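(* Let $n\ge2$. Fix $1<p\le q<\infty$ and real numbers $t,s$ with $t<s<t+n$, and let $\theta_1,\theta_2,\theta_3,\sigma_1,\sigma_2,\sigma_3\in\mathbb R$ satisfy $$-\frac{p'}{p}(\sigma_1,\sigma_2,\sigma_3)\in\mathcal A\cup\mathcal B\quad\text{and}\quad(\theta_1,\theta_2,\theta_3)\in\mathcal A\cup\mathcal B.$$ Set $\Theta:=s-t+n\left(\frac1q-\frac1p\right)$. Assume that one of the following holds: (i) $\Theta=0$ and $\dfrac{\theta_j}{q}=\dfrac{\sigma_j}{p}$ for $j=1,2,3$; or (ii) $\Theta>0$ and $$\frac{\theta_1+\theta_2+\theta_3}{q}-\frac{\sigma_1+\sigma_2+\sigma_3}{p}=-\Theta,\qquad \frac{\theta_1}{q}-\frac{\sigma_1}{p}>-\frac{n-1}{n}\,\Theta,\qquad \frac{\theta_3}{q}-\frac{\sigma_3}{p}>-\frac1n\,\Theta.$$ Then there is a constant $C>0$, depending only on $p,q,s,t,\theta_1,\theta_2,\theta_3,\sigma_1,\sigma_2,\sigma_3$ and $n$, such that $$\|D^tf\|_{L^q(u_{\theta_1,\theta_2,\theta_3})}\le C\,\|D^sf\|_{L^p(u_{\sigma_1,\sigma_2,\sigma_3})}\qquad\text{for all } f\in D^{>\tau}\mathcal S(\mathbb R^n),$$ where $\tau:=\max\{-n,-t\}$.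
   Context: Write $x=(x',x_n)\in\mathbb R^n$ with $x'=(x_1,\dots,x_{n-1})\in\mathbb R^{n-1}$. For real $\theta_1,\theta_2,\theta_3$, $u_{\theta_1,\theta_2,\theta_3}(x):=|x'|^{\theta_1}|x|^{\theta_2}|x_n|^{\theta_3}$. For a weight $w\ge0$, $\|g\|_{L^q(w)}=\left(\int_{\mathbb R^n}|g|^q w\,dx\right)^{1/q}$. $p'$ is the conjugate exponent, $1/p+1/p'=1$. $D^b$ denotes the Fourier multiplier $\widehat{D^bf}=|\cdot|^b\hat f$. The class of test functions is $D^{>\tau}\mathcal S(\mathbb R^n):=\{f\in L^\infty(\mathbb R^n): f=D^bg\text{ for some }g\in\mathcal S(\mathbb R^n)\text{ and some real } b>\tau\}$; for such $f=D^bg$, $D^tf$ and $D^sf$ are the functions with Fourier transforms $|\xi|^{t+b}\hat g(\xi)$ and $|\xi|^{s+b}\hat g(\xi)$ (here $t+b>0$ and $s+b>0$). $\mathcal A=\{(\theta_1,\theta_2,\theta_3)\in\mathbb R^3:\theta_1>-(n-1),\ \theta_2\ge0,\ \theta_3>-1\}$ and $\mathcal B=\{(\theta_1,\theta_2,\theta_3)\in\mathbb R^3:\theta_1>-(n-1),\ \theta_2<0,\ \theta_3>-1,\ \theta_1+\theta_2+\theta_3>-n\}$; equivalently $\mathcal A\cup\mathcal B=\{\theta_1>-(n-1),\ \theta_3>-1,\ \theta_1+\theta_2+\theta_3>-n\}$. *)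

theory Defs
  imports "HOL-Analysis.Analysis"
begin

text \<open>Iterated directional derivatives; along basis vectors these are the partial derivatives
  \<open>\<partial>\<^sup>\<beta> g\<close>.\<close>

primrec iter_partial ::
  "'a::euclidean_space list \<Rightarrow> ('a \<Rightarrow> complex) \<Rightarrow> 'a \<Rightarrow> complex" where
  "iter_partial [] g = g"
| "iter_partial (v # vs) g = (\<lambda>x. frechet_derivative (iter_partial vs g) (at x) v)"

text \<open>Differentiability of all iterated partial derivatives is \<open>C\<^sup>\<infinity>\<close> smoothness; it is demanded
  explicitly because \<open>frechet_derivative\<close> is unspecified at points of non-differentiability.\<close>

definition schwartz :: "('a::euclidean_space \<Rightarrow> complex) set" where
  "schwartz = {g. \<forall>vs. set vs \<subseteq> Basis \<longrightarrow>
      (\<forall>x. iter_partial vs g differentiable (at x)) \<and>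
      (\<forall>k::nat. \<exists>M. \<forall>x. norm x ^ k * norm (iter_partial vs g x) \<le> M)}"

text \<open>Normalisation with \<open>2\<pi>\<close> in the exponent, so that the inversion formula carries no constant.
  Passing to another normalisation multiplies each \<open>D\<^sup>b\<close> below by a positive constant depending
  only on \<open>b\<close>.\<close>

definition fourier :: "('a::euclidean_space \<Rightarrow> complex) \<Rightarrow> 'a \<Rightarrow> complex" where
  "fourier g \<xi> = (LINT x|lborel. cis (- 2 * pi * (x \<bullet> \<xi>)) * g x)"

definition inv_fourier :: "('a::euclidean_space \<Rightarrow> complex) \<Rightarrow> 'a \<Rightarrow> complex" where
  "inv_fourier G x = (LINT \<xi>|lborel. cis (2 * pi * (x \<bullet> \<xi>)) * G \<xi>)"

text \<open>The function with Fourier transform \<open>|\<xi>|\<^sup>b\<close> times that of \<open>g\<close>.  For a Schwartz function \<open>g\<close>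
  and \<open>b > - DIM('a)\<close> this product is integrable, so the inverse transform is an
  absolutely convergent integral.\<close>

definition D_op :: "real \<Rightarrow> ('a::euclidean_space \<Rightarrow> complex) \<Rightarrow> 'a \<Rightarrow> complex" where
  "D_op b g = inv_fourier (\<lambda>\<xi>. complex_of_real (norm \<xi> powr b) * fourier g \<xi>)"

definition Linfty :: "('a::euclidean_space \<Rightarrow> complex) set" where
  "Linfty = {f \<in> borel_measurable lebesgue. \<exists>M. AE x in lebesgue. norm (f x) \<le> M}"

text \<open>\<open>D_rep \<tau> f b g\<close>: the pair \<open>(b, g)\<close> represents \<open>f\<close> as \<open>D\<^sup>b g\<close> (almost everywhere, as
  elements of \<open>L\<^sup>\<infinity>\<close>) with \<open>b > \<tau>\<close>.  Given such a pair, \<open>D\<^sup>r f\<close> is the function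
  \<open>D_op (r + b) g\<close>.\<close>

definition D_rep ::
  "real \<Rightarrow> ('a::euclidean_space \<Rightarrow> complex) \<Rightarrow> real \<Rightarrow> ('a \<Rightarrow> complex) \<Rightarrow> bool" where
  "D_rep \<tau> f b g \<longleftrightarrow> b > \<tau> \<and> g \<in> schwartz \<and> (AE x in lebesgue. f x = D_op b g x)"

definition test_class :: "real \<Rightarrow> ('a::euclidean_space \<Rightarrow> complex) set" where
  "test_class \<tau> = {f \<in> Linfty. \<exists>b g. D_rep \<tau> f b g}"

text \<open>A point \<open>(x', x\<^sub>n)\<close> of \<open>\<real>\<^sup>n\<close> is a pair in \<open>(real^'m) \<times> real\<close>, where \<open>n = CARD('m) + 1\<close>; the
  norm of a pair is the Euclidean one.  Since \<open>0 powr \<theta> = 0\<close>, the weight vanishes on the null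
  set \<open>x' = 0 \<or> x\<^sub>n = 0\<close> whatever the exponents are.\<close>

definition u_weight ::
  "real \<Rightarrow> real \<Rightarrow> real \<Rightarrow> (real^'m::finite) \<times> real \<Rightarrow> real" where
  "u_weight \<theta>1 \<theta>2 \<theta>3 x =
     norm (fst x) powr \<theta>1 * norm x powr \<theta>2 * \<bar>snd x\<bar> powr \<theta>3"

text \<open>Real powers on \<open>[0, \<infinity>]\<close>, meant for exponents \<open>r > 0\<close>.\<close>

definition ennreal_powr :: "ennreal \<Rightarrow> real \<Rightarrow> ennreal" where
  "ennreal_powr a r = (if a = top then top else ennreal (enn2real a powr r))"

text \<open>Valued in \<open>[0, \<infinity>]\<close>: a weighted norm of a test function may be infinite.\<close>

definition weighted_norm ::
  "real \<Rightarrow> ('a::euclidean_space \<Rightarrow> real) \<Rightarrow> ('a \<Rightarrow> complex) \<Rightarrow> ennreal" where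
  "weighted_norm q w g =
     ennreal_powr (\<integral>\<^sup>+ x. ennreal (norm (g x) powr q * w x) \<partial>lborel) (1 / q)"

definition class_A :: "nat \<Rightarrow> (real \<times> real \<times> real) set" where
  "class_A n = {(\<theta>1, \<theta>2, \<theta>3). \<theta>1 > - (real n - 1) \<and> \<theta>2 \<ge> 0 \<and> \<theta>3 > - 1}"

definition class_B :: "nat \<Rightarrow> (real \<times> real \<times> real) set" where
  "class_B n = {(\<theta>1, \<theta>2, \<theta>3). \<theta>1 > - (real n - 1) \<and> \<theta>2 < 0 \<and> \<theta>3 > - 1 \<and>
     \<theta>1 + \<theta>2 + \<theta>3 > - real n}"

end

theory Submission
  imports Defs "HOL-Probability.Probability"
begin

text \<open>The operator \<open>D\<^sup>t f\<close> is, up to a constant, the Riesz potential of order \<open>s - t\<close> of \<open>D\<^sup>s f\<close>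
  (write \<open>|\<xi>|\<close> to a negative power as an integral of Gaussians), so the theorem follows from an
  \<open>L\<^sup>p\<close>--\<open>L\<^sup>q\<close> bound for the kernel \<open>\<omega>(x) |x - y|\<^sup>-\<^sup>\<mu> \<nu>(y)\<close> with \<open>\<mu> = n - (s - t)\<close> and product-type
  weights \<open>\<omega>\<close>, \<open>\<nu>\<close>.  Where \<open>|x|\<close> and \<open>|y|\<close> are not
  comparable the kernel is of Hardy type and Schur's test applies.  Where they are comparable,
  powers of \<open>|x|\<close> and \<open>|y|\<close> may be exchanged, and the hypotheses on the exponents make it possible
  to dominate the kernel by a product of a kernel in \<open>(x', y')\<close> and one in \<open>(x\<^sub>n, y\<^sub>n)\<close>, each
  covered by the Stein--Weiss inequality.\<close>

section \<open>Bilinear bounds and Schur's test\<close>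

text \<open>The hypotheses on the exponents enter in two ways. Membership in \<open>class_A\<close>
  or \<open>class_B\<close> amounts to local integrability of \<omega>^q = u_\<theta> and of the
  dual weight \<nu>^p', whose exponents are -(p'/p) \<sigma>: the total exponent serves the Hardy
  regions, the exponents of |x'| and |x_n| serve the two factors near the diagonal. Since |x' - y'|
  and |x_n - y_n| are at most |x - y|, the power |x - y|^-\<mu> is dominated by a product whose
  factors carry the shares (n - 1)/n and 1/n of \<mu>; homogeneity of each factor then forces the
  same shares of \<Theta>. The inequalities of case (ii) say that the given exponents stay below
  these shares, and the deficit is supplied by powers of |x| and |y|. Case (i) is the equality case
  \<Theta> = 0, so non-strict inequalities treat both. If \<Theta> = 0 then p < q, because s > t; if
  p = q then \<Theta> = s - t > 0. Hence the failure of the Hardy-Littlewood-Sobolev inequality at p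
  = q does no harm.\<close>

abbreviation power_integral :: "real \<Rightarrow> ('a::euclidean_space \<Rightarrow> real) \<Rightarrow> ennreal" where
  "power_integral r f \<equiv> (\<integral>\<^sup>+x. ennreal (f x powr r) \<partial>lborel)"

abbreviation bilinear_form ::
  "('a::euclidean_space \<Rightarrow> real) \<Rightarrow> ('a \<Rightarrow> 'b::euclidean_space \<Rightarrow> real) \<Rightarrow> ('b \<Rightarrow> real) \<Rightarrow> ennreal" where
  "bilinear_form f K g \<equiv> (\<integral>\<^sup>+x. \<integral>\<^sup>+y. ennreal (f x * K x y * g y) \<partial>lborel \<partial>lborel)"

text \<open>Here \<open>r\<close> is conjugate to the exponent of the target space: if \<open>1/q + 1/r = 1\<close>, the bound says that
  the integral operator with kernel \<open>K\<close> maps \<open>L\<^sup>p\<close> to \<open>L\<^sup>q\<close>.\<close>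

definition bilinear_bound_by ::
  "real \<Rightarrow> real \<Rightarrow> ('a::euclidean_space \<Rightarrow> 'b::euclidean_space \<Rightarrow> real) \<Rightarrow> real \<Rightarrow> bool" where
  "bilinear_bound_by r p K C \<longleftrightarrow> 0 \<le> C \<and> (\<forall>f g.
     f \<in> borel_measurable borel \<longrightarrow> g \<in> borel_measurable borel \<longrightarrow>
     (\<forall>x. 0 \<le> f x) \<longrightarrow> (\<forall>y. 0 \<le> g y) \<longrightarrow> power_integral r f \<le> 1 \<longrightarrow> power_integral p g \<le> 1 \<longrightarrow>
     bilinear_form f K g \<le> ennreal C)"

definition bilinear_bound ::
  "real \<Rightarrow> real \<Rightarrow> ('a::euclidean_space \<Rightarrow> 'b::euclidean_space \<Rightarrow> real) \<Rightarrow> bool" where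
  "bilinear_bound r p K \<longleftrightarrow> (\<exists>C. bilinear_bound_by r p K C)"

text \<open>Joint measurability is what Tonelli needs to exchange the two integrals; nonnegativity
  lets \<open>ennreal\<close> distribute over products and sums.\<close>

definition kernel :: "('a::euclidean_space \<Rightarrow> 'b::euclidean_space \<Rightarrow> real) \<Rightarrow> bool" where
  "kernel K \<longleftrightarrow> (\<forall>x y. 0 \<le> K x y) \<and> case_prod K \<in> borel_measurable (borel \<Otimes>\<^sub>M borel)"

lemma kernel_nonneg: "kernel K \<Longrightarrow> 0 \<le> K x y"
  by (simp add: kernel_def)

lemma kernel_measurable: "kernel K \<Longrightarrow> case_prod K \<in> borel_measurable (borel \<Otimes>\<^sub>M borel)"
  by (simp add: kernel_def)

lemma nn_integral_swap:
  fixes F :: "'a::euclidean_space \<Rightarrow> 'b::euclidean_space \<Rightarrow> ennreal"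
  assumes "case_prod F \<in> borel_measurable (borel \<Otimes>\<^sub>M borel)"
  shows "(\<integral>\<^sup>+x. \<integral>\<^sup>+y. F x y \<partial>lborel \<partial>lborel) = (\<integral>\<^sup>+y. \<integral>\<^sup>+x. F x y \<partial>lborel \<partial>lborel)"
proof -
  have "case_prod F \<in> borel_measurable (lborel \<Otimes>\<^sub>M lborel)"
    using assms by (simp cong: measurable_cong_sets sets_pair_measure_cong)
  from lborel_pair.Fubini'[OF this] show ?thesis by simp
qed

lemma bilinear_boundI:
  assumes "0 \<le> C"
    and "\<And>f g. \<lbrakk>f \<in> borel_measurable borel; g \<in> borel_measurable borel; \<And>x. 0 \<le> f x; \<And>y. 0 \<le> g y;
     power_integral r f \<le> 1; power_integral p g \<le> 1\<rbrakk> \<Longrightarrow>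
     bilinear_form f K g \<le> ennreal C"
  shows "bilinear_bound r p K"
  unfolding bilinear_bound_def bilinear_bound_by_def using assms by (intro exI[of _ C]) auto

lemma bilinear_bound_byD:
  assumes "bilinear_bound_by r p K C"
  shows "0 \<le> C"
    and "\<lbrakk>f \<in> borel_measurable borel; g \<in> borel_measurable borel; \<forall>x. 0 \<le> f x; \<forall>y. 0 \<le> g y;
     power_integral r f \<le> 1; power_integral p g \<le> 1\<rbrakk> \<Longrightarrow> bilinear_form f K g \<le> ennreal C"
  using assms unfolding bilinear_bound_by_def by blast+

text \<open>Serves the degenerate scale \<open>a = 0\<close> below: \<open>0 powr r = 0\<close>
  makes the hypothesis say that the integral vanishes, and \<open>t powr r = 0\<close> only for
  \<open>t = 0\<close>.\<close>

lemma AE_zero_of_powr_integral: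
  assumes [measurable]: "f \<in> borel_measurable (borel :: 'a::euclidean_space measure)"
    and "power_integral r f \<le> ennreal (0 powr r)"
  shows "AE x in lborel. f x = (0::real)"
proof -
  have "power_integral r f = 0" using assms(2) by simp
  then have "AE x in lborel. ennreal (f x powr r) = 0"
    by (subst (asm) nn_integral_0_iff_AE) auto
  then show ?thesis
    by eventually_elim (auto simp: ennreal_eq_0_iff powr_def split: if_splits)
qed

text \<open>The bound is assumed on unit balls only; dividing \<open>f\<close> by \<open>a\<close>
  and \<open>g\<close> by \<open>b\<close> extends it. \<open>a\<close> and \<open>b\<close> may be
  any upper bounds for the norms, zero included, which is how slice norms are inserted
  later.\<close>

lemma bilinear_bound_by_scaled:
  fixes K :: "'a::euclidean_space \<Rightarrow> 'b::euclidean_space \<Rightarrow> real"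
  assumes bb: "bilinear_bound_by r p K C" and K: "kernel K"
    and f[measurable]: "f \<in> borel_measurable borel" and g[measurable]: "g \<in> borel_measurable borel"
    and f0: "\<And>x. 0 \<le> f x" and g0: "\<And>y. 0 \<le> g y" and ab: "0 \<le> a" "0 \<le> b"
    and fa: "power_integral r f \<le> ennreal (a powr r)" and gb: "power_integral p g \<le> ennreal (b powr p)"
  shows "bilinear_form f K g \<le> ennreal (C * a * b)"
proof -
  note [measurable] = kernel_measurable[OF K]
  note C = bilinear_bound_byD(1)[OF bb] and bd = bilinear_bound_byD(2)[OF bb]
  let ?I = "\<integral>\<^sup>+x. \<integral>\<^sup>+y. ennreal (f x * K x y * g y) \<partial>lborel \<partial>lborel"
  consider "a = 0" | "b = 0" | "a > 0" "b > 0" using ab by linarith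
  then show ?thesis
  proof cases
    case 1
    have "AE x in lborel. f x = 0" using AE_zero_of_powr_integral[of f r] fa 1 by simp
    then have "AE x in lborel. (\<integral>\<^sup>+y. ennreal (f x * K x y * g y) \<partial>lborel) = 0"
      by eventually_elim simp
    then have "?I = (\<integral>\<^sup>+x. 0 \<partial>(lborel::'a measure))" by (rule nn_integral_cong_AE)
    then show ?thesis by simp
  next
    case 2
    have "AE y in lborel. g y = 0" using AE_zero_of_powr_integral[of g p] gb 2 by simp
    then have "(\<integral>\<^sup>+y. ennreal (f x * K x y * g y) \<partial>lborel) = (\<integral>\<^sup>+y. 0 \<partial>(lborel::'b measure))" for x
      by (intro nn_integral_cong_AE) (auto elim: eventually_mono)
    then show ?thesis by simp
  next
    case 3
    have sc: "(\<integral>\<^sup>+x. ennreal ((h x / c) powr s) \<partial>(lborel :: 'c::euclidean_space measure)) \<le> 1"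
      if [measurable]: "h \<in> borel_measurable borel" and h0: "\<And>x. 0 \<le> h x" and c: "c > 0"
        and hc: "power_integral s h \<le> ennreal (c powr s)" for h c s
    proof -
      have "(\<integral>\<^sup>+x. ennreal ((h x / c) powr s) \<partial>(lborel :: 'c measure)) =
          (\<integral>\<^sup>+x. ennreal (1 / c powr s) * ennreal (h x powr s) \<partial>lborel)"
        using c h0 by (intro nn_integral_cong) (simp add: powr_divide flip: ennreal_mult)
      also have "\<dots> = ennreal (1 / c powr s) * power_integral s h"
        by (rule nn_integral_cmult) auto
      also have "\<dots> \<le> ennreal (1 / c powr s) * ennreal (c powr s)"
        by (intro mult_left_mono hc) auto
      also have "\<dots> = 1" using c by (simp flip: ennreal_mult)
      finally show ?thesis .
    qed
    have le: "(\<integral>\<^sup>+x. \<integral>\<^sup>+y. ennreal (f x / a * K x y * (g y / b)) \<partial>lborel \<partial>lborel) \<le> ennreal C"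
      using 3 f0 g0 fa gb by (intro bd sc) auto
    have "?I = (\<integral>\<^sup>+x. \<integral>\<^sup>+y. ennreal (a * b) * ennreal (f x / a * K x y * (g y / b)) \<partial>lborel \<partial>lborel)"
      using 3 f0 g0 kernel_nonneg[OF K]
      by (intro nn_integral_cong) (simp flip: ennreal_mult)
    also have "\<dots> = ennreal (a * b) * (\<integral>\<^sup>+x. \<integral>\<^sup>+y. ennreal (f x / a * K x y * (g y / b)) \<partial>lborel \<partial>lborel)"
      by (simp add: nn_integral_cmult)
    also have "\<dots> \<le> ennreal (a * b) * ennreal C" by (intro mult_left_mono le) auto
    also have "\<dots> = ennreal (C * a * b)" using 3 C by (simp add: mult_ac flip: ennreal_mult)
    finally show ?thesis .
  qed
qed

lemma kernel_swap: "kernel K \<Longrightarrow> kernel (\<lambda>y x. K x y)"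
  unfolding kernel_def using measurable_compose[OF measurable_pair_swap', of "case_prod K" borel borel borel]
  by (auto simp: split_def)

lemma bilinear_bound_swap:
  assumes "bilinear_bound r p K" and K: "kernel K"
  shows "bilinear_bound p r (\<lambda>y x. K x y)"
proof -
  note [measurable] = kernel_measurable[OF K]
  obtain C where C': "bilinear_bound_by r p K C" using assms(1) unfolding bilinear_bound_def by blast
  note C = bilinear_bound_byD(1)[OF C'] and bd = bilinear_bound_byD(2)[OF C']
  show ?thesis
  proof (rule bilinear_boundI[OF C])
    fix f :: "'b \<Rightarrow> real" and g :: "'a \<Rightarrow> real"
    assume [measurable]: "f \<in> borel_measurable borel" "g \<in> borel_measurable borel"
      and *: "\<And>x. 0 \<le> f x" "\<And>y. 0 \<le> g y" "power_integral p f \<le> 1"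
       "power_integral r g \<le> 1"
    have "(\<integral>\<^sup>+y. \<integral>\<^sup>+x. ennreal (f y * K x y * g x) \<partial>lborel \<partial>lborel) =
      bilinear_form g K f"
      by (subst nn_integral_swap) (auto simp: mult_ac)
    also have "\<dots> \<le> ennreal C" using * by (intro bd) auto
    finally show "(\<integral>\<^sup>+y. \<integral>\<^sup>+x. ennreal (f y * K x y * g x) \<partial>lborel \<partial>lborel) \<le> ennreal C" .
  qed
qed

text \<open>The exceptional null set may depend on \<open>x\<close>, since the inner integral alone
  sees it. This leaves room for kernels that \<open>0 powr e = 0\<close> switches off on
  hyperplanes.\<close>

lemma bilinear_bound_mono_AE:
  fixes K L :: "'a::euclidean_space \<Rightarrow> 'b::euclidean_space \<Rightarrow> real"
  assumes "bilinear_bound r p K" and K: "kernel K" and c: "c \<ge> 0"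
    and le: "\<And>x. AE y in lborel. L x y \<le> c * K x y"
  shows "bilinear_bound r p L"
proof -
  note [measurable] = kernel_measurable[OF K]
  obtain C where C': "bilinear_bound_by r p K C" using assms(1) unfolding bilinear_bound_def by blast
  note C = bilinear_bound_byD(1)[OF C'] and bd = bilinear_bound_byD(2)[OF C']
  show ?thesis
  proof (rule bilinear_boundI)
    show "0 \<le> c * C" using c C by simp
    fix f :: "'a \<Rightarrow> real" and g :: "'b \<Rightarrow> real"
    assume [measurable]: "f \<in> borel_measurable borel" "g \<in> borel_measurable borel"
      and *: "\<And>x. 0 \<le> f x" "\<And>y. 0 \<le> g y" "power_integral r f \<le> 1"
       "power_integral p g \<le> 1"
    have "bilinear_form f L g \<le>
      (\<integral>\<^sup>+x. \<integral>\<^sup>+y. ennreal c * ennreal (f x * K x y * g y) \<partial>lborel \<partial>lborel)"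
    proof (rule nn_integral_mono, rule nn_integral_mono_AE)
      fix x :: 'a
      show "AE y in lborel. ennreal (f x * L x y * g y) \<le> ennreal c * ennreal (f x * K x y * g y)"
        using le[of x]
      proof eventually_elim
        case (elim y)
        have "f x * L x y * g y \<le> f x * (c * K x y) * g y"
          using * elim by (intro mult_right_mono mult_left_mono) auto
        then show ?case
          using c * kernel_nonneg[OF K] by (auto simp: mult_ac intro!: ennreal_leI simp flip: ennreal_mult)
      qed
    qed
    also have "\<dots> = ennreal c * bilinear_form f K g"
      by (simp add: nn_integral_cmult)
    also have "\<dots> \<le> ennreal c * ennreal C" using * by (intro mult_left_mono bd) auto
    finally show "bilinear_form f L g \<le> ennreal (c * C)"
      using c C by (simp add: ennreal_mult)
  qed
qed

lemma bilinear_bound_mono: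
  assumes "bilinear_bound r p K" "kernel K" "c \<ge> 0" "\<And>x y. L x y \<le> c * K x y"
  shows "bilinear_bound r p L"
  using assms by (intro bilinear_bound_mono_AE[of r p K c L]) auto

lemma kernel_add: "kernel K \<Longrightarrow> kernel L \<Longrightarrow> kernel (\<lambda>x y. K x y + L x y)"
  unfolding kernel_def by (auto simp: measurable_split_conv)

lemma bilinear_bound_add:
  fixes K L :: "'a::euclidean_space \<Rightarrow> 'b::euclidean_space \<Rightarrow> real"
  assumes "bilinear_bound r p K" and K: "kernel K" and "bilinear_bound r p L" and L: "kernel L"
  shows "bilinear_bound r p (\<lambda>x y. K x y + L x y)"
proof -
  note [measurable] = kernel_measurable[OF K] kernel_measurable[OF L]
  obtain C where C': "bilinear_bound_by r p K C" using assms(1) unfolding bilinear_bound_def by blast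
  note C = bilinear_bound_byD(1)[OF C'] and bd = bilinear_bound_byD(2)[OF C']
  obtain D where D': "bilinear_bound_by r p L D" using assms(3) unfolding bilinear_bound_def by blast
  note D = bilinear_bound_byD(1)[OF D'] and bd' = bilinear_bound_byD(2)[OF D']
  show ?thesis
  proof (rule bilinear_boundI)
    show "0 \<le> C + D" using C D by simp
    fix f :: "'a \<Rightarrow> real" and g :: "'b \<Rightarrow> real"
    assume [measurable]: "f \<in> borel_measurable borel" "g \<in> borel_measurable borel"
      and *: "\<And>x. 0 \<le> f x" "\<And>y. 0 \<le> g y" "power_integral r f \<le> 1"
       "power_integral p g \<le> 1"
    have "(\<integral>\<^sup>+x. \<integral>\<^sup>+y. ennreal (f x * (K x y + L x y) * g y) \<partial>lborel \<partial>lborel) =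
      (\<integral>\<^sup>+x. \<integral>\<^sup>+y. ennreal (f x * K x y * g y) + ennreal (f x * L x y * g y) \<partial>lborel \<partial>lborel)"
      using * by (intro nn_integral_cong)
        (simp add: algebra_simps kernel_nonneg[OF K] kernel_nonneg[OF L] flip: ennreal_plus)
    also have "\<dots> = bilinear_form f K g +
        bilinear_form f L g"
      by (simp add: nn_integral_add)
    also have "\<dots> \<le> ennreal C + ennreal D" using * by (intro add_mono bd bd') auto
    finally show "(\<integral>\<^sup>+x. \<integral>\<^sup>+y. ennreal (f x * (K x y + L x y) * g y) \<partial>lborel \<partial>lborel) \<le> ennreal (C + D)"
      using C D by simp
  qed
qed

section \<open>Schur's test with unequal exponents\<close>

text \<open>Each base is at most the maximum and the exponents add up to 1. No sharp constant is
  wanted, so the maximum is bounded by the sum.\<close>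

lemma powr_weighted_le_sum:
  fixes X Y Z a b c :: real
  assumes "0 \<le> X" "0 \<le> Y" "0 \<le> Z" "0 \<le> a" "0 \<le> b" "0 \<le> c" "a + b + c = 1"
  shows "X powr a * Y powr b * Z powr c \<le> X + Y + Z"
proof -
  define M where "M = max X (max Y Z)"
  have "X powr a * Y powr b * Z powr c \<le> M powr a * M powr b * M powr c"
    using assms by (intro mult_mono powr_mono2) (auto simp: M_def)
  also have "\<dots> = M" using assms by (simp add: M_def flip: powr_add)
  also have "\<dots> \<le> X + Y + Z" using assms by (auto simp: M_def)
  finally show ?thesis .
qed

text \<open>The classical test is the case \<open>1/p + 1/r = 1\<close>.  In general \<open>f K g\<close> is at most
  \<open>(g\<^sup>p K\<^sub>1)\<^sup>a (f\<^sup>r K\<^sub>2)\<^sup>b (f\<^sup>r g\<^sup>p)\<^sup>c\<close> with \<open>a = 1 - 1/r\<close>, \<open>b = 1 - 1/p\<close>, \<open>c = 1/p + 1/r - 1\<close>, and the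
  three factors have bounded integrals.\<close>

lemma schur_test:
  fixes K :: "'a::euclidean_space \<Rightarrow> 'b::euclidean_space \<Rightarrow> real"
  assumes rp: "r > 1" "p > 1" "1 / p + 1 / r \<ge> 1"
    and K1: "kernel K1" and K2: "kernel K2" and c: "c \<ge> 0"
    and le: "\<And>x y. K x y \<le> K1 x y powr (1 - 1 / r) * K2 x y powr (1 - 1 / p)"
    and c1: "\<And>y. (\<integral>\<^sup>+x. ennreal (K1 x y) \<partial>lborel) \<le> ennreal c"
    and c2: "\<And>x. (\<integral>\<^sup>+y. ennreal (K2 x y) \<partial>lborel) \<le> ennreal c"
  shows "bilinear_bound r p K"
proof (rule bilinear_boundI)
  note [measurable] = kernel_measurable[OF K1] kernel_measurable[OF K2]
  note nn = kernel_nonneg[OF K1] kernel_nonneg[OF K2]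
  show "0 \<le> c + c + 1" using c by simp
  fix f :: "'a \<Rightarrow> real" and g :: "'b \<Rightarrow> real"
  assume [measurable]: "f \<in> borel_measurable borel" "g \<in> borel_measurable borel"
    and f0: "\<And>x. 0 \<le> f x" and g0: "\<And>y. 0 \<le> g y" 
    and f1: "power_integral r f \<le> 1"
    and g1: "power_integral p g \<le> 1"
  define X where "X x y = g y powr p * K1 x y" for x y
  define Y where "Y x y = f x powr r * K2 x y" for x y
  define Z where "Z x y = f x powr r * g y powr p" for x y
  have [measurable]: "case_prod X \<in> borel_measurable (borel \<Otimes>\<^sub>M borel)"
    "case_prod Y \<in> borel_measurable (borel \<Otimes>\<^sub>M borel)" "case_prod Z \<in> borel_measurable (borel \<Otimes>\<^sub>M borel)"
    unfolding X_def Y_def Z_def by measurable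
  have XYZ: "0 \<le> X x y" "0 \<le> Y x y" "0 \<le> Z x y" for x y using nn by (auto simp: X_def Y_def Z_def)
  have pt: "f x * K x y * g y \<le> X x y + Y x y + Z x y" for x y
  proof (cases "f x = 0 \<or> g y = 0")
    case True
    then show ?thesis using XYZ[of x y] by auto
  next
    case False
    then have pos: "f x > 0" "g y > 0" using f0[of x] g0[of y] by auto
    let ?a = "1 - 1 / r" and ?b = "1 - 1 / p" and ?c = "1 / p + 1 / r - 1"
    \<comment> \<open>With \<open>?b + ?c = 1 / r\<close> and \<open>?a + ?c = 1 / p\<close>, the
      powers of \<open>f\<close> in \<open>Y\<close>, \<open>Z\<close> and those of \<open>g\<close>
      in \<open>X\<close>, \<open>Z\<close> recombine to exactly \<open>f x\<close> and
      \<open>g y\<close>.\<close>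
    have 1: "r * ?b + r * ?c = 1" "p * ?a + p * ?c = 1" using rp by (auto simp: field_simps)
    have "f x * K x y * g y \<le> f x * (K1 x y powr ?a * K2 x y powr ?b) * g y"
      using pos le by simp
    also have "\<dots> = f x powr (r * ?b + r * ?c) * g y powr (p * ?a + p * ?c) * (K1 x y powr ?a * K2 x y powr ?b)"
      unfolding 1 using pos by simp
    also have "\<dots> = X x y powr ?a * Y x y powr ?b * Z x y powr ?c"
      using pos nn by (simp add: X_def Y_def Z_def powr_mult powr_powr powr_add)
    also have "\<dots> \<le> X x y + Y x y + Z x y"
      using rp XYZ by (intro powr_weighted_le_sum) auto
    finally show ?thesis .
  qed
  have IX: "(\<integral>\<^sup>+x. \<integral>\<^sup>+y. ennreal (X x y) \<partial>lborel \<partial>lborel) \<le> ennreal c"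
  proof -
    have "(\<integral>\<^sup>+x. \<integral>\<^sup>+y. ennreal (X x y) \<partial>lborel \<partial>lborel) = (\<integral>\<^sup>+y. \<integral>\<^sup>+x. ennreal (X x y) \<partial>lborel \<partial>lborel)"
      by (rule nn_integral_swap) simp
    also have "\<dots> = (\<integral>\<^sup>+y. ennreal (g y powr p) * (\<integral>\<^sup>+x. ennreal (K1 x y) \<partial>lborel) \<partial>lborel)"
      by (simp add: X_def ennreal_mult nn nn_integral_cmult)
    also have "\<dots> \<le> (\<integral>\<^sup>+y. ennreal (g y powr p) * ennreal c \<partial>lborel)"
      by (intro nn_integral_mono mult_left_mono c1) auto
    also have "\<dots> = power_integral p g * ennreal c"
      by (rule nn_integral_multc) auto
    also have "\<dots> \<le> 1 * ennreal c" by (intro mult_right_mono g1) auto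
    finally show ?thesis by simp
  qed
  have IY: "(\<integral>\<^sup>+x. \<integral>\<^sup>+y. ennreal (Y x y) \<partial>lborel \<partial>lborel) \<le> ennreal c"
  proof -
    have "(\<integral>\<^sup>+x. \<integral>\<^sup>+y. ennreal (Y x y) \<partial>lborel \<partial>lborel) = (\<integral>\<^sup>+x. ennreal (f x powr r) * (\<integral>\<^sup>+y. ennreal (K2 x y) \<partial>lborel) \<partial>lborel)"
      by (simp add: Y_def ennreal_mult nn nn_integral_cmult)
    also have "\<dots> \<le> (\<integral>\<^sup>+x. ennreal (f x powr r) * ennreal c \<partial>lborel)"
      by (intro nn_integral_mono mult_left_mono c2) auto
    also have "\<dots> = power_integral r f * ennreal c"
      by (rule nn_integral_multc) auto
    also have "\<dots> \<le> 1 * ennreal c" by (intro mult_right_mono f1) auto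
    finally show ?thesis by simp
  qed
  have IZ: "(\<integral>\<^sup>+x. \<integral>\<^sup>+y. ennreal (Z x y) \<partial>lborel \<partial>lborel) \<le> 1"
  proof -
    have "(\<integral>\<^sup>+x. \<integral>\<^sup>+y. ennreal (Z x y) \<partial>lborel \<partial>lborel) =
       power_integral r f * power_integral p g"
      by (simp add: Z_def ennreal_mult nn_integral_cmult nn_integral_multc)
    also have "\<dots> \<le> 1 * 1" by (intro mult_mono f1 g1) auto
    finally show ?thesis by simp
  qed
  have "bilinear_form f K g \<le>
    (\<integral>\<^sup>+x. \<integral>\<^sup>+y. ennreal (X x y) + ennreal (Y x y) + ennreal (Z x y) \<partial>lborel \<partial>lborel)"
    using XYZ pt by (intro nn_integral_mono) (auto intro: ennreal_leI simp flip: ennreal_plus)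
  also have "\<dots> = (\<integral>\<^sup>+x. \<integral>\<^sup>+y. ennreal (X x y) \<partial>lborel \<partial>lborel) +
    (\<integral>\<^sup>+x. \<integral>\<^sup>+y. ennreal (Y x y) \<partial>lborel \<partial>lborel) + (\<integral>\<^sup>+x. \<integral>\<^sup>+y. ennreal (Z x y) \<partial>lborel \<partial>lborel)"
    by (simp add: nn_integral_add)
  also have "\<dots> \<le> ennreal c + ennreal c + 1" by (intro add_mono IX IY IZ)
  also have "\<dots> = ennreal c + ennreal c + ennreal 1" by simp
  also have "\<dots> = ennreal (c + c + 1)" using c by (simp flip: ennreal_plus del: ennreal_1)
  finally show "bilinear_form f K g \<le> ennreal (c + c + 1)" .
qed

lemma nn_integral_dilate:
  fixes f :: "'a::euclidean_space \<Rightarrow> ennreal"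
  assumes [measurable]: "f \<in> borel_measurable borel" and c: "c > 0"
  shows "(\<integral>\<^sup>+x. f x \<partial>lborel) = ennreal (c ^ DIM('a)) * (\<integral>\<^sup>+x. f (c *\<^sub>R x) \<partial>lborel)"
  using c by (subst lborel_affine[of c 0]) (simp_all add: nn_integral_density nn_integral_distr nn_integral_cmult)

lemma nn_integral_reflect:
  fixes f :: "'a::euclidean_space \<Rightarrow> ennreal"
  assumes [measurable]: "f \<in> borel_measurable borel"
  shows "(\<integral>\<^sup>+y. f (x - y) \<partial>lborel) = (\<integral>\<^sup>+y. f y \<partial>lborel)"
  by (subst (2) lborel_affine[of "-1" x]) (simp_all add: nn_integral_density nn_integral_distr)

abbreviation outer_integral :: "('a::euclidean_space \<Rightarrow> real) \<Rightarrow> real \<Rightarrow> ennreal" where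
  "outer_integral W \<rho> \<equiv> (\<integral>\<^sup>+x. ennreal (W x) * indicator {x. \<rho> \<le> norm x} x \<partial>lborel)"

abbreviation inner_integral :: "('a::euclidean_space \<Rightarrow> real) \<Rightarrow> real \<Rightarrow> ennreal" where
  "inner_integral W \<rho> \<equiv> (\<integral>\<^sup>+x. ennreal (W x) * indicator {x. norm x < \<rho>} x \<partial>lborel)"

section \<open>Homogeneous weights and Hardy-type kernels\<close>

abbreviation annulus_integral :: "('a::euclidean_space \<Rightarrow> real) \<Rightarrow> ennreal" where
  "annulus_integral W \<equiv> (\<integral>\<^sup>+x. ennreal (W x) * indicator {x. 1 \<le> norm x \<and> norm x < 2} x \<partial>lborel)"

text \<open>A finite integral over one dyadic annulus takes the place of integrability on the unit
  sphere, so that no polar coordinates are needed. The value at 0 is fixed because dyadic shells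
  miss the origin; it agrees with \<open>0 powr m = 0\<close>.\<close>

definition homogeneous_weight :: "real \<Rightarrow> ('a::euclidean_space \<Rightarrow> real) \<Rightarrow> bool" where
  "homogeneous_weight e W \<longleftrightarrow> W \<in> borel_measurable borel \<and> (\<forall>x. 0 \<le> W x) \<and> W 0 = 0 \<and>
     (\<forall>c>0. \<forall>x. W (c *\<^sub>R x) = c powr e * W x) \<and>
     (annulus_integral W) < \<infinity>"

lemma homogeneous_weightD:
  assumes "homogeneous_weight e W"
  shows "W \<in> borel_measurable borel" "0 \<le> W x" "W 0 = 0" "c > 0 \<Longrightarrow> W (c *\<^sub>R x) = c powr e * W x"
    "(annulus_integral W) < \<infinity>"
  using assms by (auto simp: homogeneous_weight_def)

text \<open>Finiteness is tested on the annulus alone, where the new factor is at most 2^|m|. This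
  freedom to shift the degree produces the test kernels of the Hardy bound.\<close>

lemma homogeneous_weight_mult_norm_powr:
  fixes W :: "'a::euclidean_space \<Rightarrow> real"
  assumes "homogeneous_weight e W"
  shows "homogeneous_weight (e + m) (\<lambda>x. W x * norm x powr m)"
proof -
  note W = homogeneous_weightD[OF assms]
  note [measurable] = W(1)
  have "(\<integral>\<^sup>+x. ennreal (W x * norm x powr m) * indicator {x. 1 \<le> norm x \<and> norm x < 2} x \<partial>lborel)
     \<le> (\<integral>\<^sup>+x. ennreal (2 powr \<bar>m\<bar>) * (ennreal (W x) * indicator {x. 1 \<le> norm x \<and> norm x < 2} x) \<partial>lborel)"
  proof (rule nn_integral_mono)
    fix x :: 'a
    have "norm x powr m \<le> 2 powr \<bar>m\<bar>" if "1 \<le> norm x" "norm x < 2"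
    proof -
      have "norm x powr m \<le> norm x powr \<bar>m\<bar>" using that by (intro powr_mono) auto
      also have "\<dots> \<le> 2 powr \<bar>m\<bar>" using that by (intro powr_mono2) auto
      finally show ?thesis .
    qed
    then show "ennreal (W x * norm x powr m) * indicator {x. 1 \<le> norm x \<and> norm x < 2} x
       \<le> ennreal (2 powr \<bar>m\<bar>) * (ennreal (W x) * indicator {x. 1 \<le> norm x \<and> norm x < 2} x)"
      using W(2)[of x] by (auto simp: indicator_def mult.commute mult_left_mono simp flip: ennreal_mult intro!: ennreal_leI)
  qed
  also have "\<dots> = ennreal (2 powr \<bar>m\<bar>) * (annulus_integral W)"
    by (rule nn_integral_cmult) auto
  also have "\<dots> < \<infinity>" using W(5) by (auto simp: ennreal_mult_less_top)
  finally show ?thesis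
    using W(2,3,4) unfolding homogeneous_weight_def by (auto simp: powr_add powr_mult)
qed

lemma homogeneous_weight_norm_powr:
  "homogeneous_weight m (\<lambda>x::'a::euclidean_space. norm x powr m)"
proof -
  \<comment> \<open>The constant 1, of degree 0, corrected at the origin to meet
    \<open>W 0 = 0\<close>.\<close>
  let ?W = "\<lambda>x::'a. if x = 0 then 0 else (1::real)"
  have "(\<integral>\<^sup>+x. ennreal (?W x) * indicator {x. 1 \<le> norm x \<and> norm x < 2} x \<partial>lborel)
     \<le> (\<integral>\<^sup>+x. indicator (ball (0::'a) 2) x \<partial>lborel)"
    by (intro nn_integral_mono) (auto simp: indicator_def)
  also have "\<dots> < \<infinity>" using emeasure_lborel_ball_finite[of "0::'a" 2] by simp
  finally have "homogeneous_weight 0 ?W"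
    unfolding homogeneous_weight_def by auto
  from homogeneous_weight_mult_norm_powr[OF this, of m]
  have "homogeneous_weight m (\<lambda>x::'a. ?W x * norm x powr m)" by simp
  also have "(\<lambda>x::'a. ?W x * norm x powr m) = (\<lambda>x. norm x powr m)" by auto
  finally show ?thesis .
qed

section \<open>Dyadic summation of homogeneous weights\<close>

lemma homogeneous_weight_shell:
  fixes W :: "'a::euclidean_space \<Rightarrow> real"
  assumes "homogeneous_weight e W" and s: "s > 0"
  shows "(\<integral>\<^sup>+x. ennreal (W x) * indicator {x. s \<le> norm x \<and> norm x < 2 * s} x \<partial>lborel) =
     ennreal (s powr (e + DIM('a))) *
     (annulus_integral W)"
proof -
  note W = homogeneous_weightD[OF assms(1)]
  note [measurable] = W(1)
  have "(\<integral>\<^sup>+x. ennreal (W x) * indicator {x. s \<le> norm x \<and> norm x < 2 * s} x \<partial>lborel) =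
    ennreal (s ^ DIM('a)) * (\<integral>\<^sup>+x. ennreal (W (s *\<^sub>R x)) * indicator {x. s \<le> norm x \<and> norm x < 2 * s} (s *\<^sub>R x) \<partial>lborel)"
    using s by (subst nn_integral_dilate[of _ s]) auto
  also have "(\<integral>\<^sup>+x. ennreal (W (s *\<^sub>R x)) * indicator {x. s \<le> norm x \<and> norm x < 2 * s} (s *\<^sub>R x) \<partial>lborel) =
    (\<integral>\<^sup>+x. ennreal (s powr e) * (ennreal (W x) * indicator {x. 1 \<le> norm x \<and> norm x < 2} x) \<partial>lborel)"
    using s W(2) by (intro nn_integral_cong) (auto simp: W(4) ennreal_mult indicator_def)
  also have "\<dots> = ennreal (s powr e) * (annulus_integral W)"
    by (rule nn_integral_cmult) auto
  finally show ?thesis using s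
    by (simp add: powr_add powr_realpow ennreal_mult mult_ac)
qed

text \<open>Common core of the integrals near infinity and near the origin: each shell contributes
  \<open>s k powr (e + N)\<close> times the annulus integral, with N the dimension, and the
  contributions form a geometric series of ratio \<open>z\<close>.\<close>

lemma homogeneous_weight_dyadic:
  fixes W :: "'a::euclidean_space \<Rightarrow> real" and s :: "nat \<Rightarrow> real"
  assumes hw: "homogeneous_weight e W" and s: "\<And>k. s k > 0"
    and S: "S \<in> sets borel" "\<And>x. x \<in> S \<Longrightarrow> \<exists>k. s k \<le> norm x \<and> norm x < 2 * s k"
    and B: "B \<ge> 0" "\<And>k. s k powr (e + DIM('a)) \<le> B * z ^ k" and z: "0 \<le> z" "z < 1"
  shows "(\<integral>\<^sup>+x. ennreal (W x) * indicator S x \<partial>lborel) \<le>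
    ennreal (enn2real (annulus_integral W) / (1 - z) * B)"
proof -
  note W = homogeneous_weightD[OF hw]
  note [measurable] = W(1)
  define A where "A = enn2real (annulus_integral W)"
  have A: "(annulus_integral W) = ennreal A" "A \<ge> 0"
    using W(5) by (auto simp: A_def)
  define T where "T k = {x::'a. s k \<le> norm x \<and> norm x < 2 * s k}" for k
  have [measurable]: "T k \<in> sets borel" for k unfolding T_def by measurable
  have "(\<integral>\<^sup>+x. ennreal (W x) * indicator S x \<partial>lborel) \<le> (\<integral>\<^sup>+x. (\<Sum>k. ennreal (W x) * indicator (T k) x) \<partial>lborel)"
  proof (rule nn_integral_mono)
    fix x :: 'a
    show "ennreal (W x) * indicator S x \<le> (\<Sum>k. ennreal (W x) * indicator (T k) x)"
    proof (cases "x \<in> S")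
      case True
      then obtain k where "x \<in> T k" using S(2) by (auto simp: T_def)
      then have "ennreal (W x) * indicator S x = (\<Sum>k\<in>{k}. ennreal (W x) * indicator (T k) x)"
        using True by simp
      also have "\<dots> \<le> (\<Sum>k. ennreal (W x) * indicator (T k) x)"
        by (rule sum_le_suminf) auto
      finally show ?thesis .
    qed simp
  qed
  also have "\<dots> = (\<Sum>k. \<integral>\<^sup>+x. ennreal (W x) * indicator (T k) x \<partial>lborel)"
    by (rule nn_integral_suminf) measurable
  also have "\<dots> = (\<Sum>k. ennreal (s k powr (e + DIM('a))) * ennreal A)"
    unfolding T_def by (simp only: homogeneous_weight_shell[OF hw s] A(1))
  also have "\<dots> \<le> (\<Sum>k. ennreal (B * z ^ k * A))"
  proof (intro suminf_le)
    fix k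
    have "s k powr (e + DIM('a)) * A \<le> B * z ^ k * A" by (intro mult_right_mono B A)
    then show "ennreal (s k powr (e + DIM('a))) * ennreal A \<le> ennreal (B * z ^ k * A)"
      by (simp add: A(2) ennreal_leI flip: ennreal_mult)
  qed auto
  also have "\<dots> = ennreal (A / (1 - z) * B)"
  proof -
    have sm: "(\<lambda>k. B * z ^ k * A) sums (B * (1 / (1 - z)) * A)"
      using z by (intro sums_mult sums_mult2 geometric_sums) auto
    have "(\<Sum>k. ennreal (B * z ^ k * A)) = ennreal (B * (1 / (1 - z)) * A)"
      using B A(2) z sm by (subst suminf_ennreal2) (auto simp: sums_iff)
    then show ?thesis by (simp add: mult_ac)
  qed
  finally show ?thesis unfolding A_def .
qed

lemma dyadic_scale:
  assumes "t > (0::real)"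
  obtains j :: int where "2 powr (real_of_int j) \<le> t" "t < 2 * 2 powr (real_of_int j)"
proof -
  define j where "j = \<lfloor>log 2 t\<rfloor>"
  have t: "2 powr log 2 t = t" using assms by simp
  have "2 powr j \<le> 2 powr log 2 t" by (rule powr_mono) (auto simp: j_def)
  moreover have "2 powr log 2 t < 2 powr (j + 1)" by (rule powr_less_mono) (auto simp: j_def)
  ultimately show thesis using that[of j] unfolding t by (simp add: powr_add)
qed

lemma homogeneous_weight_outside:
  fixes W :: "'a::euclidean_space \<Rightarrow> real"
  assumes hw: "homogeneous_weight e W" and e: "e + DIM('a) < 0"
  obtains C where "C \<ge> 0"
    "\<And>\<rho>. \<rho> > 0 \<Longrightarrow> outer_integral W \<rho> \<le> ennreal (C * \<rho> powr (e + DIM('a)))"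
proof
  let ?E = "e + DIM('a)"
  define z where "z = 2 powr ?E"
  have z: "0 \<le> z" "z < 1" using e by (auto simp: z_def powr_less_one)
  let ?C = "enn2real (annulus_integral W) / (1 - z)"
  show "?C \<ge> 0" using z by simp
  fix \<rho> :: real assume \<rho>: "\<rho> > 0"
  show "outer_integral W \<rho> \<le> ennreal (?C * \<rho> powr ?E)"
  proof (rule homogeneous_weight_dyadic[OF hw, of "\<lambda>k. \<rho> * 2 powr real k"])
    fix x :: 'a assume "x \<in> {x. \<rho> \<le> norm x}"
    then have x: "norm x / \<rho> \<ge> 1" using \<rho> by simp
    then obtain j where j: "2 powr real_of_int j \<le> norm x / \<rho>" "norm x / \<rho> < 2 * 2 powr real_of_int j" using dyadic_scale[of "norm x / \<rho>"] by auto
    have "2 powr 0 < 2 powr (real_of_int j + 1)" using x j(2) by (simp add: powr_add)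
    then have "j \<ge> 0" by (subst (asm) powr_less_cancel_iff) auto
    then show "\<exists>k. \<rho> * 2 powr real k \<le> norm x \<and> norm x < 2 * (\<rho> * 2 powr real k)"
      using j \<rho> by (intro exI[of _ "nat j"]) (auto simp: field_simps)
  next
    fix k show "(\<rho> * 2 powr real k) powr ?E \<le> \<rho> powr ?E * z ^ k"
      using \<rho> by (simp add: powr_mult z_def powr_powr powr_power mult_ac)
  qed (use \<rho> z in auto)
qed

lemma homogeneous_weight_inside:
  fixes W :: "'a::euclidean_space \<Rightarrow> real"
  assumes hw: "homogeneous_weight e W" and e: "e + DIM('a) > 0"
  obtains C where "C \<ge> 0"
    "\<And>\<rho>. \<rho> > 0 \<Longrightarrow> inner_integral W \<rho> \<le> ennreal (C * \<rho> powr (e + DIM('a)))"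
proof
  let ?E = "e + DIM('a)"
  define z where "z = 2 powr - ?E"
  have z: "0 \<le> z" "z < 1" using e by (auto simp: z_def powr_less_one)
  let ?C = "enn2real (annulus_integral W) / (1 - z)"
  show "?C \<ge> 0" using z by simp
  fix \<rho> :: real assume \<rho>: "\<rho> > 0"
  \<comment> \<open>No shell contains the origin, which is dropped because
    \<open>W 0 = 0\<close>.\<close>
  have "inner_integral W \<rho> =
     (\<integral>\<^sup>+x. ennreal (W x) * indicator {x. x \<noteq> 0 \<and> norm x < \<rho>} x \<partial>lborel)"
    using homogeneous_weightD(3)[OF hw] by (intro nn_integral_cong) (auto simp: indicator_def)
  \<comment> \<open>The outermost shell has to be \<rho>/2 <= |x| < \<rho>, hence the exponent
    \<open>- real k - 1\<close>; the surplus factor \<open>z\<close> that it produces is at most 1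
    and is discarded.\<close>
  also have "\<dots> \<le> ennreal (?C * \<rho> powr ?E)"
  proof (rule homogeneous_weight_dyadic[OF hw, of "\<lambda>k. \<rho> * 2 powr (- real k - 1)"])
    fix x :: 'a assume "x \<in> {x. x \<noteq> 0 \<and> norm x < \<rho>}"
    then have x: "norm x / \<rho> > 0" "norm x / \<rho> < 1" using \<rho> by auto
    then obtain j where j: "2 powr real_of_int j \<le> norm x / \<rho>" "norm x / \<rho> < 2 * 2 powr real_of_int j"
      using dyadic_scale[of "norm x / \<rho>"] by auto
    have "2 powr (real_of_int j) < 2 powr 0" using x(2) j(1) by simp
    then have "j < 0" by (subst (asm) powr_less_cancel_iff) auto
    define k where "k = nat (- j - 1)"
    have jk: "real_of_int j = - real k - 1" using \<open>j < 0\<close> by (simp add: k_def)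
    show "\<exists>k. \<rho> * 2 powr (- real k - 1) \<le> norm x \<and> norm x < 2 * (\<rho> * 2 powr (- real k - 1))"
      using j[unfolded jk] \<rho> by (intro exI[of _ k]) (simp add: pos_le_divide_eq pos_divide_less_eq mult_ac)
  next
    fix k
    have "(\<rho> * 2 powr (- real k - 1)) powr ?E = \<rho> powr ?E * (z ^ k * z)"
    proof -
      have "z ^ k * z = 2 powr (- ?E * real k + - ?E)" by (simp only: powr_add z_def powr_power) (simp add: powr_power mult_ac)
      also have "- ?E * real k + - ?E = (- real k - 1) * ?E" by (simp add: algebra_simps)
      finally show ?thesis using \<rho> by (simp only: powr_mult powr_powr)
    qed
    also have "\<dots> \<le> \<rho> powr ?E * z ^ k" using z by (intro mult_left_mono mult_right_le_one_le) auto
    finally show "(\<rho> * 2 powr (- real k - 1)) powr ?E \<le> \<rho> powr ?E * z ^ k" .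
  qed (use \<rho> z in auto)
  finally show "inner_integral W \<rho> \<le> ennreal (?C * \<rho> powr ?E)" .
qed

section \<open>Hardy kernels and reduction to comparable norms\<close>

text \<open>The degree \<open>e\<close> is that of \<omega> itself, while integrability is imposed
  on \<omega>^s: Schur's test uses \<omega>^r' and \<nu>^p', and the kernel contains \<omega> and
  \<nu>.\<close>

definition homogeneous_root :: "real \<Rightarrow> real \<Rightarrow> ('a::euclidean_space \<Rightarrow> real) \<Rightarrow> bool" where
  "homogeneous_root s e \<omega> \<longleftrightarrow> \<omega> \<in> borel_measurable borel \<and> (\<forall>x. 0 \<le> \<omega> x) \<and>
     homogeneous_weight (e * s) (\<lambda>x. \<omega> x powr s)"

lemma homogeneous_rootD:
  assumes "homogeneous_root s e \<omega>"
  shows "\<omega> \<in> borel_measurable borel" "0 \<le> \<omega> x" "homogeneous_weight (e * s) (\<lambda>x. \<omega> x powr s)" "\<omega> 0 = 0"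
proof -
  show *: "homogeneous_weight (e * s) (\<lambda>x. \<omega> x powr s)" and "\<omega> \<in> borel_measurable borel" "0 \<le> \<omega> x"
    using assms by (auto simp: homogeneous_root_def)
  show "\<omega> 0 = 0" using homogeneous_weightD(3)[OF *] by simp
qed

lemma homogeneous_root_norm_powr: "homogeneous_root s e (\<lambda>x::'a::euclidean_space. norm x powr e)"
  unfolding homogeneous_root_def using homogeneous_weight_norm_powr[of "e * s"] by (simp add: powr_powr)

text \<open>Model for the region where |x| dominates and |x - y| may be replaced by |x|. The
  condition on \<open>\<Gamma>\<close> is integrability of \<nu>^p' at the origin; by
  \<open>hom\<close> it also makes \<omega>^r' |x|^(-\<mu> r') integrable at infinity.\<close>

lemma bilinear_bound_hardy:
  fixes \<omega> \<nu> :: "'a::euclidean_space \<Rightarrow> real"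
  assumes rp: "r > 1" "p > 1" "1 / p + 1 / r \<ge> 1" "1 / r + 1 / r' = 1" "1 / p + 1 / p' = 1"
    and \<omega>: "homogeneous_root r' (- B) \<omega>" and \<nu>: "homogeneous_root p' (- \<Gamma>) \<nu>"
    and \<Gamma>: "\<Gamma> < DIM('a) / p'"
    and hom: "B + \<Gamma> + \<mu> = DIM('a) * (2 - 1 / p - 1 / r)"
  shows "bilinear_bound r p (\<lambda>x y. if norm y < norm x then \<omega> x * norm x powr (- \<mu>) * \<nu> y else 0)"
proof -
  let ?N = "real DIM('a)"
  have conj: "1 - 1 / r = 1 / r'" "1 - 1 / p = 1 / p'" using rp by linarith+
  have "1 / r < 1" "1 / p < 1" using rp(1,2) by (simp_all add: divide_simps)
  then have "1 / r' > 0" "1 / p' > 0" using conj by linarith+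
  then have pos: "r' > 0" "p' > 0" by (simp_all add: zero_less_divide_iff)
  \<comment> \<open>Schur's test with \<open>K\<^sub>1 = \<omega>(x)\<^sup>r\<^sup>' |x|\<^sup>m |y|\<^sup>l\<close> and \<open>K\<^sub>2 = \<nu>(y)\<^sup>p\<^sup>' |x|\<^sup>k |y|\<^sup>k\<close>: the room \<open>\<epsilon>\<close> in the integrability
    of \<open>\<nu>\<close> at the origin is shared equally between the two.\<close>
  define \<epsilon> where "\<epsilon> = ?N / p' - \<Gamma>"
  have \<epsilon>: "\<epsilon> > 0" using \<Gamma> by (simp add: \<epsilon>_def)
  define l1 where "l1 = r' * \<epsilon> / 2"
  define l2 where "l2 = - p' * \<epsilon> / 2"
  define m1 where "m1 = r' * B - ?N - l1"
  note W = homogeneous_rootD[OF \<omega>] and V = homogeneous_rootD[OF \<nu>]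
  note [measurable] = W(1) V(1)
  \<comment> \<open>\<open>m1\<close> is chosen to make the integral of \<open>K1\<close> in
    \<open>x\<close> scale invariant: its total degree is \<open>- l1\<close>, compensated by the
    factor |y|^l1. The sign of \<open>l1\<close> gives convergence at infinity, that of
    \<open>- l2\<close> below convergence at the origin.\<close>
  have "- B * r' + m1 + ?N = - l1" by (simp add: m1_def)
  moreover have "l1 > 0" using \<epsilon> pos by (simp add: l1_def)
  ultimately have e1: "- B * r' + m1 + ?N = - l1" "- B * r' + m1 + ?N < 0" by linarith+
  obtain C1 where C1: "C1 \<ge> 0" "\<And>\<rho>. \<rho> > 0 \<Longrightarrow>
     outer_integral (\<lambda>x. \<omega> x powr r' * norm x powr m1) \<rho> \<le> ennreal (C1 * \<rho> powr (- l1))"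
    using homogeneous_weight_outside[OF homogeneous_weight_mult_norm_powr[OF W(3)] e1(2)] unfolding e1(1) by blast
  have "- \<Gamma> * p' + l2 + ?N = - l2" using pos by (simp add: l2_def \<epsilon>_def field_simps)
  moreover have "- l2 > 0" using \<epsilon> pos by (simp add: l2_def)
  ultimately have e2: "- \<Gamma> * p' + l2 + ?N = - l2" "- \<Gamma> * p' + l2 + ?N > 0" by linarith+
  obtain C2 where C2: "C2 \<ge> 0" "\<And>\<rho>. \<rho> > 0 \<Longrightarrow>
     inner_integral (\<lambda>x. \<nu> x powr p' * norm x powr l2) \<rho> \<le> ennreal (C2 * \<rho> powr (- l2))"
    using homogeneous_weight_inside[OF homogeneous_weight_mult_norm_powr[OF V(3)] e2(2)] unfolding e2(1) by blast
  define K1 where "K1 x y = (if y \<noteq> 0 \<and> norm y < norm x then \<omega> x powr r' * norm x powr m1 * norm y powr l1 else 0)" for x y :: 'a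
  define K2 where "K2 x y = (if y \<noteq> 0 \<and> norm y < norm x then \<nu> y powr p' * norm y powr l2 * norm x powr l2 else 0)" for x y :: 'a
  show ?thesis
  proof (rule schur_test[where ?K1.0 = K1 and ?K2.0 = K2 and c = "max C1 C2"])
    show "kernel K1" "kernel K2" unfolding kernel_def K1_def K2_def by auto
    show "0 \<le> max C1 C2" using C1 by simp
    fix x y :: 'a
    show "(if norm y < norm x then \<omega> x * norm x powr (- \<mu>) * \<nu> y else 0) \<le> K1 x y powr (1 - 1 / r) * K2 x y powr (1 - 1 / p)"
    proof (cases "y \<noteq> 0 \<and> norm y < norm x")
      case True
      then have x: "norm x > 0" using norm_ge_zero[of y] by linarith
      \<comment> \<open>\<open>hom\<close> fixes the exponent of |x|. The powers of |y| cancel later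
        because \<open>l1 / r'\<close> and \<open>l2 / p'\<close> are \<epsilon>/2 and
        -\<epsilon>/2.\<close>
      have e: "m1 / r' + l2 / p' = - \<mu>"
      proof -
        have "2 - 1 / p - 1 / r = 1 / r' + 1 / p'" using conj by linarith
        then have "?N * (2 - 1 / p - 1 / r) = ?N / r' + ?N / p'" by (simp add: distrib_left)
        then have "\<mu> = ?N / r' + ?N / p' - B - \<Gamma>" using hom by linarith
        moreover have "m1 / r' = B - ?N / r' - \<epsilon> / 2" "l2 / p' = - (\<epsilon> / 2)" using pos by (simp_all add: m1_def l1_def l2_def field_simps)
        ultimately show ?thesis using \<epsilon>_def by linarith
      qed
      have "K1 x y powr (1 - 1 / r) * K2 x y powr (1 - 1 / p) =
        \<omega> x * norm x powr (m1 / r' + l2 / p') * \<nu> y * norm y powr (l1 / r' + l2 / p')"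
        unfolding K1_def K2_def conj using True W(2) V(2) pos
        by (simp add: powr_mult powr_powr powr_add powr_one_gt_zero_iff)
      also have "l1 / r' + l2 / p' = 0" using pos by (simp add: l1_def l2_def)
      finally show ?thesis using True by (simp add: e)
    next
      case False
      then show ?thesis using V(4) by (auto simp: K1_def K2_def)
    qed
  next
    fix y :: 'a
    show "(\<integral>\<^sup>+x. ennreal (K1 x y) \<partial>lborel) \<le> ennreal (max C1 C2)"
    proof (cases "y = 0")
      case False
      have "(\<integral>\<^sup>+x. ennreal (K1 x y) \<partial>lborel) \<le> (\<integral>\<^sup>+x. ennreal (norm y powr l1) *
         (ennreal (\<omega> x powr r' * norm x powr m1) * indicator {x. norm y \<le> norm x} x) \<partial>lborel)"
        using False by (intro nn_integral_mono) (auto simp: K1_def indicator_def mult_ac simp flip: ennreal_mult)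
      also have "\<dots> = ennreal (norm y powr l1) * outer_integral (\<lambda>x. \<omega> x powr r' * norm x powr m1) (norm y)"
        by (rule nn_integral_cmult) auto
      also have "\<dots> \<le> ennreal (norm y powr l1) * ennreal (C1 * norm y powr (- l1))"
        using False by (intro mult_left_mono C1) auto
      also have "\<dots> = ennreal C1" using False C1(1) by (simp add: powr_minus field_simps flip: ennreal_mult)
      finally show ?thesis by (rule order_trans) (simp add: ennreal_leI)
    qed (simp add: K1_def)
  next
    fix x :: 'a
    show "(\<integral>\<^sup>+y. ennreal (K2 x y) \<partial>lborel) \<le> ennreal (max C1 C2)"
    proof (cases "x = 0")
      case False
      have "(\<integral>\<^sup>+y. ennreal (K2 x y) \<partial>lborel) \<le> (\<integral>\<^sup>+y. ennreal (norm x powr l2) *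
         (ennreal (\<nu> y powr p' * norm y powr l2) * indicator {y. norm y < norm x} y) \<partial>lborel)"
        by (intro nn_integral_mono) (auto simp: K2_def indicator_def mult_ac simp flip: ennreal_mult)
      also have "\<dots> = ennreal (norm x powr l2) * inner_integral (\<lambda>y. \<nu> y powr p' * norm y powr l2) (norm x)"
        by (rule nn_integral_cmult) auto
      also have "\<dots> \<le> ennreal (norm x powr l2) * ennreal (C2 * norm x powr (- l2))"
        using False by (intro mult_left_mono C2) auto
      also have "\<dots> = ennreal C2" using False C2(1) by (simp add: powr_minus field_simps flip: ennreal_mult)
      finally show ?thesis by (rule order_trans) (simp add: ennreal_leI)
    qed (simp add: K2_def)
  qed (use rp in auto)
qed

text \<open>If one norm exceeds twice the other, |x - y| is at least half the larger norm, so the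
  kernel is at most a Hardy kernel or a transposed one. Only the region of comparable norms is left,
  which is the hypothesis \<open>diag\<close>.\<close>

lemma bilinear_bound_localize:
  fixes \<omega> \<nu> :: "'a::euclidean_space \<Rightarrow> real"
  assumes rp: "r > 1" "p > 1" "1 / p + 1 / r \<ge> 1" "1 / r + 1 / r' = 1" "1 / p + 1 / p' = 1"
    and \<omega>: "homogeneous_root r' (- B) \<omega>" and \<nu>: "homogeneous_root p' (- \<Gamma>) \<nu>"
    and B: "B < DIM('a) / r'" and \<Gamma>: "\<Gamma> < DIM('a) / p'"
    and hom: "B + \<Gamma> + \<mu> = DIM('a) * (2 - 1 / p - 1 / r)" and \<mu>: "\<mu> > 0"
    and diag: "bilinear_bound r p (\<lambda>x y. if norm x \<le> 2 * norm y \<and> norm y \<le> 2 * norm x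
                 then \<omega> x * norm (x - y) powr (- \<mu>) * \<nu> y else 0)"
  shows "bilinear_bound r p (\<lambda>x y. \<omega> x * norm (x - y) powr (- \<mu>) * \<nu> y)"
proof -
  note W = homogeneous_rootD[OF \<omega>] and V = homogeneous_rootD[OF \<nu>]
  note [measurable] = W(1) V(1)
  define H where "H x y = (if norm y < norm x then \<omega> x * norm x powr (- \<mu>) * \<nu> y else 0)" for x y
  define H' where "H' y x = (if norm x < norm y then \<nu> y * norm y powr (- \<mu>) * \<omega> x else 0)" for x y
  define D where "D x y = (if norm x \<le> 2 * norm y \<and> norm y \<le> 2 * norm x
                 then \<omega> x * norm (x - y) powr (- \<mu>) * \<nu> y else 0)" for x y
  have k: "kernel H" "kernel H'" "kernel D"
    unfolding kernel_def H_def H'_def D_def using W(2) V(2) by auto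
  have "bilinear_bound r p H" unfolding H_def
    by (rule bilinear_bound_hardy[OF rp \<omega> \<nu> \<Gamma> hom])
  \<comment> \<open>The transposed kernel is of the same type with weights and exponents
    interchanged; this is where the bound on \<open>B\<close> enters.\<close>
  moreover have "bilinear_bound p r H'" unfolding H'_def
    using rp hom by (intro bilinear_bound_hardy[OF _ _ _ _ _ \<nu> \<omega> B]) (auto simp: algebra_simps)
  then have "bilinear_bound r p (\<lambda>x y. H' y x)" using k(2) by (rule bilinear_bound_swap)
  moreover have "bilinear_bound r p D" using diag unfolding D_def .
  ultimately have bb: "bilinear_bound r p (\<lambda>x y. H x y + H' y x + D x y)"
    using k(1,3) kernel_swap[OF k(2)] by (intro bilinear_bound_add kernel_add)
  show ?thesis
  proof (rule bilinear_bound_mono[OF bb])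
    show "kernel (\<lambda>x y. H x y + H' y x + D x y)" using k(1,3) kernel_swap[OF k(2)] by (intro kernel_add)
    show "(0::real) \<le> 2 powr \<mu>" by simp
    fix x y :: 'a
    let ?K = "\<omega> x * norm (x - y) powr (- \<mu>) * \<nu> y"
    have nn: "0 \<le> H x y" "0 \<le> H' y x" "0 \<le> D x y" using k by (auto intro: kernel_nonneg)
    have far: "norm (x - y) powr (- \<mu>) \<le> 2 powr \<mu> * s powr (- \<mu>)" if "s > 0" "s \<le> 2 * norm (x - y)" for s
    proof -
      have "norm (x - y) powr (- \<mu>) \<le> (s / 2) powr (- \<mu>)" using that \<mu> by (intro powr_mono2') auto
      also have "\<dots> = 2 powr \<mu> * s powr (- \<mu>)" using that by (simp add: powr_divide powr_minus field_simps)
      finally show ?thesis .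
    qed
    consider "norm x \<le> 2 * norm y" "norm y \<le> 2 * norm x" | "norm x > 2 * norm y" | "norm y > 2 * norm x" by linarith
    then have "?K \<le> 2 powr \<mu> * H x y \<or> ?K \<le> 2 powr \<mu> * H' y x \<or> ?K \<le> 2 powr \<mu> * D x y"
    proof cases
      case 1
      have "1 * D x y \<le> 2 powr \<mu> * D x y" using nn \<mu> by (intro mult_right_mono) (auto intro: ge_one_powr_ge_zero)
      then show ?thesis using 1 by (simp add: D_def)
    next
      case 2
      have x: "norm x > 0" "norm y < norm x" using 2 norm_ge_zero[of y] by linarith+
      have "norm x \<le> 2 * norm (x - y)" using 2 norm_triangle_ineq2[of x y] by linarith
      from far[OF x(1) this] have "?K \<le> \<omega> x * (2 powr \<mu> * norm x powr (- \<mu>)) * \<nu> y"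
        by (intro mult_right_mono mult_left_mono W V)
      then show ?thesis using x by (simp add: H_def mult_ac)
    next
      case 3
      have y: "norm y > 0" "norm x < norm y" using 3 norm_ge_zero[of x] by linarith+
      have "norm y \<le> 2 * norm (x - y)" using 3 norm_triangle_ineq2[of y x] by (simp add: norm_minus_commute)
      from far[OF y(1) this] have "?K \<le> \<omega> x * (2 powr \<mu> * norm y powr (- \<mu>)) * \<nu> y"
        by (intro mult_right_mono mult_left_mono W V)
      then show ?thesis using y by (simp add: H'_def mult_ac)
    qed
    moreover have "2 powr \<mu> * H x y \<ge> 0" "2 powr \<mu> * H' y x \<ge> 0" "2 powr \<mu> * D x y \<ge> 0" using nn by auto
    ultimately show "?K \<le> 2 powr \<mu> * (H x y + H' y x + D x y)"
      unfolding distrib_left by linarith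
  qed
qed

section \<open>The Hardy--Littlewood--Sobolev and Stein--Weiss inequalities\<close>

lemma powr_young_le_sum:
  fixes X Y a b :: real
  assumes "0 \<le> X" "0 \<le> Y" "0 \<le> a" "0 \<le> b" "a + b = 1"
  shows "X powr a * Y powr b \<le> X + Y"
proof -
  have "X powr a * Y powr b \<le> max X Y powr a * max X Y powr b"
    using assms by (intro mult_mono powr_mono2) auto
  also have "\<dots> = max X Y" using assms by (simp flip: powr_add)
  also have "\<dots> \<le> X + Y" using assms by auto
  finally show ?thesis .
qed

abbreviation truncated_potential :: "real \<Rightarrow> ('a::euclidean_space \<Rightarrow> real) \<Rightarrow> real \<Rightarrow> 'a \<Rightarrow> ennreal" where
  "truncated_potential \<mu> g L x \<equiv> (\<integral>\<^sup>+y. ennreal ((if g y \<le> L then g y else 0) * norm (x - y) powr (- \<mu>)) \<partial>lborel)"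

text \<open>Split at a radius \<open>R\<close>: near \<open>x\<close> use that the truncated
  function is at most \<open>L\<close>, and \<open>\<mu> < N\<close> for the dimension N; far from
  \<open>x\<close> use the p-norm of \<open>g\<close>, and \<open>\<mu> * p' > N\<close> for the
  tail of the kernel.\<close>

lemma riesz_potential_truncated:
  fixes \<mu> p p' :: real
  assumes p: "p > 1" "1 / p + 1 / p' = 1" and \<mu>: "0 < \<mu>" "\<mu> < DIM('a)" "\<mu> * p' > DIM('a)"
  obtains C where "C \<ge> 0"
    "\<And>g L x. \<lbrakk>g \<in> borel_measurable borel; \<And>y::'a::euclidean_space. 0 \<le> g y;
        power_integral p g \<le> 1; 0 < L\<rbrakk> \<Longrightarrow>
      truncated_potential \<mu> g L x
        \<le> ennreal (C * L powr (1 - p + p * \<mu> / DIM('a)))"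
proof -
  let ?N = "real DIM('a)"
  define \<kappa> where "\<kappa> = 1 - p + p * \<mu> / ?N"
  have conj: "1 / p' = 1 - 1 / p" using p by linarith
  have "1 / p < 1" using p(1) by simp
  then have "1 / p' > 0" using conj by linarith
  then have p'0: "p' > 0" by (simp add: zero_less_divide_iff)
  have pp: "p * p' = p + p'" using p p'0 by (simp add: field_simps)
  obtain C1 where C1: "C1 \<ge> 0" "\<And>\<rho>. \<rho> > 0 \<Longrightarrow>
     inner_integral (\<lambda>x::'a. norm x powr (- \<mu>)) \<rho> \<le> ennreal (C1 * \<rho> powr (- \<mu> + ?N))"
    using homogeneous_weight_inside[OF homogeneous_weight_norm_powr[of "- \<mu>"]] \<mu> by auto
  obtain C2 where C2: "C2 \<ge> 0" "\<And>\<rho>. \<rho> > 0 \<Longrightarrow>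
     outer_integral (\<lambda>x::'a. norm x powr (- \<mu> * p')) \<rho> \<le> ennreal (C2 * \<rho> powr (- \<mu> * p' + ?N))"
    using homogeneous_weight_outside[OF homogeneous_weight_norm_powr[of "- \<mu> * p'"]] \<mu> by auto
  show thesis
  proof (rule that[of "C1 + 1 + C2"])
    show "C1 + 1 + C2 \<ge> 0" using C1 C2 by simp
    fix g :: "'a \<Rightarrow> real" and L :: real and x :: 'a
    assume g[measurable]: "g \<in> borel_measurable borel" and g0: "\<And>y. 0 \<le> g y"
      and g1: "power_integral p g \<le> 1" and L: "L > 0"
    \<comment> \<open>\<open>R\<close> balances the two parts: with N = \<open>?N\<close> it solves
      \<open>L * R powr (N - \<mu>) = R powr (N / p' - \<mu>)\<close>, the bound by \<open>L\<close>
      inside against Hoelder outside.\<close>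
    define R where "R = L powr (- p / ?N)"
    \<comment> \<open>Hoelder is replaced by Young's inequality with weight \<open>T\<close>, set to
      the expected size of the result, so that \<open>T\<close> times the integral of g^p is already
      of the right order.\<close>
    define T where "T = L powr \<kappa>"
    have R: "R > 0" and T: "T > 0" using L by (auto simp: R_def T_def)
    define A where "A y = norm (x - y) powr (- \<mu>) * indicator {z. norm z < R} (x - y)" for y
    define E where "E y = norm (x - y) powr (- \<mu> * p') * indicator {z. R \<le> norm z} (x - y)" for y
    have [measurable]: "A \<in> borel_measurable borel" "E \<in> borel_measurable borel"
      unfolding A_def E_def by measurable
    have pt: "(if g y \<le> L then g y else 0) * norm (x - y) powr (- \<mu>) \<le> L * A y + (T * g y powr p + T powr (- p' / p) * E y)" for y
    proof (cases "norm (x - y) < R")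
      case True
      have "(if g y \<le> L then g y else 0) * norm (x - y) powr (- \<mu>) \<le> L * A y"
        using True L by (auto simp: A_def intro: mult_right_mono)
      also have "\<dots> \<le> L * A y + (T * g y powr p + T powr (- p' / p) * E y)" using T by (auto simp: E_def)
      finally show ?thesis .
    next
      case False
      have "(if g y \<le> L then g y else 0) * norm (x - y) powr (- \<mu>) \<le> g y * norm (x - y) powr (- \<mu>)"
        using g0[of y] by (auto intro: mult_right_mono)
      also have "\<dots> = (T * g y powr p) powr (1 / p) * (T powr (- p' / p) * norm (x - y) powr (- \<mu> * p')) powr (1 / p')"
      proof -
        have "T powr (1 / p) * T powr (- p' / p * (1 / p')) = 1" using T p'0 by (simp flip: powr_add)
        then show ?thesis using g0[of y] T p p'0 by (simp add: powr_mult powr_powr)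
      qed
      also have "\<dots> \<le> T * g y powr p + T powr (- p' / p) * norm (x - y) powr (- \<mu> * p')"
        using p p'0 T by (intro powr_young_le_sum) auto
      also have "\<dots> \<le> L * A y + (T * g y powr p + T powr (- p' / p) * E y)" using False L by (auto simp: E_def A_def)
      finally show ?thesis .
    qed
    have nn: "0 \<le> A y" "0 \<le> E y" for y by (auto simp: A_def E_def)
    have IA: "(\<integral>\<^sup>+y. ennreal (A y) \<partial>lborel) \<le> ennreal (C1 * R powr (- \<mu> + ?N))"
    proof -
      have "(\<integral>\<^sup>+y. ennreal (A y) \<partial>lborel) = inner_integral (\<lambda>z::'a. norm z powr (- \<mu>)) R"
        unfolding A_def by (subst nn_integral_reflect[symmetric, of _ x]) (auto intro!: nn_integral_cong simp: indicator_def)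
      also have "\<dots> \<le> ennreal (C1 * R powr (- \<mu> + ?N))" by (rule C1(2)[OF R])
      finally show ?thesis .
    qed
    have IE: "(\<integral>\<^sup>+y. ennreal (E y) \<partial>lborel) \<le> ennreal (C2 * R powr (- \<mu> * p' + ?N))"
    proof -
      have "(\<integral>\<^sup>+y. ennreal (E y) \<partial>lborel) = outer_integral (\<lambda>z::'a. norm z powr (- \<mu> * p')) R"
        unfolding E_def by (subst nn_integral_reflect[symmetric, of _ x]) (auto intro!: nn_integral_cong simp: indicator_def)
      also have "\<dots> \<le> ennreal (C2 * R powr (- \<mu> * p' + ?N))" by (rule C2(2)[OF R])
      finally show ?thesis .
    qed
    have eA: "L * R powr (- \<mu> + ?N) = L powr \<kappa>"
    proof -
      have "L * R powr (- \<mu> + ?N) = L powr (1 + (- p / ?N) * (- \<mu> + ?N))"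
        unfolding powr_add[of L 1 "(- p / ?N) * (- \<mu> + ?N)"] R_def powr_powr using L by simp
      also have "1 + (- p / ?N) * (- \<mu> + ?N) = \<kappa>" by (simp add: \<kappa>_def field_simps)
      finally show ?thesis .
    qed
    have eE: "T powr (- p' / p) * R powr (- \<mu> * p' + ?N) = L powr \<kappa>"
    proof -
      have "T powr (- p' / p) * R powr (- \<mu> * p' + ?N) = L powr (\<kappa> * (- p' / p) + (- p / ?N) * (- \<mu> * p' + ?N))"
        unfolding powr_add[of L "\<kappa> * (- p' / p)" "(- p / ?N) * (- \<mu> * p' + ?N)"] R_def T_def powr_powr by simp
      also have "\<kappa> * (- p' / p) + (- p / ?N) * (- \<mu> * p' + ?N) = \<kappa>"
      proof -
        have e: "- p' / p = - (p' - 1)" using pp p by (simp add: field_simps)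
        have e1: "(- p / ?N) * (- \<mu> * p' + ?N) = \<mu> / ?N * (p * p') - p" by (simp add: field_simps)
        have e2: "\<mu> / ?N * (p * p') - p = \<kappa> * p'" by (simp add: \<kappa>_def pp algebra_simps)
        show ?thesis unfolding e e1 e2 by (simp add: algebra_simps)
      qed
      finally show ?thesis .
    qed
    have "truncated_potential \<mu> g L x \<le>
      (\<integral>\<^sup>+y. ennreal L * ennreal (A y) + (ennreal T * ennreal (g y powr p) + ennreal (T powr (- p' / p)) * ennreal (E y)) \<partial>lborel)"
    proof (rule nn_integral_mono)
      fix y
      show "ennreal ((if g y \<le> L then g y else 0) * norm (x - y) powr (- \<mu>)) \<le>
        ennreal L * ennreal (A y) + (ennreal T * ennreal (g y powr p) + ennreal (T powr (- p' / p)) * ennreal (E y))"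
        using ennreal_leI[OF pt[of y]] L T nn by (simp add: ennreal_mult)
    qed
    also have "\<dots> = ennreal L * (\<integral>\<^sup>+y. ennreal (A y) \<partial>lborel) + (ennreal T * power_integral p g +
        ennreal (T powr (- p' / p)) * (\<integral>\<^sup>+y. ennreal (E y) \<partial>lborel))"
      by (simp add: nn_integral_add nn_integral_cmult)
    also have "\<dots> \<le> ennreal L * ennreal (C1 * R powr (- \<mu> + ?N)) + (ennreal T * 1 +
        ennreal (T powr (- p' / p)) * ennreal (C2 * R powr (- \<mu> * p' + ?N)))"
      by (intro add_mono mult_left_mono IA IE g1) auto
    also have "\<dots> = ennreal (C1 * (L * R powr (- \<mu> + ?N)) + (T + C2 * (T powr (- p' / p) * R powr (- \<mu> * p' + ?N))))"
      using C1(1) C2(1) L T by (simp add: mult_ac flip: ennreal_mult ennreal_plus)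
    also have "\<dots> = ennreal ((C1 + 1 + C2) * L powr \<kappa>)"
      unfolding eA eE unfolding T_def by (simp add: algebra_simps)
    finally show "truncated_potential \<mu> g L x
        \<le> ennreal ((C1 + 1 + C2) * L powr (1 - p + p * \<mu> / ?N))" unfolding \<kappa>_def .
  qed
qed

text \<open>No maximal function is needed: on the part where \<open>g(y)\<^sup>p \<le> f(x)\<^sup>r\<close> the truncated potential of \<open>g\<close> is at
  most a constant times \<open>f(x)\<^sup>r\<^sup>-\<^sup>1\<close>, and the other part is symmetric.\<close>

theorem hardy_littlewood_sobolev:
  fixes r p \<mu> :: real
  assumes rp: "r > 1" "p > 1" "1 / p + 1 / r > 1" and \<mu>: "\<mu> = DIM('a) * (2 - 1 / p - 1 / r)"
  shows "bilinear_bound r p (\<lambda>x y :: 'a::euclidean_space. norm (x - y) powr (- \<mu>))"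
proof -
  let ?N = "real DIM('a)"
  define p' where "p' = p / (p - 1)"
  define r' where "r' = r / (r - 1)"
  have conj: "1 / p + 1 / p' = 1" "1 / r + 1 / r' = 1" using rp by (auto simp: p'_def r'_def field_simps)
  have pos: "p' > 0" "r' > 0" using rp by (auto simp: p'_def r'_def)
  have m2: "\<mu> / ?N = 2 - 1 / p - 1 / r" using \<mu> by simp
  have N0: "?N > 0" by simp
  have "1 / p < 1" "1 / r < 1" using rp by simp_all
  then have "0 < 2 - 1 / p - 1 / r" "2 - 1 / p - 1 / r < 1" using rp by linarith+
  then have \<mu>N: "0 < \<mu>" "\<mu> < ?N" unfolding \<mu> using N0 by (auto intro!: mult_pos_pos simp: mult_less_cancel_left2)
  have dual: "\<mu> * p' > ?N" "\<mu> * r' > ?N"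
  proof -
    \<comment> \<open>\<mu> divided by the dimension is the sum of \<open>1 / p'\<close> and
      \<open>1 / r'\<close>, hence larger than either.\<close>
    have eq: "2 - 1 / p - 1 / r = 1 / p' + 1 / r'" using conj by linarith
    have "(1 / p' + 1 / r') * p' = 1 + p' / r'" "(1 / p' + 1 / r') * r' = 1 + r' / p'"
      using pos by (simp_all add: field_simps)
    moreover have "p' / r' > 0" "r' / p' > 0" using pos by auto
    ultimately have "(1 / p' + 1 / r') * p' > 1" "(1 / p' + 1 / r') * r' > 1" by linarith+
    then show "\<mu> * p' > ?N" "\<mu> * r' > ?N"
      unfolding \<mu> eq using N0 by (simp_all add: mult.assoc)
  qed
  obtain C where C: "C \<ge> 0"
    "\<And>g L x. \<lbrakk>g \<in> borel_measurable borel; \<And>y::'a. 0 \<le> g y;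
        power_integral p g \<le> 1; 0 < L\<rbrakk> \<Longrightarrow>
      truncated_potential \<mu> g L x
        \<le> ennreal (C * L powr (1 - p + p * \<mu> / ?N))"
    by (rule riesz_potential_truncated[OF rp(2) conj(1) \<mu>N dual(1)]) blast
  obtain D where D: "D \<ge> 0"
    "\<And>g L x. \<lbrakk>g \<in> borel_measurable borel; \<And>y::'a. 0 \<le> g y;
        power_integral r g \<le> 1; 0 < L\<rbrakk> \<Longrightarrow>
      truncated_potential \<mu> g L x
        \<le> ennreal (D * L powr (1 - r + r * \<mu> / ?N))"
    by (rule riesz_potential_truncated[OF rp(1) conj(2) \<mu>N dual(2)]) blast
  \<comment> \<open>One half of the splitting, used for (a, b) = (r, p) and (p, r). At the level L =
    f(x)^(a/b) the truncated potential is at most E f(x)^(a-1); multiplication by f(x) leaves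
    f(x)^a, whose integral is at most 1.\<close>
  have half: "(\<integral>\<^sup>+x. \<integral>\<^sup>+y. ennreal (f x * ((if g y \<le> f x powr (a / b) then g y else 0) * norm (x - y) powr (- \<mu>))) \<partial>lborel \<partial>lborel)
      \<le> ennreal E"
    if [measurable]: "f \<in> borel_measurable borel" "g \<in> borel_measurable borel"
      and f0: "\<And>x::'a. 0 \<le> f x" and f1: "power_integral a f \<le> 1"
      and ab: "a > 0" "b > 0" "1 - b + b * \<mu> / ?N = b * (1 - 1 / a)" and E: "E \<ge> 0"
      and le: "\<And>L x. 0 < L \<Longrightarrow> truncated_potential \<mu> g L x
        \<le> ennreal (E * L powr (1 - b + b * \<mu> / ?N))" for f g a b E
  proof -
    have "(\<integral>\<^sup>+y. ennreal (f x * ((if g y \<le> f x powr (a / b) then g y else 0) * norm (x - y) powr (- \<mu>))) \<partial>lborel)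
       \<le> ennreal E * ennreal (f x powr a)" for x
    proof (cases "f x = 0")
      case False
      then have fx: "f x > 0" using f0[of x] by simp
      have "(\<integral>\<^sup>+y. ennreal (f x * ((if g y \<le> f x powr (a / b) then g y else 0) * norm (x - y) powr (- \<mu>))) \<partial>lborel)
        = ennreal (f x) * truncated_potential \<mu> g (f x powr (a / b)) x"
        using fx by (simp add: ennreal_mult' nn_integral_cmult)
      also have "\<dots> \<le> ennreal (f x) * ennreal (E * (f x powr (a / b)) powr (1 - b + b * \<mu> / ?N))"
        using fx by (intro mult_left_mono le) auto
      also have "\<dots> = ennreal (E * (f x * f x powr (a / b * (b * (1 - 1 / a)))))"
        unfolding ab(3) powr_powr using fx E by (simp add: mult_ac flip: ennreal_mult)
      also have "f x * f x powr (a / b * (b * (1 - 1 / a))) = f x powr (1 + a / b * (b * (1 - 1 / a)))"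
        using fx by (simp add: powr_add)
      also have "1 + a / b * (b * (1 - 1 / a)) = a" using ab(1,2) by (simp add: field_simps)
      finally show ?thesis using E by (simp add: ennreal_mult)
    qed simp
    then have "(\<integral>\<^sup>+x. \<integral>\<^sup>+y. ennreal (f x * ((if g y \<le> f x powr (a / b) then g y else 0) * norm (x - y) powr (- \<mu>))) \<partial>lborel \<partial>lborel)
      \<le> (\<integral>\<^sup>+x. ennreal E * ennreal (f x powr a) \<partial>lborel)" by (intro nn_integral_mono) auto
    also have "\<dots> = ennreal E * power_integral a f" by (rule nn_integral_cmult) auto
    also have "\<dots> \<le> ennreal E * 1" by (intro mult_left_mono f1) auto
    finally show ?thesis by simp
  qed
  have ex: "1 - p + p * \<mu> / ?N = p * (1 - 1 / r)" "1 - r + r * \<mu> / ?N = r * (1 - 1 / p)"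
  proof -
    have "p * \<mu> / ?N = p * (2 - 1 / p - 1 / r)" "r * \<mu> / ?N = r * (2 - 1 / p - 1 / r)"
      unfolding m2[symmetric] by simp_all
    then show "1 - p + p * \<mu> / ?N = p * (1 - 1 / r)" "1 - r + r * \<mu> / ?N = r * (1 - 1 / p)"
      using rp by (simp_all add: algebra_simps)
  qed
  show ?thesis
  proof (rule bilinear_boundI)
    show "0 \<le> C + D" using C D by simp
    fix f g :: "'a \<Rightarrow> real"
    assume fm[measurable]: "f \<in> borel_measurable borel" and gm[measurable]: "g \<in> borel_measurable borel"
      and f0: "\<And>x. 0 \<le> f x" and g0: "\<And>y. 0 \<le> g y" 
      and f1: "power_integral r f \<le> 1"
      and g1: "power_integral p g \<le> 1"
    define F where "F x y = f x * ((if g y \<le> f x powr (r / p) then g y else 0) * norm (x - y) powr (- \<mu>))" for x y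
    define G where "G y x = g y * ((if f x \<le> g y powr (p / r) then f x else 0) * norm (y - x) powr (- \<mu>))" for x y
    have nn: "0 \<le> F x y" "0 \<le> G y x" for x y using f0 g0 by (auto simp: F_def G_def)
    have [measurable]: "case_prod F \<in> borel_measurable (borel \<Otimes>\<^sub>M borel)"
      "case_prod G \<in> borel_measurable (borel \<Otimes>\<^sub>M borel)"
      unfolding F_def G_def by measurable
    have pt: "f x * norm (x - y) powr (- \<mu>) * g y \<le> F x y + G y x" for x y
    proof (cases "g y \<le> f x powr (r / p)")
      case True
      then show ?thesis using nn(2)[of y x] by (simp add: F_def mult_ac)
    next
      case False
      then have "(f x powr (r / p)) powr (p / r) \<le> g y powr (p / r)" using rp by (intro powr_mono2) auto
      then have "f x \<le> g y powr (p / r)" using rp f0 by (simp add: powr_powr)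
      then show ?thesis using nn(1)[of x y] by (simp add: G_def mult_ac norm_minus_commute)
    qed
    have "(\<integral>\<^sup>+x. \<integral>\<^sup>+y. ennreal (f x * norm (x - y) powr (- \<mu>) * g y) \<partial>lborel \<partial>lborel)
      \<le> (\<integral>\<^sup>+x. \<integral>\<^sup>+y. ennreal (F x y) + ennreal (G y x) \<partial>lborel \<partial>lborel)"
      using pt nn by (intro nn_integral_mono) (auto intro: ennreal_leI simp flip: ennreal_plus)
    also have "\<dots> = (\<integral>\<^sup>+x. \<integral>\<^sup>+y. ennreal (F x y) \<partial>lborel \<partial>lborel) + (\<integral>\<^sup>+x. \<integral>\<^sup>+y. ennreal (G y x) \<partial>lborel \<partial>lborel)"
      by (simp add: nn_integral_add)
    also have "(\<integral>\<^sup>+x. \<integral>\<^sup>+y. ennreal (G y x) \<partial>lborel \<partial>lborel) = (\<integral>\<^sup>+y. \<integral>\<^sup>+x. ennreal (G y x) \<partial>lborel \<partial>lborel)"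
      by (rule nn_integral_swap) measurable
    also have "(\<integral>\<^sup>+x. \<integral>\<^sup>+y. ennreal (F x y) \<partial>lborel \<partial>lborel) + \<dots> \<le> ennreal C + ennreal D"
      unfolding F_def G_def using rp ex C(1) D(1) f0 g0 f1 g1
      by (intro add_mono half C(2) D(2)) auto
    finally show "(\<integral>\<^sup>+x. \<integral>\<^sup>+y. ennreal (f x * norm (x - y) powr (- \<mu>) * g y) \<partial>lborel \<partial>lborel) \<le> ennreal (C + D)"
      using C(1) D(1) by simp
  qed
qed

section \<open>The Stein-Weiss inequality for power weights\<close>

lemma powr_comparable:
  fixes a b e :: real
  assumes "0 \<le> a" "0 \<le> b" "a \<le> 2 * b" "b \<le> 2 * a"
  shows "b powr e \<le> 2 powr \<bar>e\<bar> * a powr e"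
proof (cases "a = 0")
  case True
  then show ?thesis using assms by auto
next
  case False
  then have pos: "a > 0" "b > 0" using assms by auto
  show ?thesis
  proof (cases "e \<ge> 0")
    case True
    have "b powr e \<le> (2 * a) powr e" using True assms by (intro powr_mono2) auto
    then show ?thesis using True pos by (simp add: powr_mult)
  next
    case False
    have "b powr e \<le> (a / 2) powr e" using False assms pos by (intro powr_mono2') auto
    also have "\<dots> = 2 powr (- e) * a powr e" using pos by (simp add: powr_divide powr_minus_divide)
    finally show ?thesis using False by simp
  qed
qed

text \<open>For comparable norms the two weights merge into |x|^-T with T = \<beta> + \<gamma> >= 0.
  As |x - y| <= 3 |x| there, |x|^-T is absorbed into |x - y|^-T, and the unweighted inequality with
  exponent T + \<mu> applies.\<close>

theorem stein_weiss:
  fixes r p \<mu> \<beta> \<gamma> :: real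
  assumes rp: "r > 1" "p > 1" "1 / p + 1 / r \<ge> 1" "1 / r + 1 / r' = 1" "1 / p + 1 / p' = 1"
    and \<mu>: "0 < \<mu>" "\<mu> < DIM('a)"
    and \<beta>: "\<beta> < DIM('a) / r'" and \<gamma>: "\<gamma> < DIM('a) / p'" and \<beta>\<gamma>: "0 \<le> \<beta> + \<gamma>"
    and hom: "\<beta> + \<gamma> + \<mu> = DIM('a) * (2 - 1 / p - 1 / r)"
  shows "bilinear_bound r p (\<lambda>x y :: 'a::euclidean_space.
           norm x powr (- \<beta>) * norm (x - y) powr (- \<mu>) * norm y powr (- \<gamma>))"
proof -
  let ?N = "real DIM('a)"
  define T where "T = \<beta> + \<gamma>"
  have T0: "0 \<le> T" and homT: "T + \<mu> = ?N * (2 - 1 / p - 1 / r)" using \<beta>\<gamma> hom by (simp_all add: T_def)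
  define D where "D x y = (if norm x \<le> 2 * norm y \<and> norm y \<le> 2 * norm x
                 then norm x powr (- \<beta>) * norm (x - y) powr (- \<mu>) * norm y powr (- \<gamma>) else 0)" for x y :: 'a
  have D: "D x y \<le> 2 powr \<bar>\<gamma>\<bar> * (norm x powr (- T) * norm (x - y) powr (- \<mu>))"
    if xy: "norm x \<le> 2 * norm y" "norm y \<le> 2 * norm x" for x y :: 'a
  proof -
    have "D x y \<le> norm x powr (- \<beta>) * norm (x - y) powr (- \<mu>) * (2 powr \<bar>- \<gamma>\<bar> * norm x powr (- \<gamma>))"
      unfolding D_def using xy powr_comparable[of "norm x" "norm y" "- \<gamma>"] by (auto intro!: mult_left_mono)
    also have "\<dots> = 2 powr \<bar>\<gamma>\<bar> * ((norm x powr (- \<beta>) * norm x powr (- \<gamma>)) * norm (x - y) powr (- \<mu>))" by (simp add: mult_ac)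
    also have "norm x powr (- \<beta>) * norm x powr (- \<gamma>) = norm x powr (- T)" by (simp add: T_def flip: powr_add)
    finally show ?thesis .
  qed
  \<comment> \<open>The Hardy--Littlewood--Sobolev inequality fails at the endpoint \<open>1/p + 1/r = 1\<close>; there \<open>T\<close> is
    positive and Schur's test works.\<close>
  consider "1 / p + 1 / r > 1" | "1 / p + 1 / r = 1" using rp by linarith
  then have "bilinear_bound r p D"
  proof cases
    case 1
    have bb: "bilinear_bound r p (\<lambda>x y :: 'a. norm (x - y) powr (- (T + \<mu>)))"
      using homT by (intro hardy_littlewood_sobolev rp 1) simp
    show ?thesis
    proof (rule bilinear_bound_mono[OF bb])
      show "kernel (\<lambda>x y :: 'a. norm (x - y) powr (- (T + \<mu>)))" unfolding kernel_def by auto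
      show "0 \<le> 2 powr \<bar>\<gamma>\<bar> * 3 powr T" by simp
      fix x y :: 'a
      show "D x y \<le> 2 powr \<bar>\<gamma>\<bar> * 3 powr T * norm (x - y) powr (- (T + \<mu>))"
      \<comment> \<open>On the diagonal x = y the convention \<open>0 powr e = 0\<close> makes
        \<open>D\<close> vanish, so |x - y| > 0 may be assumed.\<close>
      proof (cases "norm x \<le> 2 * norm y \<and> norm y \<le> 2 * norm x \<and> x \<noteq> y")
        case True
        then have x: "norm (x - y) > 0" "norm (x - y) \<le> 3 * norm x" using norm_triangle_ineq4[of x y] by auto
        have "norm x powr (- T) \<le> (norm (x - y) / 3) powr (- T)" using x T0 by (intro powr_mono2') auto
        also have "\<dots> = 3 powr T * norm (x - y) powr (- T)" using x by (simp only: powr_divide powr_minus) (simp add: field_simps)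
        finally have *: "norm x powr (- T) \<le> 3 powr T * norm (x - y) powr (- T)" .
        have "D x y \<le> 2 powr \<bar>\<gamma>\<bar> * (norm x powr (- T) * norm (x - y) powr (- \<mu>))" using D True by auto
        also have "\<dots> \<le> 2 powr \<bar>\<gamma>\<bar> * ((3 powr T * norm (x - y) powr (- T)) * norm (x - y) powr (- \<mu>))"
          by (intro mult_left_mono mult_right_mono *) auto
        also have "\<dots> = 2 powr \<bar>\<gamma>\<bar> * 3 powr T * norm (x - y) powr (- T + - \<mu>)" by (simp only: powr_add mult.assoc)
        finally show ?thesis by (simp add: algebra_simps)
      next
        case False
        then have "D x y = 0" by (auto simp: D_def)
        then show ?thesis by simp
      qed
    qed
  next
    case 2
    have T: "T = ?N - \<mu>" "T > 0" using homT 2 \<mu> by (simp_all add: algebra_simps)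
    obtain C where C: "C \<ge> 0" "\<And>\<rho>. \<rho> > 0 \<Longrightarrow>
       inner_integral (\<lambda>x::'a. norm x powr (- \<mu>)) \<rho> \<le> ennreal (C * \<rho> powr (- \<mu> + ?N))"
      using homogeneous_weight_inside[OF homogeneous_weight_norm_powr[of "- \<mu>"]] \<mu> by auto
    define K where "K x y = (if norm x \<le> 2 * norm y \<and> norm y \<le> 2 * norm x
        then norm x powr (- T) * norm (x - y) powr (- \<mu>) else 0)" for x y :: 'a
    have k: "kernel K" unfolding kernel_def K_def by auto
    define c where "c = 2 powr T * (C * 4 powr T)"
    \<comment> \<open>Comparable norms give |x - y| <= 3 |x|; the radius 4 |x| makes this strict.
      The bound is independent of \<open>x\<close> because T = N - \<mu>, with N the dimension. The
      factor 2^T lets the same estimate serve the integral over the first variable, where |x|^-T is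
      traded for |y|^-T.\<close>
    have near: "(\<integral>\<^sup>+y. ennreal (2 powr T * norm x powr (- T)) * (ennreal (norm (x - y) powr (- \<mu>)) * indicator {z. norm z < 4 * norm x} (x - y)) \<partial>lborel)
      \<le> ennreal c" for x :: 'a
    proof (cases "x = 0")
      case False
      have "(\<integral>\<^sup>+y. ennreal (2 powr T * norm x powr (- T)) * (ennreal (norm (x - y) powr (- \<mu>)) * indicator {z. norm z < 4 * norm x} (x - y)) \<partial>lborel)
        = ennreal (2 powr T * norm x powr (- T)) * (\<integral>\<^sup>+y. ennreal (norm (x - y) powr (- \<mu>)) * indicator {z. norm z < 4 * norm x} (x - y) \<partial>lborel)"
        by (rule nn_integral_cmult) auto
      also have "(\<integral>\<^sup>+y. ennreal (norm (x - y) powr (- \<mu>)) * indicator {z. norm z < 4 * norm x} (x - y) \<partial>lborel) =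
        inner_integral (\<lambda>z::'a. norm z powr (- \<mu>)) (4 * norm x)"
        by (rule nn_integral_reflect) auto
      also have "ennreal (2 powr T * norm x powr (- T)) * \<dots> \<le> ennreal (2 powr T * norm x powr (- T)) * ennreal (C * (4 * norm x) powr (- \<mu> + ?N))"
        using False by (intro mult_left_mono C) auto
      also have "\<dots> = ennreal ((2 powr T * norm x powr (- T)) * (C * (4 * norm x) powr (- \<mu> + ?N)))"
        using C(1) by (simp flip: ennreal_mult)
      also have "(2 powr T * norm x powr (- T)) * (C * (4 * norm x) powr (- \<mu> + ?N)) = c"
      proof -
        have e: "- \<mu> + ?N = T" using T(1) by simp
        have "(2 powr t * norm x powr (- t)) * (C * (4 * norm x) powr t) = 2 powr t * (C * 4 powr t)" for t
          using False by (simp add: powr_mult powr_minus field_simps)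
        then show ?thesis unfolding c_def e .
      qed
      finally show ?thesis .
    next
      case True
      then show ?thesis by simp
    qed
    \<comment> \<open>At the endpoint the two Schur exponents add up to 1, so \<open>K\<close>
      itself serves as both test kernels.\<close>
    have "bilinear_bound r p K"
    proof (rule schur_test[OF rp(1-3) k k, where c = c])
      show "0 \<le> c" using C by (simp add: c_def)
      fix x y :: 'a
      have e: "(1 - 1 / r) + (1 - 1 / p) = 1" using 2 by linarith
      show "K x y \<le> K x y powr (1 - 1 / r) * K x y powr (1 - 1 / p)"
        unfolding powr_add[symmetric] e using kernel_nonneg[OF k, of x y] by simp
    next
      fix y :: 'a
      have "(\<integral>\<^sup>+x. ennreal (K x y) \<partial>lborel) \<le> (\<integral>\<^sup>+x. ennreal (2 powr T * norm y powr (- T)) * (ennreal (norm (y - x) powr (- \<mu>)) * indicator {z. norm z < 4 * norm y} (y - x)) \<partial>lborel)"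
      proof (rule nn_integral_mono)
        fix x :: 'a
        show "ennreal (K x y) \<le> ennreal (2 powr T * norm y powr (- T)) * (ennreal (norm (y - x) powr (- \<mu>)) * indicator {z. norm z < 4 * norm y} (y - x))"
        proof (cases "norm x \<le> 2 * norm y \<and> norm y \<le> 2 * norm x \<and> x \<noteq> 0")
          case True
          then have y: "norm y > 0" using zero_less_norm_iff[of x] by linarith
          then have "norm (y - x) < 4 * norm y" using True norm_triangle_ineq4[of y x] by linarith
          moreover have "norm x powr (- T) \<le> 2 powr T * norm y powr (- T)"
            using powr_comparable[of "norm y" "norm x" "- T"] True T(2) by auto
          then have "K x y \<le> 2 powr T * norm y powr (- T) * norm (y - x) powr (- \<mu>)"
            using True by (auto simp: K_def norm_minus_commute[of y x] intro!: mult_right_mono)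
          ultimately show ?thesis by (simp add: ennreal_leI flip: ennreal_mult)
        qed (auto simp: K_def)
      qed
      also have "\<dots> \<le> ennreal c" by (rule near)
      finally show "(\<integral>\<^sup>+x. ennreal (K x y) \<partial>lborel) \<le> ennreal c" .
    next
      fix x :: 'a
      have "(\<integral>\<^sup>+y. ennreal (K x y) \<partial>lborel) \<le> (\<integral>\<^sup>+y. ennreal (2 powr T * norm x powr (- T)) * (ennreal (norm (x - y) powr (- \<mu>)) * indicator {z. norm z < 4 * norm x} (x - y)) \<partial>lborel)"
      proof (rule nn_integral_mono)
        fix y :: 'a
        show "ennreal (K x y) \<le> ennreal (2 powr T * norm x powr (- T)) * (ennreal (norm (x - y) powr (- \<mu>)) * indicator {z. norm z < 4 * norm x} (x - y))"
        proof (cases "norm x \<le> 2 * norm y \<and> norm y \<le> 2 * norm x \<and> x \<noteq> 0")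
          case True
          then have "norm x > 0" by simp
          then have "norm (x - y) < 4 * norm x" using True norm_triangle_ineq4[of x y] by linarith
          moreover have "1 * (norm x powr (- T) * norm (x - y) powr (- \<mu>)) \<le> 2 powr T * (norm x powr (- T) * norm (x - y) powr (- \<mu>))"
            using T(2) by (intro mult_right_mono) (auto intro: ge_one_powr_ge_zero)
          then have "K x y \<le> 2 powr T * norm x powr (- T) * norm (x - y) powr (- \<mu>)"
            unfolding K_def by (simp add: mult.assoc)
          ultimately show ?thesis by (simp add: ennreal_leI flip: ennreal_mult)
        qed (auto simp: K_def)
      qed
      also have "\<dots> \<le> ennreal c" by (rule near)
      finally show "(\<integral>\<^sup>+y. ennreal (K x y) \<partial>lborel) \<le> ennreal c" .
    qed
    then show ?thesis
    proof (rule bilinear_bound_mono[OF _ k])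
      show "(0::real) \<le> 2 powr \<bar>\<gamma>\<bar>" by simp
      fix x y :: 'a
      show "D x y \<le> 2 powr \<bar>\<gamma>\<bar> * K x y"
      proof (cases "norm x \<le> 2 * norm y \<and> norm y \<le> 2 * norm x")
        case True
        then show ?thesis using D[of x y] by (simp add: K_def)
      next
        case False
        then have "D x y = 0" "K x y = 0" unfolding D_def K_def by auto
        then show ?thesis by simp
      qed
    qed
  qed
  then have diag: "bilinear_bound r p (\<lambda>x y :: 'a. if norm x \<le> 2 * norm y \<and> norm y \<le> 2 * norm x
                 then norm x powr (- \<beta>) * norm (x - y) powr (- \<mu>) * norm y powr (- \<gamma>) else 0)"
    unfolding D_def .
  have "homogeneous_root r' (- \<beta>) (\<lambda>x::'a. norm x powr (- \<beta>))"
    "homogeneous_root p' (- \<gamma>) (\<lambda>x::'a. norm x powr (- \<gamma>))"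
    by (rule homogeneous_root_norm_powr)+
  from bilinear_bound_localize[OF rp this \<beta> \<gamma> hom \<mu>(1) diag] show ?thesis .
qed

section \<open>Tensor products and duality\<close>

lemma nn_integral_lborel_pair:
  fixes h :: "'a::euclidean_space \<times> 'b::euclidean_space \<Rightarrow> ennreal"
  assumes [measurable]: "h \<in> borel_measurable borel"
  shows "(\<integral>\<^sup>+z. h z \<partial>lborel) = (\<integral>\<^sup>+b. \<integral>\<^sup>+a. h (a, b) \<partial>lborel \<partial>lborel)"
proof -
  have "h \<in> borel_measurable (lborel \<Otimes>\<^sub>M lborel)" unfolding lborel_prod by simp
  from lborel_pair.nn_integral_snd[OF this] show ?thesis by (simp add: lborel_prod)
qed

text \<open>\<open>F b\<close> is the r-norm of the slice f(., b), made real-valued. A slice of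
  infinite norm is sent to 0 by \<open>enn2real\<close>, so the last claim holds only almost
  everywhere.\<close>

lemma nn_integral_slice_root:
  fixes f :: "'a::euclidean_space \<times> 'b::euclidean_space \<Rightarrow> real"
  assumes [measurable]: "f \<in> borel_measurable borel" and r: "r > 0"
    and f1: "power_integral r f \<le> 1"
  obtains F where "F \<in> borel_measurable borel" "\<And>b. 0 \<le> F b" "power_integral r F \<le> 1"
    "AE b in lborel. (\<integral>\<^sup>+a. ennreal (f (a, b) powr r) \<partial>lborel) \<le> ennreal (F b powr r)"
proof
  define F where "F b = enn2real (\<integral>\<^sup>+a. ennreal (f (a, b) powr r) \<partial>lborel) powr (1 / r)" for b
  have [measurable]: "(\<lambda>b. \<integral>\<^sup>+a. ennreal (f (a, b) powr r) \<partial>lborel) \<in> borel_measurable borel" by measurable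
  have Fr: "F b powr r = enn2real (\<integral>\<^sup>+a. ennreal (f (a, b) powr r) \<partial>lborel)" for b
    using r by (simp add: F_def powr_powr)
  have eq: "(\<integral>\<^sup>+b. \<integral>\<^sup>+a. ennreal (f (a, b) powr r) \<partial>lborel \<partial>lborel) = power_integral r f"
    by (rule nn_integral_lborel_pair[symmetric]) measurable
  show "F \<in> borel_measurable borel" unfolding F_def by measurable
  show "0 \<le> F b" for b by (simp add: F_def)
  have "power_integral r F \<le> (\<integral>\<^sup>+b. \<integral>\<^sup>+a. ennreal (f (a, b) powr r) \<partial>lborel \<partial>lborel)"
    unfolding Fr
  proof (rule nn_integral_mono)
    show "ennreal (enn2real (\<integral>\<^sup>+a. ennreal (f (a, b) powr r) \<partial>lborel)) \<le> (\<integral>\<^sup>+a. ennreal (f (a, b) powr r) \<partial>lborel)" for b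
      by (cases "\<integral>\<^sup>+a. ennreal (f (a, b) powr r) \<partial>lborel") auto
  qed
  then show "power_integral r F \<le> 1" using f1 unfolding eq by (rule order_trans)
  have "(\<integral>\<^sup>+b. \<integral>\<^sup>+a. ennreal (f (a, b) powr r) \<partial>lborel \<partial>lborel) \<noteq> \<infinity>"
    using f1 unfolding eq by (auto simp: top_unique)
  then have "AE b in lborel. (\<integral>\<^sup>+a. ennreal (f (a, b) powr r) \<partial>lborel) \<noteq> \<infinity>"
    by (intro nn_integral_PInf_AE) auto
  then show "AE b in lborel. (\<integral>\<^sup>+a. ennreal (f (a, b) powr r) \<partial>lborel) \<le> ennreal (F b powr r)"
    by eventually_elim (simp add: Fr less_top)
qed

lemma kernel_tensor:
  fixes K1 :: "'a::euclidean_space \<Rightarrow> 'c::euclidean_space \<Rightarrow> real"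
    and K2 :: "'b::euclidean_space \<Rightarrow> 'd::euclidean_space \<Rightarrow> real"
  assumes "kernel K1" "kernel K2"
  shows "kernel (\<lambda>x y. K1 (fst x) (fst y) * K2 (snd x) (snd y))"
proof -
  note [measurable] = kernel_measurable[OF assms(1)] kernel_measurable[OF assms(2)]
  have "(\<lambda>z. K1 (fst (fst z)) (fst (snd z)) * K2 (snd (fst z)) (snd (snd z)))
    \<in> borel_measurable ((borel :: ('a \<times> 'b) measure) \<Otimes>\<^sub>M (borel :: ('c \<times> 'd) measure))"
    unfolding borel_prod[symmetric] by measurable
  then show ?thesis
    using kernel_nonneg[OF assms(1)] kernel_nonneg[OF assms(2)] by (auto simp: kernel_def split_def)
qed

text \<open>Freeze the second coordinates: the bound for \<open>K1\<close> on slices leaves the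
  product of slice norms \<open>F b * G d\<close>, to which the bound for \<open>K2\<close> applies.
  Slice norms have the same exponents as the full norms, so nothing is lost.\<close>

lemma bilinear_bound_tensor:
  fixes K1 :: "'a::euclidean_space \<Rightarrow> 'c::euclidean_space \<Rightarrow> real"
    and K2 :: "'b::euclidean_space \<Rightarrow> 'd::euclidean_space \<Rightarrow> real"
  assumes b1: "bilinear_bound r p K1" and k1: "kernel K1" and b2: "bilinear_bound r p K2" and k2: "kernel K2"
    and rp: "r > 0" "p > 0"
  shows "bilinear_bound r p (\<lambda>x y. K1 (fst x) (fst y) * K2 (snd x) (snd y))"
proof -
  note [measurable] = kernel_measurable[OF k1] kernel_measurable[OF k2]
  note nn = kernel_nonneg[OF k1] kernel_nonneg[OF k2]
  obtain C where C': "bilinear_bound_by r p K1 C" using b1 unfolding bilinear_bound_def by blast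
  note C = bilinear_bound_byD(1)[OF C'] bilinear_bound_by_scaled[OF C' k1]
  obtain D where D': "bilinear_bound_by r p K2 D" using b2 unfolding bilinear_bound_def by blast
  note D = bilinear_bound_byD(1)[OF D'] bilinear_bound_by_scaled[OF D' k2]
  show ?thesis
  proof (rule bilinear_boundI)
    show "0 \<le> C * D" using C D by simp
    fix f :: "'a \<times> 'b \<Rightarrow> real" and g :: "'c \<times> 'd \<Rightarrow> real"
    assume [measurable]: "f \<in> borel_measurable borel" "g \<in> borel_measurable borel"
      and f0: "\<And>x. 0 \<le> f x" and g0: "\<And>y. 0 \<le> g y" 
      and f1: "power_integral r f \<le> 1"
      and g1: "power_integral p g \<le> 1"
    note [measurable] = \<open>f \<in> borel_measurable borel\<close>[folded borel_prod] \<open>g \<in> borel_measurable borel\<close>[folded borel_prod]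
    obtain F where F[measurable]: "F \<in> borel_measurable borel" and F0: "\<And>b. 0 \<le> F b"
      and F1: "power_integral r F \<le> 1"
      and Fs: "AE b in lborel. (\<integral>\<^sup>+a. ennreal (f (a, b) powr r) \<partial>lborel) \<le> ennreal (F b powr r)"
      using nn_integral_slice_root[OF _ rp(1) f1] by auto
    obtain G where G[measurable]: "G \<in> borel_measurable borel" and G0: "\<And>d. 0 \<le> G d"
      and G1: "power_integral p G \<le> 1"
      and Gs: "AE d in lborel. (\<integral>\<^sup>+c. ennreal (g (c, d) powr p) \<partial>lborel) \<le> ennreal (G d powr p)"
      using nn_integral_slice_root[OF _ rp(2) g1] by auto
    let ?I = "\<lambda>b d. \<integral>\<^sup>+a. \<integral>\<^sup>+c. ennreal (f (a, b) * K1 a c * g (c, d)) \<partial>lborel \<partial>lborel"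
    have "(\<integral>\<^sup>+x. \<integral>\<^sup>+y. ennreal (f x * (K1 (fst x) (fst y) * K2 (snd x) (snd y)) * g y) \<partial>lborel \<partial>lborel) =
      (\<integral>\<^sup>+b. \<integral>\<^sup>+a. \<integral>\<^sup>+d. \<integral>\<^sup>+c. ennreal (f (a, b) * (K1 a c * K2 b d) * g (c, d)) \<partial>lborel \<partial>lborel \<partial>lborel \<partial>lborel)"
    proof -
      have "(\<integral>\<^sup>+y. ennreal (f x * (K1 (fst x) (fst y) * K2 (snd x) (snd y)) * g y) \<partial>lborel) =
        (\<integral>\<^sup>+d. \<integral>\<^sup>+c. ennreal (f x * (K1 (fst x) c * K2 (snd x) d) * g (c, d)) \<partial>lborel \<partial>lborel)" for x
        by (subst nn_integral_lborel_pair) (auto simp flip: borel_prod)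
      then show ?thesis by (simp, subst nn_integral_lborel_pair) (auto simp flip: borel_prod)
    qed
    also have "\<dots> = (\<integral>\<^sup>+b. \<integral>\<^sup>+d. \<integral>\<^sup>+a. \<integral>\<^sup>+c. ennreal (f (a, b) * (K1 a c * K2 b d) * g (c, d)) \<partial>lborel \<partial>lborel \<partial>lborel \<partial>lborel)"
      by (intro nn_integral_cong nn_integral_swap) measurable
    also have "\<dots> = (\<integral>\<^sup>+b. \<integral>\<^sup>+d. ennreal (K2 b d) * ?I b d \<partial>lborel \<partial>lborel)"
    proof (intro nn_integral_cong)
      fix b d
      have "(\<integral>\<^sup>+a. \<integral>\<^sup>+c. ennreal (f (a, b) * (K1 a c * K2 b d) * g (c, d)) \<partial>lborel \<partial>lborel) =
        (\<integral>\<^sup>+a. \<integral>\<^sup>+c. ennreal (K2 b d) * ennreal (f (a, b) * K1 a c * g (c, d)) \<partial>lborel \<partial>lborel)"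
        using nn f0 g0 by (intro nn_integral_cong) (simp add: mult_ac flip: ennreal_mult)
      then show "(\<integral>\<^sup>+a. \<integral>\<^sup>+c. ennreal (f (a, b) * (K1 a c * K2 b d) * g (c, d)) \<partial>lborel \<partial>lborel) = ennreal (K2 b d) * ?I b d"
        by (simp add: nn_integral_cmult)
    qed
    also have "\<dots> \<le> (\<integral>\<^sup>+b. \<integral>\<^sup>+d. ennreal C * ennreal (F b * K2 b d * G d) \<partial>lborel \<partial>lborel)"
    proof (rule nn_integral_mono_AE)
      show "AE b in lborel. (\<integral>\<^sup>+d. ennreal (K2 b d) * ?I b d \<partial>lborel) \<le> (\<integral>\<^sup>+d. ennreal C * ennreal (F b * K2 b d * G d) \<partial>lborel)"
        using Fs
      proof eventually_elim
        case (elim b)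
        note Fb = elim
        show ?case
        proof (rule nn_integral_mono_AE)
          show "AE d in lborel. ennreal (K2 b d) * ?I b d \<le> ennreal C * ennreal (F b * K2 b d * G d)"
            using Gs
          proof eventually_elim
            case (elim d)
            have "?I b d \<le> ennreal (C * F b * G d)"
              using Fb elim F0 G0 f0 g0 by (intro C(2)) auto
            then have "ennreal (K2 b d) * ?I b d \<le> ennreal (K2 b d) * ennreal (C * F b * G d)"
              by (intro mult_left_mono) auto
            also have "\<dots> = ennreal C * ennreal (F b * K2 b d * G d)"
              using nn C(1) F0 G0 by (simp add: mult_ac flip: ennreal_mult)
            finally show ?case .
          qed
        qed
      qed
    qed
    also have "\<dots> = ennreal C * (\<integral>\<^sup>+b. \<integral>\<^sup>+d. ennreal (F b * K2 b d * G d) \<partial>lborel \<partial>lborel)"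
      by (simp add: nn_integral_cmult)
    also have "\<dots> \<le> ennreal C * ennreal (D * 1 * 1)"
      using F0 G0 F1 G1 by (intro mult_left_mono D(2)) auto
    also have "\<dots> = ennreal (C * D)" using C(1) D(1) by (simp flip: ennreal_mult)
    finally show "(\<integral>\<^sup>+x. \<integral>\<^sup>+y. ennreal (f x * (K1 (fst x) (fst y) * K2 (snd x) (snd y)) * g y) \<partial>lborel \<partial>lborel) \<le> ennreal (C * D)" .
  qed
qed

section \<open>From bilinear bounds to norm bounds\<close>

text \<open>The converse of Hoelder's inequality, for a function \<phi> that is merely dominated by
  the integral operator applied to \<open>h\<close>. This suits the Riesz bound below, which is an
  inequality for absolute values.\<close>

lemma bilinear_bound_dual:
  fixes K :: "'a::euclidean_space \<Rightarrow> 'b::euclidean_space \<Rightarrow> real"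
  assumes bb: "bilinear_bound r p K" and K: "kernel K" and rp: "r > 1" "p > 0" and q: "1 / q + 1 / r = 1"
  obtains C where "C \<ge> 0"
    "\<And>h \<phi> b. \<lbrakk>h \<in> borel_measurable borel; \<And>y. 0 \<le> h y; \<phi> \<in> borel_measurable borel; \<And>x. 0 \<le> \<phi> x; 0 \<le> b;
       power_integral p h \<le> ennreal (b powr p);
       AE x in lborel. ennreal (\<phi> x) \<le> (\<integral>\<^sup>+y. ennreal (K x y * h y) \<partial>lborel)\<rbrakk> \<Longrightarrow>
       power_integral q \<phi> \<le> ennreal ((C * b) powr q)"
proof -
  note [measurable] = kernel_measurable[OF K]
  have r0: "r > 0" using rp by simp
  obtain C where C': "bilinear_bound_by r p K C" using bb unfolding bilinear_bound_def by blast
  note C = bilinear_bound_byD(1)[OF C'] bilinear_bound_by_scaled[OF C' K]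
  have "1 / r < 1" using rp by simp
  then have "1 / q > 0" using q by linarith
  then have q0: "q > 0" by (simp add: zero_less_divide_iff)
  have "1 / q < 1" using q r0 by (smt (verit) zero_less_divide_1_iff)
  then have q1: "q > 1" "(q - 1) * r = q" using q rp q0 by (simp_all add: field_simps)
  show thesis
  proof (rule that[OF C(1)])
    fix h :: "'b \<Rightarrow> real" and \<phi> :: "'a \<Rightarrow> real" and b :: real
    assume [measurable]: "h \<in> borel_measurable borel" "\<phi> \<in> borel_measurable borel"
      and h0: "\<And>y. 0 \<le> h y" and \<phi>0: "\<And>x. 0 \<le> \<phi> x" and b: "0 \<le> b"
      and hb: "power_integral p h \<le> ennreal (b powr p)"
      and le: "AE x in lborel. ennreal (\<phi> x) \<le> (\<integral>\<^sup>+y. ennreal (K x y * h y) \<partial>lborel)"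
    \<comment> \<open>Testing against \<open>\<phi>\<^sup>q\<^sup>-\<^sup>1\<close> requires \<open>\<phi>\<^sup>q\<close> to be integrable, hence the truncation.\<close>
    define t where "t k x = (if norm x \<le> real k then min (\<phi> x) (real k) else 0)" for k :: nat and x
    have [measurable]: "t k \<in> borel_measurable borel" for k unfolding t_def by measurable
    have t0: "0 \<le> t k x" for k x using \<phi>0 by (auto simp: t_def)
    have t\<phi>: "t k x \<le> \<phi> x" for k x using \<phi>0 by (auto simp: t_def)
    have bound: "(\<integral>\<^sup>+x. ennreal (t k x powr q) \<partial>lborel) \<le> ennreal ((C * b) powr q)" for k
    proof -
      define f where "f x = t k x powr (q - 1)" for x
      have [measurable]: "f \<in> borel_measurable borel" unfolding f_def by measurable
      have fr: "f x powr r = t k x powr q" for x using q1 by (simp add: f_def powr_powr)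
      have "(\<integral>\<^sup>+x. ennreal (t k x powr q) \<partial>lborel) \<le> (\<integral>\<^sup>+x. ennreal (real k powr q) * indicator (cball 0 (real k)) x \<partial>(lborel :: 'a measure))"
        using q0 t0 by (intro nn_integral_mono) (auto simp: t_def indicator_def \<phi>0 intro!: ennreal_leI powr_mono2)
      also have "\<dots> = ennreal (real k powr q) * emeasure lborel (cball (0::'a) (real k))"
        by (rule nn_integral_cmult_indicator) auto
      also have "\<dots> < \<infinity>" using emeasure_lborel_cball_finite[of "0::'a" "real k"] by (auto simp: ennreal_mult_less_top)
      finally obtain J where J: "J \<ge> 0" "(\<integral>\<^sup>+x. ennreal (t k x powr q) \<partial>lborel) = ennreal J"
        by (metis ennreal_cases less_irrefl infinity_ennreal_def)
      show ?thesis
      proof (cases "J = 0")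
        case False
        then have Jp: "J > 0" using J by simp
        \<comment> \<open>The r-norm of the test function, because (q - 1) r = q. The bound becomes
          \<open>J \<le> C * J powr (1 / r) * b\<close>, and a finite positive \<open>J\<close> can
          be divided out.\<close>
        define a where "a = J powr (1 / r)"
        have "power_integral r f \<le> ennreal (a powr r)"
          unfolding fr J a_def using r0 J(1) by (simp add: powr_powr)
        then have "bilinear_form f K h \<le> ennreal (C * a * b)"
          using h0 b hb by (intro C(2)) (auto simp: f_def a_def)
        moreover have "ennreal J \<le> bilinear_form f K h"
          unfolding J(2)[symmetric]
        proof (rule nn_integral_mono_AE)
          show "AE x in lborel. ennreal (t k x powr q) \<le> (\<integral>\<^sup>+y. ennreal (f x * K x y * h y) \<partial>lborel)"
            using le
          proof eventually_elim
            case (elim x)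
            have "t k x powr q = f x * t k x"
            proof (cases "t k x = 0")
              case False
              then have "f x * t k x = t k x powr (q - 1) * t k x powr 1" using t0[of k x] by (simp add: f_def)
              also have "\<dots> = t k x powr q" by (simp only: powr_add[symmetric]) simp
              finally show ?thesis by simp
            qed (simp add: f_def)
            also have "ennreal \<dots> \<le> ennreal (f x) * ennreal (\<phi> x)"
              using t\<phi>[of k x] t0[of k x] \<phi>0[of x]
              by (simp add: f_def ennreal_leI mult_left_mono flip: ennreal_mult)
            also have "\<dots> \<le> ennreal (f x) * (\<integral>\<^sup>+y. ennreal (K x y * h y) \<partial>lborel)"
              by (intro mult_left_mono elim) auto
            also have "\<dots> = (\<integral>\<^sup>+y. ennreal (f x) * ennreal (K x y * h y) \<partial>lborel)"
              by (rule nn_integral_cmult[symmetric]) measurable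
            also have "\<dots> = (\<integral>\<^sup>+y. ennreal (f x * K x y * h y) \<partial>lborel)"
              using kernel_nonneg[OF K] h0 by (intro nn_integral_cong) (simp add: f_def mult.assoc flip: ennreal_mult)
            finally show ?case .
          qed
        qed
        ultimately have "ennreal J \<le> ennreal (C * a * b)" by (rule order_trans[rotated])
        then have "J \<le> C * a * b" using C(1) b by (simp add: a_def)
        moreover have "J = a * J powr (1 / q)"
          using Jp q by (simp add: a_def add.commute flip: powr_add)
        ultimately have "a * J powr (1 / q) \<le> a * (C * b)" by (simp add: mult_ac)
        then have "J powr (1 / q) \<le> C * b" using Jp by (simp add: a_def)
        then have "(J powr (1 / q)) powr q \<le> (C * b) powr q" using q0 by (intro powr_mono2) auto
        then have "J \<le> (C * b) powr q" using q0 J(1) by (simp add: powr_powr)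
        then show ?thesis unfolding J by (rule ennreal_leI)
      qed (simp add: J)
    qed
    have "power_integral q \<phi> = (\<integral>\<^sup>+x. (SUP k. ennreal (t k x powr q)) \<partial>lborel)"
    proof (intro nn_integral_cong antisym)
      fix x
      obtain k :: nat where "max (norm x) (\<phi> x) \<le> real k" using real_arch_simple by blast
      then have "\<phi> x = t k x" by (auto simp: t_def)
      then show "ennreal (\<phi> x powr q) \<le> (SUP k. ennreal (t k x powr q))" by (auto intro: SUP_upper2[of k])
      show "(SUP k. ennreal (t k x powr q)) \<le> ennreal (\<phi> x powr q)"
        using t0 t\<phi> q0 by (intro SUP_least ennreal_leI powr_mono2) auto
    qed
    also have "\<dots> = (SUP k. \<integral>\<^sup>+x. ennreal (t k x powr q) \<partial>lborel)"
    proof (rule nn_integral_monotone_convergence_SUP)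
      show "incseq (\<lambda>k x. ennreal (t k x powr q))"
      proof (intro incseq_SucI le_funI ennreal_leI powr_mono2)
        fix k x show "t k x \<le> t (Suc k) x" using \<phi>0[of x] by (auto simp: t_def)
      qed (use q0 t0 in auto)
    qed measurable
    also have "\<dots> \<le> ennreal ((C * b) powr q)" by (intro SUP_least bound)
    finally show "power_integral q \<phi> \<le> ennreal ((C * b) powr q)" .
  qed
qed

section \<open>The weights \<open>|x'|\<^sup>a |x|\<^sup>b |x\<^sub>n|\<^sup>c\<close>\<close>

text \<open>The slab is a product of a null point with a space of infinite measure, and 0 times
  \<infinity> is 0.\<close>

lemma AE_fst_neq: "AE y in (lborel :: ('a::euclidean_space \<times> 'b::euclidean_space) measure). fst y \<noteq> a"
proof (rule AE_I')
  have "emeasure (lborel \<Otimes>\<^sub>M lborel) ({a} \<times> (UNIV :: 'b set)) = emeasure lborel {a} * emeasure lborel (UNIV :: 'b set)"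
    by (rule lborel.emeasure_pair_measure_Times) auto
  then have "emeasure lborel ({a} \<times> (UNIV :: 'b set)) = 0" by (simp add: lborel_prod)
  then show "{a} \<times> (UNIV :: 'b set) \<in> null_sets lborel"
    by (auto simp: null_sets_def closed_Times intro!: borel_closed)
qed auto

lemma AE_snd_neq: "AE y in (lborel :: ('a::euclidean_space \<times> 'b::euclidean_space) measure). snd y \<noteq> b"
proof (rule AE_I')
  have "emeasure (lborel \<Otimes>\<^sub>M lborel) ((UNIV :: 'a set) \<times> {b}) = emeasure lborel (UNIV :: 'a set) * emeasure lborel {b}"
    by (rule lborel.emeasure_pair_measure_Times) auto
  then have "emeasure lborel ((UNIV :: 'a set) \<times> {b}) = 0" by (simp add: lborel_prod)
  then show "(UNIV :: 'a set) \<times> {b} \<in> null_sets lborel"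
    by (auto simp: null_sets_def closed_Times intro!: borel_closed)
qed auto

lemma u_weight_nonneg: "0 \<le> u_weight a1 a2 a3 x"
  by (simp add: u_weight_def)

lemma u_weight_measurable [measurable]:
  "(u_weight a1 a2 a3 :: (real^'m::finite) \<times> real \<Rightarrow> real) \<in> borel_measurable borel"
proof -
  define f g where "f = (\<lambda>x::(real^'m) \<times> real. norm (fst x))" and "g = (\<lambda>x::(real^'m) \<times> real. \<bar>snd x\<bar>)"
  have [measurable]: "f \<in> borel_measurable borel" "g \<in> borel_measurable borel"
    unfolding f_def g_def by (intro borel_measurable_continuous_onI continuous_intros)+
  have "u_weight a1 a2 a3 = (\<lambda>x. f x powr a1 * norm x powr a2 * g x powr a3)"
    by (simp add: fun_eq_iff u_weight_def f_def g_def)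
  then show ?thesis by simp
qed

lemma u_weight_powr: "u_weight a1 a2 a3 x powr s = u_weight (a1 * s) (a2 * s) (a3 * s) x"
  by (simp add: u_weight_def powr_mult powr_powr)

text \<open>On the annulus |x| lies between 1 and 2, so |x|^a2 is bounded and local integrability of
  the factors in x' and x_n decides. The total exponent matters only later, in the dyadic
  sums.\<close>

lemma homogeneous_weight_u_weight:
  assumes "a1 > - real CARD('m)" "a3 > - 1"
  shows "homogeneous_weight (a1 + a2 + a3) (u_weight a1 a2 a3 :: (real^'m::finite) \<times> real \<Rightarrow> real)"
proof -
  obtain C1 where C1: "C1 \<ge> 0" "\<And>\<rho>. \<rho> > 0 \<Longrightarrow>
     inner_integral (\<lambda>x::real^'m. norm x powr a1) \<rho> \<le> ennreal (C1 * \<rho> powr (a1 + CARD('m)))"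
    using homogeneous_weight_inside[OF homogeneous_weight_norm_powr[of a1, where 'a = "real^'m"]] assms by auto
  obtain C3 where C3: "C3 \<ge> 0" "\<And>\<rho>. \<rho> > 0 \<Longrightarrow>
     inner_integral (\<lambda>x::real. norm x powr a3) \<rho> \<le> ennreal (C3 * \<rho> powr (a3 + 1))"
    using homogeneous_weight_inside[OF homogeneous_weight_norm_powr[of a3, where 'a = "real"]] assms by auto
  let ?c = "2 powr \<bar>a2\<bar>"
  define U where "U a = ennreal (norm (a::real^'m) powr a1) * indicator {x. norm x < 2} a" for a
  define V where "V b = ennreal (norm (b::real) powr a3) * indicator {x. norm x < 2} b" for b
  have [measurable]: "U \<in> borel_measurable borel" "V \<in> borel_measurable borel" unfolding U_def V_def by measurable
  have "(\<integral>\<^sup>+x. ennreal (u_weight a1 a2 a3 (x :: (real^'m) \<times> real)) * indicator {x. 1 \<le> norm x \<and> norm x < 2} x \<partial>lborel)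
    \<le> (\<integral>\<^sup>+x. ennreal ?c * (U (fst x) * V (snd x)) \<partial>lborel)"
  proof (rule nn_integral_mono)
    fix x :: "(real^'m) \<times> real"
    show "ennreal (u_weight a1 a2 a3 x) * indicator {x. 1 \<le> norm x \<and> norm x < 2} x \<le> ennreal ?c * (U (fst x) * V (snd x))"
    proof (cases "1 \<le> norm x \<and> norm x < 2")
      case True
      then have fs: "norm (fst x) < 2" "norm (snd x) < 2"
        using norm_fst_le[of "fst x" "snd x"] norm_snd_le[of "snd x" "fst x"] by auto
      have "norm x powr a2 \<le> norm x powr \<bar>a2\<bar>" using True by (intro powr_mono) auto
      also have "\<dots> \<le> ?c" using True by (intro powr_mono2) auto
      finally have "u_weight a1 a2 a3 x \<le> norm (fst x) powr a1 * ?c * \<bar>snd x\<bar> powr a3"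
        unfolding u_weight_def by (intro mult_right_mono mult_left_mono) auto
      then have "ennreal (u_weight a1 a2 a3 x) \<le> ennreal (?c * (norm (fst x) powr a1 * \<bar>snd x\<bar> powr a3))"
        by (intro ennreal_leI) (simp add: mult_ac)
      also have "\<dots> = ennreal ?c * (U (fst x) * V (snd x))"
        using fs by (simp add: U_def V_def ennreal_mult)
      finally show ?thesis using True by simp
    qed simp
  qed
  also have "\<dots> = ennreal ?c * (\<integral>\<^sup>+x. U (fst x) * V (snd x) \<partial>lborel)"
    by (rule nn_integral_cmult) (auto simp flip: borel_prod)
  also have "(\<integral>\<^sup>+x. U (fst x) * V (snd x) \<partial>lborel) = (\<integral>\<^sup>+a. U a \<partial>lborel) * (\<integral>\<^sup>+b. V b \<partial>lborel)"
  proof -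
    have "(\<integral>\<^sup>+x. U (fst x) * V (snd x) \<partial>lborel) = (\<integral>\<^sup>+b. \<integral>\<^sup>+a. U a * V b \<partial>lborel \<partial>lborel)"
      by (subst nn_integral_lborel_pair) (auto simp flip: borel_prod)
    then show ?thesis by (simp add: nn_integral_multc nn_integral_cmult)
  qed
  also have "ennreal ?c * ((\<integral>\<^sup>+a. U a \<partial>lborel) * (\<integral>\<^sup>+b. V b \<partial>lborel)) \<le>
     ennreal ?c * (ennreal (C1 * 2 powr (a1 + CARD('m))) * ennreal (C3 * 2 powr (a3 + 1)))"
    unfolding U_def V_def by (intro mult_left_mono mult_mono C1(2) C3(2)) auto
  also have "\<dots> < \<infinity>" by (simp add: ennreal_mult_less_top)
  finally have fin: "(\<integral>\<^sup>+x. ennreal (u_weight a1 a2 a3 (x :: (real^'m) \<times> real)) * indicator {x. 1 \<le> norm x \<and> norm x < 2} x \<partial>lborel) < \<infinity>" .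
  have "u_weight a1 a2 a3 (c *\<^sub>R x) = c powr (a1 + a2 + a3) * u_weight a1 a2 a3 x" if "c > 0" for c and x :: "(real^'m) \<times> real"
  proof -
    have "norm (c *\<^sub>R x) = c * norm x" "norm (fst (c *\<^sub>R x)) = c * norm (fst x)" "\<bar>snd (c *\<^sub>R x)\<bar> = c * \<bar>snd x\<bar>"
      using that by (simp_all add: abs_mult)
    then show ?thesis by (simp only: u_weight_def powr_mult powr_add mult_ac)
  qed
  then show ?thesis using fin unfolding homogeneous_weight_def
    by (auto simp: u_weight_nonneg) (simp add: u_weight_def)
qed

lemma homogeneous_root_u_weight:
  assumes "a1 * s > - real CARD('m)" "a3 * s > - 1"
  shows "homogeneous_root s (a1 + a2 + a3) (u_weight a1 a2 a3 :: (real^'m::finite) \<times> real \<Rightarrow> real)"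
  unfolding homogeneous_root_def
  using homogeneous_weight_u_weight[of "a1 * s" "a3 * s" "a2 * s", where 'm = 'm] assms
  by (simp add: u_weight_nonneg u_weight_powr distrib_right)

section \<open>Splitting exponents and the bound for product weights\<close>

text \<open>Dividing \<open>c\<close> in the proportion P : Q keeps each share below its cap, since
  c / (P + Q) < 1. It distributes an exponent between the two variables without leaving the
  Stein-Weiss range of either.\<close>

lemma split_between:
  fixes c P Q :: real
  assumes "0 \<le> c" "0 < P" "0 < Q" "c < P + Q"
  obtains a where "0 \<le> a" "a \<le> c" "a < P" "c - a < Q"
proof
  let ?a = "c * P / (P + Q)"
  show "0 \<le> ?a" using assms by simp
  have e: "c - ?a = c * Q / (P + Q)" using assms by (simp add: field_simps)
  moreover have "c * Q / (P + Q) \<ge> 0" using assms by simp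
  ultimately show "?a \<le> c" by linarith
  have "c / (P + Q) < 1" using assms by simp
  then have "c / (P + Q) * P < 1 * P" "c / (P + Q) * Q < 1 * Q" using assms by (intro mult_strict_right_mono; simp)+
  then show "?a < P" "c - ?a < Q" unfolding e by simp_all
qed

text \<open>Near the diagonal the kernel is dominated by a tensor product of Stein-Weiss kernels in
  dimensions m and 1. Each factor must satisfy its own homogeneity relation, so \<mu> and \<Theta>
  are divided in the proportion m : 1. The hypotheses \<open>le\<close> make \<open>c1\<close> and
  \<open>c3\<close>, the missing parts of the exponents, nonnegative.\<close>

theorem u_weight_stein_weiss:
  fixes r p \<mu> \<beta>1 \<beta>2 \<beta>3 \<gamma>1 \<gamma>2 \<gamma>3 :: real
  defines "m \<equiv> real CARD('m::finite)"
  defines "N \<equiv> m + 1"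
  assumes rp: "r > 1" "p > 1" "1 / p + 1 / r \<ge> 1" "1 / r + 1 / r' = 1" "1 / p + 1 / p' = 1"
    and \<mu>: "0 < \<mu>" "\<mu> < N"
    and \<beta>: "\<beta>1 < m / r'" "\<beta>3 < 1 / r'" "\<beta>1 + \<beta>2 + \<beta>3 < N / r'"
    and \<gamma>: "\<gamma>1 < m / p'" "\<gamma>3 < 1 / p'" "\<gamma>1 + \<gamma>2 + \<gamma>3 < N / p'"
    and \<Theta>: "0 \<le> \<Theta>" "\<Theta> = (\<beta>1 + \<beta>2 + \<beta>3) + (\<gamma>1 + \<gamma>2 + \<gamma>3)" "\<Theta> + \<mu> = N * (2 - 1 / p - 1 / r)"
    and le: "\<beta>1 + \<gamma>1 \<le> m / N * \<Theta>" "\<beta>3 + \<gamma>3 \<le> 1 / N * \<Theta>"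
  shows "bilinear_bound r p (\<lambda>x y :: (real^'m) \<times> real.
     u_weight (- \<beta>1) (- \<beta>2) (- \<beta>3) x * norm (x - y) powr (- \<mu>) * u_weight (- \<gamma>1) (- \<gamma>2) (- \<gamma>3) y)"
proof -
  have m: "m > 0" "N > 0" "N = m + 1" by (auto simp: m_def N_def)
  have conj: "1 - 1 / r = 1 / r'" "1 - 1 / p = 1 / p'" using rp by linarith+
  have "1 / r < 1" "1 / p < 1" using rp(1,2) by (simp_all add: divide_simps)
  then have "1 / r' > 0" "1 / p' > 0" using conj by linarith+
  then have pos: "r' > 0" "p' > 0" by (simp_all add: zero_less_divide_iff)
  have sum: "2 - 1 / p - 1 / r = 1 / r' + 1 / p'" using conj by linarith
  \<comment> \<open>This is \<mu> > 0 in disguise; it is the room that makes both splittings below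
    possible.\<close>
  have T: "\<Theta> / N < 1 / r' + 1 / p'" using \<Theta>(3) \<mu> m unfolding sum by (simp add: field_simps)
  \<comment> \<open>Near the diagonal the factor \<open>|x|\<close> to the power \<open>- (\<beta>2 + \<gamma>2) = - (c1 + c3)\<close> is shared out between
    \<open>x'\<close>, \<open>y'\<close>, \<open>x\<^sub>n\<close>, \<open>y\<^sub>n\<close> with nonnegative parts \<open>a1\<close>, \<open>c1 - a1\<close>, \<open>a3\<close>, \<open>c3 - a3\<close>.\<close>
  define c1 where "c1 = m / N * \<Theta> - \<beta>1 - \<gamma>1"
  define c3 where "c3 = 1 / N * \<Theta> - \<beta>3 - \<gamma>3"
  have mN: "m / N + 1 / N = 1" using m(2) by (simp add: m(3) flip: add_divide_distrib)
  have "m / N * \<Theta> + 1 / N * \<Theta> = \<Theta>" unfolding distrib_right[symmetric] mN by simp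
  then have c: "c1 + c3 = \<beta>2 + \<gamma>2" using \<Theta>(2) by (simp add: c1_def c3_def)
  obtain a1 where a1: "0 \<le> a1" "a1 \<le> c1" "a1 < m / r' - \<beta>1" "c1 - a1 < m / p' - \<gamma>1"
  proof (rule split_between)
    have "m * (\<Theta> / N) < m * (1 / r' + 1 / p')" by (rule mult_strict_left_mono[OF T m(1)])
    then show "c1 < (m / r' - \<beta>1) + (m / p' - \<gamma>1)" by (simp add: c1_def distrib_left)
  qed (use le \<beta> \<gamma> in \<open>auto simp: c1_def\<close>)
  obtain a3 where a3: "0 \<le> a3" "a3 \<le> c3" "a3 < 1 / r' - \<beta>3" "c3 - a3 < 1 / p' - \<gamma>3"
  proof (rule split_between)
    show "c3 < (1 / r' - \<beta>3) + (1 / p' - \<gamma>3)" using T by (simp add: c3_def)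
  qed (use le \<beta> \<gamma> in \<open>auto simp: c3_def\<close>)
  define K1 where "K1 x y = norm x powr (- (\<beta>1 + a1)) * norm (x - y) powr (- (m / N * \<mu>)) * norm y powr (- (\<gamma>1 + (c1 - a1)))" for x y :: "real^'m"
  define K3 where "K3 x y = norm x powr (- (\<beta>3 + a3)) * norm (x - y) powr (- (1 / N * \<mu>)) * norm y powr (- (\<gamma>3 + (c3 - a3)))" for x y :: real
  have k: "kernel K1" "kernel K3" unfolding kernel_def K1_def K3_def by auto
  have "bilinear_bound r p K1" unfolding K1_def
  proof (rule stein_weiss[OF rp])
    show "0 < m / N * \<mu>" using m \<mu> by simp
    have "m / N * \<mu> < m / N * N" using m \<mu> by (intro mult_strict_left_mono) auto
    then show "m / N * \<mu> < real DIM(real^'m)" using m by (simp add: m_def)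
    show "\<beta>1 + a1 < real DIM(real^'m) / r'" "\<gamma>1 + (c1 - a1) < real DIM(real^'m) / p'"
      using a1 by (simp_all add: m_def)
    have e: "\<beta>1 + a1 + (\<gamma>1 + (c1 - a1)) = m / N * \<Theta>" by (simp add: c1_def)
    show "0 \<le> \<beta>1 + a1 + (\<gamma>1 + (c1 - a1))" unfolding e using m \<Theta> by simp
    have "m / N * \<Theta> + m / N * \<mu> = m / N * (\<Theta> + \<mu>)" by (simp add: distrib_left)
    also have "\<dots> = real DIM(real^'m) * (2 - 1 / p - 1 / r)" unfolding \<Theta>(3) using m by (simp add: m_def)
    finally show "\<beta>1 + a1 + (\<gamma>1 + (c1 - a1)) + m / N * \<mu> = real DIM(real^'m) * (2 - 1 / p - 1 / r)" unfolding e .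
  qed
  moreover have "bilinear_bound r p K3" unfolding K3_def
  proof (rule stein_weiss[OF rp])
    show "0 < 1 / N * \<mu>" using m \<mu> by simp
    show "1 / N * \<mu> < real DIM(real)" using m \<mu> by simp
    show "\<beta>3 + a3 < real DIM(real) / r'" "\<gamma>3 + (c3 - a3) < real DIM(real) / p'"
      using a3 by simp_all
    have e: "\<beta>3 + a3 + (\<gamma>3 + (c3 - a3)) = 1 / N * \<Theta>" by (simp add: c3_def)
    show "0 \<le> \<beta>3 + a3 + (\<gamma>3 + (c3 - a3))" unfolding e using m \<Theta> by simp
    have "1 / N * \<Theta> + 1 / N * \<mu> = 1 / N * (\<Theta> + \<mu>)" by (simp add: distrib_left)
    also have "\<dots> = real DIM(real) * (2 - 1 / p - 1 / r)" unfolding \<Theta>(3) using m by simp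
    finally show "\<beta>3 + a3 + (\<gamma>3 + (c3 - a3)) + 1 / N * \<mu> = real DIM(real) * (2 - 1 / p - 1 / r)" unfolding e .
  qed
  ultimately have tensor: "bilinear_bound r p (\<lambda>x y. K1 (fst x) (fst y) * K3 (snd x) (snd y))"
    using k rp by (intro bilinear_bound_tensor) auto
  let ?\<omega> = "u_weight (- \<beta>1) (- \<beta>2) (- \<beta>3) :: (real^'m) \<times> real \<Rightarrow> real"
  let ?\<nu> = "u_weight (- \<gamma>1) (- \<gamma>2) (- \<gamma>3) :: (real^'m) \<times> real \<Rightarrow> real"
  have dim: "real DIM((real^'m) \<times> real) = N" by (simp add: m m_def)
  define a where "a = a1 + a3"
  define b where "b = (c1 - a1) + (c3 - a3)"
  have ab: "a + b = \<beta>2 + \<gamma>2" using c by (simp add: a_def b_def)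
  define L where "L x y = (if norm x \<le> 2 * norm y \<and> norm y \<le> 2 * norm x
                 then ?\<omega> x * norm (x - y) powr (- \<mu>) * ?\<nu> y else 0)" for x y
  define cc where "cc = 2 powr \<bar>a - \<beta>2\<bar>"
  \<comment> \<open>Only almost everywhere: \<open>0 powr e = 0\<close> makes the tensor kernel vanish where \<open>x' = y'\<close> or \<open>x\<^sub>n = y\<^sub>n\<close>.\<close>
  have pt: "AE y in lborel. L x y \<le> cc * (K1 (fst x) (fst y) * K3 (snd x) (snd y))" for x
    using AE_fst_neq[of "fst x"] AE_snd_neq[of "snd x"]
  proof eventually_elim
    case (elim y)
    have rhs: "0 \<le> 2 powr \<bar>a - \<beta>2\<bar> * (K1 (fst x) (fst y) * K3 (snd x) (snd y))"
      by (intro mult_nonneg_nonneg kernel_nonneg[OF k(1)] kernel_nonneg[OF k(2)]) auto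
    show ?case
    proof (cases "norm x \<le> 2 * norm y \<and> norm y \<le> 2 * norm x \<and> fst x \<noteq> 0 \<and> snd x \<noteq> 0 \<and> fst y \<noteq> 0 \<and> snd y \<noteq> 0")
      case False
      then have "(if norm x \<le> 2 * norm y \<and> norm y \<le> 2 * norm x
               then ?\<omega> x * norm (x - y) powr (- \<mu>) * ?\<nu> y else 0) = 0"
        by (auto simp: u_weight_def)
      then show ?thesis using rhs unfolding L_def cc_def by linarith
    next
      case True
      \<comment> \<open>Both components are at most |z| in norm, so nonpositive powers only grow.
        Used for x and y, and with z = x - y for the kernel.\<close>
      have two: "norm z powr (- (s + t)) \<le> norm (fst z) powr (- s) * norm (snd z) powr (- t)"
        if "fst z \<noteq> 0" "snd z \<noteq> 0" "0 \<le> s" "0 \<le> t" for z :: "(real^'m) \<times> real" and s t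
      proof -
        have "norm z powr (- (s + t)) = norm z powr (- s) * norm z powr (- t)" by (simp flip: powr_add)
        also have "\<dots> \<le> norm (fst z) powr (- s) * norm (snd z) powr (- t)"
          using that norm_fst_le[of "fst z" "snd z"] norm_snd_le[of "snd z" "fst z"] by (intro mult_mono powr_mono2') auto
        finally show ?thesis .
      qed
      \<comment> \<open>Comparability trades the surplus power \<open>a - \<beta>2\<close> of |x|
        for the same power of |y|. What remains is \<open>- a\<close> on |x| and \<open>- b\<close>
        on |y|, nonpositive exponents that can be passed to the components.\<close>
      have "norm x powr (- \<beta>2) * norm y powr (- \<gamma>2) = norm x powr (- a) * norm x powr (a - \<beta>2) * norm y powr (- \<gamma>2)"
        by (simp flip: powr_add)
      also have "\<dots> \<le> norm x powr (- a) * (2 powr \<bar>a - \<beta>2\<bar> * norm y powr (a - \<beta>2)) * norm y powr (- \<gamma>2)"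
        using True by (intro mult_right_mono mult_left_mono powr_comparable) auto
      also have "\<dots> = 2 powr \<bar>a - \<beta>2\<bar> * (norm x powr (- a) * (norm y powr (a - \<beta>2) * norm y powr (- \<gamma>2)))"
        by (simp only: mult_ac)
      also have "norm y powr (a - \<beta>2) * norm y powr (- \<gamma>2) = norm y powr (- b)"
      proof -
        have "a - \<beta>2 + - \<gamma>2 = - b" using ab by linarith
        then show ?thesis by (simp only: powr_add[symmetric])
      qed
      also have "norm x powr (- a) * norm y powr (- b) \<le>
        (norm (fst x) powr (- a1) * norm (snd x) powr (- a3)) * (norm (fst y) powr (- (c1 - a1)) * norm (snd y) powr (- (c3 - a3)))"
        unfolding a_def b_def using True a1 a3 by (intro mult_mono two) auto
      finally have w: "norm x powr (- \<beta>2) * norm y powr (- \<gamma>2) \<le> 2 powr \<bar>a - \<beta>2\<bar> *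
        ((norm (fst x) powr (- a1) * norm (snd x) powr (- a3)) * (norm (fst y) powr (- (c1 - a1)) * norm (snd y) powr (- (c3 - a3))))"
        by simp
      have "\<mu> = m / N * \<mu> + 1 / N * \<mu>" unfolding distrib_right[symmetric] mN by simp
      then have d: "norm (x - y) powr (- \<mu>) \<le> norm (fst x - fst y) powr (- (m / N * \<mu>)) * norm (snd x - snd y) powr (- (1 / N * \<mu>))"
        using two[of "x - y" "m / N * \<mu>" "1 / N * \<mu>"] elim m \<mu> by simp
      let ?P = "norm (fst x) powr (- \<beta>1) * norm (snd x) powr (- \<beta>3) * (norm (fst y) powr (- \<gamma>1) * norm (snd y) powr (- \<gamma>3))"
      have "?\<omega> x * norm (x - y) powr (- \<mu>) * ?\<nu> y = ?P * ((norm x powr (- \<beta>2) * norm y powr (- \<gamma>2)) * norm (x - y) powr (- \<mu>))"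
        by (simp add: u_weight_def mult_ac)
      also have "\<dots> \<le> ?P * ((2 powr \<bar>a - \<beta>2\<bar> *
        ((norm (fst x) powr (- a1) * norm (snd x) powr (- a3)) * (norm (fst y) powr (- (c1 - a1)) * norm (snd y) powr (- (c3 - a3)))))
        * (norm (fst x - fst y) powr (- (m / N * \<mu>)) * norm (snd x - snd y) powr (- (1 / N * \<mu>))))"
        by (rule mult_left_mono[OF mult_mono[OF w d]]) auto
      also have "\<dots> = 2 powr \<bar>a - \<beta>2\<bar> * (K1 (fst x) (fst y) * K3 (snd x) (snd y))"
        by (simp only: K1_def K3_def minus_add_distrib powr_add mult_ac)
      finally show ?thesis unfolding L_def cc_def using True by simp
    qed
  qed
  have diag: "bilinear_bound r p (\<lambda>x y. if norm x \<le> 2 * norm y \<and> norm y \<le> 2 * norm x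
                 then ?\<omega> x * norm (x - y) powr (- \<mu>) * ?\<nu> y else 0)"
    unfolding L_def[symmetric] by (rule bilinear_bound_mono_AE[OF tensor kernel_tensor[OF k] _ pt]) (simp add: cc_def)
  have "homogeneous_root r' (- \<beta>1 + - \<beta>2 + - \<beta>3) ?\<omega>"
    using \<beta> pos by (intro homogeneous_root_u_weight) (auto simp: m_def field_simps)
  then have \<omega>: "homogeneous_root r' (- (\<beta>1 + \<beta>2 + \<beta>3)) ?\<omega>" by (simp add: algebra_simps)
  have "homogeneous_root p' (- \<gamma>1 + - \<gamma>2 + - \<gamma>3) ?\<nu>"
    using \<gamma> pos by (intro homogeneous_root_u_weight) (auto simp: m_def field_simps)
  then have \<nu>: "homogeneous_root p' (- (\<gamma>1 + \<gamma>2 + \<gamma>3)) ?\<nu>" by (simp add: algebra_simps)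
  show ?thesis
    by (rule bilinear_bound_localize[OF rp \<omega> \<nu> _ _ _ \<mu>(1) diag]) (use \<beta> \<gamma> \<Theta> in \<open>simp_all only: dim\<close>)
qed

section \<open>Fourier transforms of Schwartz functions\<close>

lemma cis_measurable [measurable]: "cis \<in> borel_measurable borel"
  by (intro borel_measurable_continuous_onI continuous_intros)

lemma integral_lborel_translate:
  fixes F :: "'a::euclidean_space \<Rightarrow> complex"
  assumes [measurable]: "F \<in> borel_measurable borel"
  shows "(LINT x|lborel. F (c + x)) = (LINT x|lborel. F x)"
proof -
  have "(LINT x|lborel. F x) = (LINT x|distr lborel borel ((+) c). F x)" by (simp add: lborel_distr_plus)
  also have "\<dots> = (LINT x|lborel. F (c + x))" by (rule integral_distr) auto
  finally show ?thesis by simp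
qed

text \<open>The integrable majorant for Schwartz functions below: at most 1 in the unit ball, and
  outside it at most a homogeneous weight whose degree is one below the critical one.\<close>

lemma integrable_decay:
  "integrable lborel (\<lambda>x::'a::euclidean_space. 1 / (1 + norm x) ^ (DIM('a) + 1))"
proof (rule integrableI_bounded)
  let ?N = "DIM('a)"
  obtain C where C: "C \<ge> 0" "\<And>\<rho>. \<rho> > 0 \<Longrightarrow>
     (\<integral>\<^sup>+x. ennreal (norm (x::'a) powr (- real (?N + 1))) * indicator {x. \<rho> \<le> norm x} x \<partial>lborel) \<le> ennreal (C * \<rho> powr (- real (?N + 1) + ?N))"
  proof -
    have "- real (?N + 1) + ?N < 0" by simp
    from homogeneous_weight_outside[OF homogeneous_weight_norm_powr this] show thesis using that by blast
  qed
  have "(\<integral>\<^sup>+x. ennreal (norm (1 / (1 + norm (x::'a)) ^ (?N + 1))) \<partial>lborel) \<le>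
    (\<integral>\<^sup>+x. indicator (ball (0::'a) 1) x + ennreal (norm (x::'a) powr (- real (?N + 1))) * indicator {x. 1 \<le> norm x} x \<partial>lborel)"
  proof (rule nn_integral_mono)
    fix x :: 'a
    show "ennreal (norm (1 / (1 + norm x) ^ (?N + 1))) \<le> indicator (ball (0::'a) 1) x + ennreal (norm x powr (- real (?N + 1))) * indicator {x. 1 \<le> norm x} x"
    proof (cases "norm x < 1")
      case True
      have "1 \<le> (1 + norm x) ^ (?N + 1)" by (rule one_le_power) simp
      then have "ennreal (norm (1 / (1 + norm x) ^ (?N + 1))) \<le> ennreal 1" by (intro ennreal_leI) (simp add: divide_le_eq)
      then show ?thesis using True by simp
    next
      case False
      then have x: "norm x \<ge> 1" by simp
      then have "0 < norm x ^ (?N + 1)" by (intro zero_less_power) linarith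
      moreover have "norm x ^ (?N + 1) \<le> (1 + norm x) ^ (?N + 1)" by (rule power_mono) auto
      ultimately have "1 / (1 + norm x) ^ (?N + 1) \<le> 1 / norm x ^ (?N + 1)" by (intro divide_left_mono) auto
      also have "1 / norm x ^ (?N + 1) = norm x powr (- real (?N + 1))"
        using x by (subst powr_minus_divide, subst powr_realpow) auto
      finally have "1 / (1 + norm x) ^ (?N + 1) \<le> norm x powr (- real (?N + 1))" .
      then show ?thesis using x by (auto simp: indicator_def intro!: ennreal_leI)
    qed
  qed
  also have "\<dots> = (\<integral>\<^sup>+x. indicator (ball (0::'a) 1) x \<partial>lborel) +
     (\<integral>\<^sup>+x. ennreal (norm (x::'a) powr (- real (?N + 1))) * indicator {x. 1 \<le> norm x} x \<partial>lborel)"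
    by (intro nn_integral_add) (auto intro!: borel_measurable_indicator borel_open)
  also have "\<dots> < \<infinity>"
  proof -
    have "(\<integral>\<^sup>+x. indicator (ball (0::'a) 1) x \<partial>lborel) < \<infinity>"
      using emeasure_lborel_ball_finite[of "0::'a" 1] by simp
    moreover have "(\<integral>\<^sup>+x. ennreal (norm (x::'a) powr (- real (?N + 1))) * indicator {x. 1 \<le> norm x} x \<partial>lborel) < \<infinity>"
      by (rule le_less_trans[OF C(2)]) simp_all
    ultimately show ?thesis by (simp add: ennreal_add_less_top)
  qed
  finally show "(\<integral>\<^sup>+x. ennreal (norm (1 / (1 + norm (x::'a)) ^ (?N + 1))) \<partial>lborel) < \<infinity>" .
qed measurable

text \<open>From (1 + |x|)^k <= 2^k (1 + |x|^k): two moments yield a bound that is regular at the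
  origin and, for large \<open>k\<close>, integrable.\<close>

lemma polynomial_weight_bound:
  fixes f :: "'a::real_normed_vector \<Rightarrow> complex"
  assumes "\<And>k::nat. \<exists>M. \<forall>x. norm x ^ k * norm (f x) \<le> M"
  obtains M where "M \<ge> 0" "\<And>x. norm (f x) \<le> M * (1 / (1 + norm x) ^ k)"
proof -
  obtain M0 Mk where M: "\<And>x. norm x ^ 0 * norm (f x) \<le> M0" "\<And>x. norm x ^ k * norm (f x) \<le> Mk"
    using assms by metis
  have "(1 + norm x) ^ k * norm (f x) \<le> 2 ^ k * (M0 + Mk)" for x :: 'a
  proof -
    have "(1 + norm x) ^ k \<le> (2 * max 1 (norm x)) ^ k" by (intro power_mono) auto
    also have "\<dots> = 2 ^ k * max 1 (norm x) ^ k" by (rule power_mult_distrib)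
    also have "max 1 (norm x) ^ k \<le> norm x ^ 0 + norm x ^ k" by (auto simp: max_def)
    finally have "(1 + norm x) ^ k \<le> 2 ^ k * (norm x ^ 0 + norm x ^ k)" by simp
    then have "(1 + norm x) ^ k * norm (f x) \<le> 2 ^ k * (norm x ^ 0 + norm x ^ k) * norm (f x)"
      by (rule mult_right_mono) simp
    also have "\<dots> = 2 ^ k * (norm x ^ 0 * norm (f x) + norm x ^ k * norm (f x))" by (simp only: distrib_right mult.assoc)
    also have "\<dots> \<le> 2 ^ k * (M0 + Mk)" by (intro mult_left_mono add_mono M) auto
    finally show ?thesis .
  qed
  then have b: "(1 + norm x) ^ k * norm (f x) \<le> \<bar>2 ^ k * (M0 + Mk)\<bar>" for x :: 'a by (rule order_trans) simp
  show thesis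
  proof (rule that[of "\<bar>2 ^ k * (M0 + Mk)\<bar>"])
    fix x :: 'a
    have "0 < (1 + norm x) ^ k" by (intro zero_less_power add_pos_nonneg) auto
    then show "norm (f x) \<le> \<bar>2 ^ k * (M0 + Mk)\<bar> * (1 / (1 + norm x) ^ k)"
      using b[of x] by (simp add: pos_le_divide_eq mult.commute)
  qed simp
qed

lemma schwartzD:
  assumes "g \<in> schwartz" "set vs \<subseteq> Basis"
  shows "iter_partial vs g differentiable (at x)" "\<And>k::nat. \<exists>M. \<forall>x. norm x ^ k * norm (iter_partial vs g x) \<le> M"
    "iter_partial vs g \<in> borel_measurable borel"
proof -
  show d: "iter_partial vs g differentiable (at x)" for x using assms unfolding schwartz_def by blast
  show "\<exists>M. \<forall>x. norm x ^ k * norm (iter_partial vs g x) \<le> M" for k :: nat using assms unfolding schwartz_def by blast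
  have "continuous_on UNIV (iter_partial vs g)"
    by (intro differentiable_imp_continuous_on) (simp add: differentiable_on_def d)
  then show "iter_partial vs g \<in> borel_measurable borel" by (rule borel_measurable_continuous_onI)
qed

lemma norm_fourier_le:
  fixes h :: "'a::euclidean_space \<Rightarrow> complex"
  shows "norm (fourier h \<xi>) \<le> (LINT x|lborel. norm (h x))"
proof -
  have "norm (fourier h \<xi>) \<le> (LINT x|lborel. norm (cis (- 2 * pi * (x \<bullet> \<xi>)) * h x))"
    unfolding fourier_def by (rule integral_norm_bound)
  then show ?thesis by (simp add: norm_mult)
qed

text \<open>The steps \<open>1 / (n + 1)\<close> match the difference quotients of Schwartz
  functions below. A sequence is what dominated convergence takes, and the shift by one avoids
  division by zero at \<open>n = 0\<close>.\<close>

lemma cis_difference_quotient: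
  "(\<lambda>n. (real n + 1) *\<^sub>R (cis (c / (real n + 1)) - 1)) \<longlonglongrightarrow> \<i> * of_real c"
proof -
  have D: "((\<lambda>t. cis (c * t)) has_derivative (\<lambda>t. t *\<^sub>R (\<i> * of_real c))) (at 0)"
  proof -
    have "((\<lambda>z. exp (\<i> * (of_real c * z))) has_field_derivative \<i> * of_real c) (at (of_real 0))"
      by (auto intro!: derivative_eq_intros)
    from has_vector_derivative_real_field[OF this, of UNIV] show ?thesis
      by (simp add: cis_conv_exp has_vector_derivative_def)
  qed
  have lim: "filterlim (\<lambda>n. 1 / (real n + 1)) (at 0) sequentially"
    unfolding filterlim_at by (auto intro!: LIMSEQ_Suc lim_1_over_n simp: add.commute eventually_sequentially)
      (use lim_1_over_n[THEN LIMSEQ_Suc] in \<open>simp add: add.commute\<close>)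
  have "(\<lambda>n. norm (cis (c * (0 + 1 / (real n + 1))) - cis (c * 0) - (1 / (real n + 1)) *\<^sub>R (\<i> * of_real c)) / norm (1 / (real n + 1))) \<longlonglongrightarrow> 0"
    using filterlim_compose[OF conjunct2[OF D[unfolded has_derivative_at]] lim] .
  moreover have "norm (cis (c * (0 + 1 / (real n + 1))) - cis (c * 0) - (1 / (real n + 1)) *\<^sub>R (\<i> * of_real c)) / norm (1 / (real n + 1))
    = norm ((real n + 1) *\<^sub>R (cis (c / (real n + 1)) - 1) - \<i> * of_real c)" for n
  proof -
    have "(real n + 1) *\<^sub>R (cis (c / (real n + 1)) - 1) - \<i> * of_real c =
      (real n + 1) *\<^sub>R (cis (c * (0 + 1 / (real n + 1))) - cis (c * 0) - (1 / (real n + 1)) *\<^sub>R (\<i> * of_real c))"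
      by (simp add: scaleR_diff_right)
    then show ?thesis by (simp only: norm_scaleR) (simp add: divide_inverse)
  qed
  ultimately have "(\<lambda>n. norm ((real n + 1) *\<^sub>R (cis (c / (real n + 1)) - 1) - \<i> * of_real c)) \<longlonglongrightarrow> 0" by simp
  then show ?thesis by (simp add: tendsto_norm_zero_iff LIM_zero_iff)
qed

text \<open>A limit of difference quotients replaces integration by parts.\<close>

lemma fourier_iter_partial_Cons:
  fixes g :: "'a::euclidean_space \<Rightarrow> complex"
  assumes g: "g \<in> schwartz" and vs: "set vs \<subseteq> Basis" and v: "v \<in> Basis"
  shows "fourier (iter_partial (v # vs) g) \<xi> = \<i> * of_real (2 * pi * (v \<bullet> \<xi>)) * fourier (iter_partial vs g) \<xi>"
proof -
  let ?N = "DIM('a)"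
  define h where "h = iter_partial vs g"
  define h' where "h' = iter_partial (v # vs) g"
  have vs': "set (v # vs) \<subseteq> Basis" using v vs by simp
  have nv: "norm v = 1" using v by simp
  note H = schwartzD[OF g vs, folded h_def] and H' = schwartzD[OF g vs', folded h'_def]
  note [measurable] = H(3) H'(3)
  have deriv: "(h has_derivative frechet_derivative h (at x)) (at x)" for x
    using H(1) by (simp add: frechet_derivative_works)
  have h'_eq: "h' x = frechet_derivative h (at x) v" for x by (simp add: h'_def h_def)
  obtain M0 where M0: "M0 \<ge> 0" "\<And>x. norm (h x) \<le> M0 * (1 / (1 + norm x) ^ (?N + 1))"
    using polynomial_weight_bound[OF H(2)] by blast
  obtain M where M: "M \<ge> 0" "\<And>x. norm (h' x) \<le> M * (1 / (1 + norm x) ^ (?N + 1))"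
    using polynomial_weight_bound[OF H'(2)] by blast
  have hint: "integrable lborel (\<lambda>x. cis (- 2 * pi * (x \<bullet> \<xi>)) * h x)"
    by (rule Bochner_Integration.integrable_bound[OF integrable_mult_right[OF integrable_decay, of M0]])
       (use M0 in \<open>auto simp: norm_mult intro!: AE_I2 order_trans[OF M0(2)]\<close>)
  define s where "s n x = (real n + 1) *\<^sub>R (h (x + (1 / (real n + 1)) *\<^sub>R v) - h x)" for n :: nat and x
  have [measurable]: "s n \<in> borel_measurable borel" for n unfolding s_def by measurable
  have lim: "(\<lambda>n. s n x) \<longlonglongrightarrow> h' x" for x
  proof -
    have "filterlim (\<lambda>n. (1 / (real n + 1)) *\<^sub>R v) (at 0) sequentially"
    proof -
      have "(\<lambda>n. 1 / (real n + 1)) \<longlonglongrightarrow> 0" using lim_1_over_n[THEN LIMSEQ_Suc] by (simp add: add.commute)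
      then have "(\<lambda>n. (1 / (real n + 1)) *\<^sub>R v) \<longlonglongrightarrow> 0 *\<^sub>R v" by (intro tendsto_intros)
      moreover have "v \<noteq> 0" using nv by auto
      ultimately show ?thesis unfolding filterlim_at by (auto simp: add_nonneg_eq_0_iff)
    qed
    from filterlim_compose[OF conjunct2[OF deriv[of x, unfolded has_derivative_at]] this]
    have "(\<lambda>n. norm (h (x + (1 / (real n + 1)) *\<^sub>R v) - h x - frechet_derivative h (at x) ((1 / (real n + 1)) *\<^sub>R v)) /
        norm ((1 / (real n + 1)) *\<^sub>R v)) \<longlonglongrightarrow> 0" .
    moreover have "norm (h (x + (1 / (real n + 1)) *\<^sub>R v) - h x - frechet_derivative h (at x) ((1 / (real n + 1)) *\<^sub>R v)) /
        norm ((1 / (real n + 1)) *\<^sub>R v) = norm (s n x - h' x)" for n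
    proof -
      have "linear (frechet_derivative h (at x))" using deriv[of x] by (rule has_derivative_linear)
      then have "frechet_derivative h (at x) ((1 / (real n + 1)) *\<^sub>R v) = (1 / (real n + 1)) *\<^sub>R h' x"
        by (simp add: linear_cmul h'_eq)
      moreover have "s n x - h' x = (real n + 1) *\<^sub>R (h (x + (1 / (real n + 1)) *\<^sub>R v) - h x - (1 / (real n + 1)) *\<^sub>R h' x)"
        by (simp add: s_def scaleR_diff_right)
      ultimately show ?thesis by (simp only: norm_scaleR nv) (simp add: divide_inverse)
    qed
    ultimately have "(\<lambda>n. norm (s n x - h' x)) \<longlonglongrightarrow> 0" by simp
    then show ?thesis by (simp add: tendsto_norm_zero_iff LIM_zero_iff)
  qed
  \<comment> \<open>Mean value inequality on the segment from x to x + v/(n + 1), of length at most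
    1. There 1 + |x| <= 2 (1 + |x + t v|), which costs a power of 2 and gives a majorant independent
    of \<open>n\<close>.\<close>
  have bd: "norm (s n x) \<le> M * 2 ^ (?N + 1) * (1 / (1 + norm x) ^ (?N + 1))" for n x
  proof -
    let ?d = "1 / (real n + 1)"
    have d: "0 < ?d" "?d \<le> 1" by auto
    define \<phi> where "\<phi> t = h (x + t *\<^sub>R v)" for t
    have D: "(\<phi> has_derivative (\<lambda>r. r *\<^sub>R h' (x + t *\<^sub>R v))) (at t)" for t
    proof -
      have "(\<phi> has_derivative (\<lambda>r. frechet_derivative h (at (x + t *\<^sub>R v)) (r *\<^sub>R v))) (at t)"
        unfolding \<phi>_def
        by (rule has_derivative_compose[OF _ deriv]) (auto intro!: derivative_eq_intros)
      moreover have "linear (frechet_derivative h (at (x + t *\<^sub>R v)))" using deriv by (rule has_derivative_linear)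
      ultimately show ?thesis by (simp add: linear_cmul h'_eq)
    qed
    have "continuous_on {0..?d} \<phi>" by (rule has_derivative_continuous_on) (rule has_derivative_at_withinI[OF D])
    from mvt_general[OF d(1) this D] obtain t where t: "0 < t" "t < ?d"
      "norm (\<phi> ?d - \<phi> 0) \<le> norm ((?d - 0) *\<^sub>R h' (x + t *\<^sub>R v))" by auto
    have aux: "1 + a \<le> 2 * (1 + b)" if "a \<le> b + 1" "0 \<le> b" for a b :: real using that by simp
    have "norm (s n x) = (real n + 1) * norm (\<phi> ?d - \<phi> 0)" by (simp add: s_def \<phi>_def)
    also have "\<dots> \<le> (real n + 1) * norm ((?d - 0) *\<^sub>R h' (x + t *\<^sub>R v))" using t(3) by (intro mult_left_mono) auto
    also have "\<dots> = norm (h' (x + t *\<^sub>R v))" by simp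
    also have "\<dots> \<le> M * (1 / (1 + norm (x + t *\<^sub>R v)) ^ (?N + 1))" by (rule M)
    also have "\<dots> \<le> M * (2 ^ (?N + 1) * (1 / (1 + norm x) ^ (?N + 1)))"
    proof (intro mult_left_mono M(1))
      have "norm x \<le> norm (x + t *\<^sub>R v) + norm (t *\<^sub>R v)" using norm_triangle_ineq4[of "x + t *\<^sub>R v" "t *\<^sub>R v"] by simp
      moreover have "t \<le> 1" using t(2) d(2) by linarith
      then have "norm (t *\<^sub>R v) \<le> 1" using t(1) nv by simp
      ultimately have "norm x \<le> norm (x + t *\<^sub>R v) + 1" by (meson add_left_mono order_trans)
      then have "1 + norm x \<le> 2 * (1 + norm (x + t *\<^sub>R v))" 
        using aux[OF _ norm_ge_zero] by blast
      then have "(1 + norm x) ^ (?N + 1) \<le> (2 * (1 + norm (x + t *\<^sub>R v))) ^ (?N + 1)" by (intro power_mono) auto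
      also have "\<dots> = 2 ^ (?N + 1) * (1 + norm (x + t *\<^sub>R v)) ^ (?N + 1)" by (rule power_mult_distrib)
      finally have *: "(1 + norm x) ^ (?N + 1) \<le> 2 ^ (?N + 1) * (1 + norm (x + t *\<^sub>R v)) ^ (?N + 1)" .
      have "0 < (1 + norm x) ^ (?N + 1)" "0 < (1 + norm (x + t *\<^sub>R v)) ^ (?N + 1)"
        by (intro zero_less_power add_pos_nonneg; simp)+
      then show "1 / (1 + norm (x + t *\<^sub>R v)) ^ (?N + 1) \<le> 2 ^ (?N + 1) * (1 / (1 + norm x) ^ (?N + 1))"
        using * by (simp only: pos_divide_le_eq pos_le_divide_eq times_divide_eq_right times_divide_eq_left mult_1_right mult_1_left)
    qed
    finally show ?thesis by (simp only: mult.assoc)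
  qed
  have "(\<lambda>n. LINT x|lborel. cis (- 2 * pi * (x \<bullet> \<xi>)) * s n x) \<longlonglongrightarrow> (LINT x|lborel. cis (- 2 * pi * (x \<bullet> \<xi>)) * h' x)"
  proof (rule integral_dominated_convergence)
    show "integrable lborel (\<lambda>x::'a. M * 2 ^ (?N + 1) * (1 / (1 + norm x) ^ (?N + 1)))"
      by (intro integrable_mult_right integrable_decay)
    show "AE x in lborel. (\<lambda>n. cis (- 2 * pi * (x \<bullet> \<xi>)) * s n x) \<longlonglongrightarrow> cis (- 2 * pi * (x \<bullet> \<xi>)) * h' x"
      by (intro AE_I2 tendsto_mult_left lim)
    show "AE x in lborel. norm (cis (- 2 * pi * (x \<bullet> \<xi>)) * s n x) \<le> M * 2 ^ (?N + 1) * (1 / (1 + norm x) ^ (?N + 1))" for n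
      using bd by (intro AE_I2) (simp add: norm_mult)
  qed measurable
  then have 1: "(\<lambda>n. LINT x|lborel. cis (- 2 * pi * (x \<bullet> \<xi>)) * s n x) \<longlonglongrightarrow> fourier h' \<xi>"
    unfolding fourier_def .
  have "(LINT x|lborel. cis (- 2 * pi * (x \<bullet> \<xi>)) * s n x) =
      ((real n + 1) *\<^sub>R (cis ((2 * pi * (v \<bullet> \<xi>)) / (real n + 1)) - 1)) * fourier h \<xi>" for n
  proof -
    let ?c = "(1 / (real n + 1)) *\<^sub>R v"
    \<comment> \<open>The constant phase makes F(c + x) equal to the shifted term of the difference
      quotient; by translation invariance the shift leaves only this phase behind.\<close>
    define F where "F y = cis (2 * pi * (?c \<bullet> \<xi>)) * (cis (- 2 * pi * (y \<bullet> \<xi>)) * h y)" for y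
    have [measurable]: "F \<in> borel_measurable borel" unfolding F_def by measurable
    have Fint: "integrable lborel F" unfolding F_def by (intro integrable_mult_right hint)
    have Fc: "integrable lborel (\<lambda>x. F (?c + x))"
      using Fint by (subst (asm) lborel_distr_plus[symmetric, of ?c]) (simp add: integrable_distr_eq)
    have "cis (- 2 * pi * (x \<bullet> \<xi>)) * s n x = (real n + 1) *\<^sub>R (F (?c + x) - cis (- 2 * pi * (x \<bullet> \<xi>)) * h x)" for x
    proof -
      have "cis (2 * pi * (?c \<bullet> \<xi>)) * cis (- 2 * pi * ((?c + x) \<bullet> \<xi>)) = cis (- 2 * pi * (x \<bullet> \<xi>))"
        by (simp add: cis_mult inner_add_left algebra_simps)
      then have "F (?c + x) = cis (- 2 * pi * (x \<bullet> \<xi>)) * h (x + ?c)"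
        unfolding F_def by (simp only: mult.assoc[symmetric] add.commute)
      then show ?thesis by (simp add: s_def algebra_simps scaleR_diff_right)
    qed
    then have "(LINT x|lborel. cis (- 2 * pi * (x \<bullet> \<xi>)) * s n x) =
      (real n + 1) *\<^sub>R ((LINT x|lborel. F (?c + x)) - fourier h \<xi>)"
      using Fc hint by (simp add: fourier_def)
    also have "(LINT x|lborel. F (?c + x)) = (LINT x|lborel. F x)" by (rule integral_lborel_translate) measurable
    also have "\<dots> = cis (2 * pi * (?c \<bullet> \<xi>)) * fourier h \<xi>" unfolding F_def fourier_def by simp
    also have "2 * pi * (?c \<bullet> \<xi>) = (2 * pi * (v \<bullet> \<xi>)) / (real n + 1)" by simp
    finally show ?thesis by (simp add: algebra_simps)
  qed
  then have 2: "(\<lambda>n. LINT x|lborel. cis (- 2 * pi * (x \<bullet> \<xi>)) * s n x) \<longlonglongrightarrow> \<i> * of_real (2 * pi * (v \<bullet> \<xi>)) * fourier h \<xi>"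
    by (simp only:) (intro tendsto_mult_right cis_difference_quotient)
  show ?thesis using LIMSEQ_unique[OF 1 2] by (simp only: h_def h'_def)
qed

lemma fourier_measurable [measurable]:
  fixes g :: "'a::euclidean_space \<Rightarrow> complex"
  assumes [measurable]: "g \<in> borel_measurable borel"
  shows "fourier g \<in> borel_measurable borel"
  unfolding fourier_def[abs_def] by measurable

lemma inv_fourier_measurable [measurable]:
  fixes g :: "'a::euclidean_space \<Rightarrow> complex"
  assumes [measurable]: "g \<in> borel_measurable borel"
  shows "inv_fourier g \<in> borel_measurable borel"
  unfolding inv_fourier_def[abs_def] by measurable

lemma fourier_iter_partial_replicate:
  fixes g :: "'a::euclidean_space \<Rightarrow> complex"
  assumes "g \<in> schwartz" "v \<in> Basis"
  shows "fourier (iter_partial (replicate k v) g) \<xi> = (\<i> * of_real (2 * pi * (v \<bullet> \<xi>))) ^ k * fourier g \<xi>"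
proof (induction k)
  case (Suc k)
  have "set (replicate k v) \<subseteq> Basis" using assms(2) by auto
  from fourier_iter_partial_Cons[OF assms(1) this assms(2)] Suc show ?case
    by (simp only: replicate_Suc power_Suc mult.assoc)
qed simp

text \<open>Pure derivatives suffice: differentiating \<open>k\<close> times along one basis vector
  controls the k-th power of that coordinate of \<xi>, and some coordinate is at least |\<xi>|
  divided by the dimension.\<close>

lemma fourier_decay:
  fixes g :: "'a::euclidean_space \<Rightarrow> complex"
  assumes g: "g \<in> schwartz"
  shows "\<exists>M. \<forall>\<xi>. norm \<xi> ^ k * norm (fourier g \<xi>) \<le> M"
proof -
  let ?N = "DIM('a)"
  define I where "I v = (LINT x|lborel. norm (iter_partial (replicate k v) g x))" for v
  have b: "\<bar>v \<bullet> \<xi>\<bar> ^ k * norm (fourier g \<xi>) \<le> I v" if v: "v \<in> Basis" for v \<xi>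
  proof -
    have "1 * \<bar>v \<bullet> \<xi>\<bar> \<le> (2 * pi) * \<bar>v \<bullet> \<xi>\<bar>" using pi_ge_two by (intro mult_right_mono) auto
    then have "\<bar>v \<bullet> \<xi>\<bar> ^ k \<le> (2 * pi * \<bar>v \<bullet> \<xi>\<bar>) ^ k" by (intro power_mono) auto
    then have "\<bar>v \<bullet> \<xi>\<bar> ^ k * norm (fourier g \<xi>) \<le> (2 * pi * \<bar>v \<bullet> \<xi>\<bar>) ^ k * norm (fourier g \<xi>)"
      by (rule mult_right_mono) simp
    also have "\<dots> = norm (fourier (iter_partial (replicate k v) g) \<xi>)"
      unfolding fourier_iter_partial_replicate[OF g v] by (simp add: norm_mult norm_power abs_mult)
    also have "\<dots> \<le> I v" unfolding I_def by (rule norm_fourier_le)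
    finally show ?thesis .
  qed
  have "norm \<xi> ^ k * norm (fourier g \<xi>) \<le> (\<Sum>v\<in>Basis. real ?N ^ k * I v)" for \<xi>
  proof -
    have "\<exists>v\<in>Basis. norm \<xi> \<le> real ?N * \<bar>v \<bullet> \<xi>\<bar>"
    proof (rule ccontr)
      assume "\<not> ?thesis"
      then have "(\<Sum>v\<in>(Basis::'a set). real ?N * \<bar>v \<bullet> \<xi>\<bar>) < (\<Sum>v\<in>(Basis::'a set). norm \<xi>)"
        by (intro sum_strict_mono) (auto simp: not_le)
      then have "real ?N * (\<Sum>v\<in>(Basis::'a set). \<bar>v \<bullet> \<xi>\<bar>) < real ?N * norm \<xi>" by (simp add: sum_distrib_left)
      then have "(\<Sum>v\<in>(Basis::'a set). \<bar>v \<bullet> \<xi>\<bar>) < norm \<xi>" by simp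
      then show False using norm_le_l1[of \<xi>] by (simp add: inner_commute)
    qed
    then obtain v where v: "v \<in> Basis" "norm \<xi> \<le> real ?N * \<bar>v \<bullet> \<xi>\<bar>" by blast
    have "norm \<xi> ^ k * norm (fourier g \<xi>) \<le> (real ?N * \<bar>v \<bullet> \<xi>\<bar>) ^ k * norm (fourier g \<xi>)"
      using v(2) by (intro mult_right_mono power_mono) auto
    also have "\<dots> = real ?N ^ k * (\<bar>v \<bullet> \<xi>\<bar> ^ k * norm (fourier g \<xi>))" by (simp add: power_mult_distrib)
    also have "\<dots> \<le> real ?N ^ k * I v" using b[OF v(1)] by (intro mult_left_mono) auto
    also have "\<dots> \<le> (\<Sum>v\<in>Basis. real ?N ^ k * I v)"
      using v(1) by (intro member_le_sum[of v Basis "\<lambda>v. real ?N ^ k * I v"]) (auto simp: I_def)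
    finally show ?thesis .
  qed
  then show ?thesis by blast
qed

lemma schwartz_measurable: "g \<in> schwartz \<Longrightarrow> g \<in> borel_measurable borel"
  using schwartzD(3)[of g "[]"] by simp

text \<open>The real power is rounded up to an integer \<open>m\<close>, which the rapid decay of
  the transform outweighs. It is applied to the orders t + b and s + b, positive because b >
  \<tau>.\<close>

lemma integrable_norm_powr_fourier:
  fixes g :: "'a::euclidean_space \<Rightarrow> complex"
  assumes g: "g \<in> schwartz" and s: "s > 0"
  shows "integrable lborel (\<lambda>\<xi>. of_real (norm \<xi> powr s) * fourier g \<xi>)"
proof -
  note [measurable] = schwartz_measurable[OF g]
  let ?N = "DIM('a)"
  define m where "m = nat \<lceil>s\<rceil>"
  have m: "s \<le> real m" unfolding m_def by (rule real_nat_ceiling_ge)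
  obtain M where M: "M \<ge> 0" "\<And>\<xi>. norm (fourier g \<xi>) \<le> M * (1 / (1 + norm \<xi>) ^ (m + (?N + 1)))"
    using polynomial_weight_bound[OF fourier_decay[OF g]] by blast
  have "norm (of_real (norm \<xi> powr s) * fourier g \<xi>) \<le> norm (M * (1 / (1 + norm \<xi>) ^ (?N + 1)))" for \<xi>
  proof -
    have p: "1 + norm \<xi> > 0" by (simp add: add_pos_nonneg)
    have "norm \<xi> powr s \<le> (1 + norm \<xi>) powr s" using s by (intro powr_mono2) auto
    also have "\<dots> \<le> (1 + norm \<xi>) powr real m" using m by (intro powr_mono) auto
    also have "\<dots> = (1 + norm \<xi>) ^ m" using p by (rule powr_realpow)
    finally have "norm (of_real (norm \<xi> powr s) * fourier g \<xi>) \<le> (1 + norm \<xi>) ^ m * (M * (1 / (1 + norm \<xi>) ^ (m + (?N + 1))))"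
      using M(2)[of \<xi>] by (simp only: norm_mult norm_of_real) (intro mult_mono; simp)
    also have "\<dots> = M * ((1 + norm \<xi>) ^ m / ((1 + norm \<xi>) ^ m * (1 + norm \<xi>) ^ (?N + 1)))"
      by (simp only: power_add times_divide_eq_right mult_1_right mult.commute)
    also have "(1 + norm \<xi>) ^ m / ((1 + norm \<xi>) ^ m * (1 + norm \<xi>) ^ (?N + 1)) = 1 / (1 + norm \<xi>) ^ (?N + 1)"
      using p by simp
    also have "M * \<dots> \<le> norm (M * \<dots>)" by (simp only: real_norm_def abs_ge_self)
    finally show ?thesis .
  qed
  then show ?thesis
    by (intro Bochner_Integration.integrable_bound[OF integrable_mult_right[OF integrable_decay, of M]] AE_I2) measurable
qed

section \<open>Fubini's theorem and the Fourier transform of Gaussians\<close>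

lemma fubini_lborel:
  fixes f :: "'a::euclidean_space \<Rightarrow> 'b::euclidean_space \<Rightarrow> complex"
  assumes [measurable]: "case_prod f \<in> borel_measurable (borel \<Otimes>\<^sub>M borel)"
    and fin: "(\<integral>\<^sup>+x. \<integral>\<^sup>+y. ennreal (norm (f x y)) \<partial>lborel \<partial>lborel) < \<infinity>"
  shows "(LINT x|lborel. LINT y|lborel. f x y) = (LINT y|lborel. LINT x|lborel. f x y)"
proof -
  have m: "case_prod f \<in> borel_measurable (lborel \<Otimes>\<^sub>M lborel)"
    by (simp cong: measurable_cong_sets sets_pair_measure_cong)
  have "(\<integral>\<^sup>+z. ennreal (norm (case_prod f z)) \<partial>(lborel \<Otimes>\<^sub>M lborel)) = (\<integral>\<^sup>+x. \<integral>\<^sup>+y. ennreal (norm (f x y)) \<partial>lborel \<partial>lborel)"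
    using m by (subst lborel.nn_integral_fst[symmetric]) auto
  then have "integrable (lborel \<Otimes>\<^sub>M lborel) (case_prod f)"
    using m fin by (intro integrableI_bounded) auto
  from lborel_pair.Fubini_integral[OF this] show ?thesis by simp
qed

text \<open>The substitution z = c x with c^2 = u/(2 pi) turns the Gaussian into a multiple of the
  standard normal density, whose characteristic function is known.\<close>

lemma gaussian_fourier_real:
  assumes u: "u > 0"
  shows "integrable lborel (\<lambda>z. exp (- pi * z\<^sup>2 / u))"
    and "(LINT z|lborel. of_real (exp (- pi * z\<^sup>2 / u)) * cis (- 2 * pi * (z * \<xi>))) = of_real (sqrt u * exp (- pi * u * \<xi>\<^sup>2))"
proof -
  define c where "c = sqrt (u / (2 * pi))"
  have c: "c > 0" "c\<^sup>2 = u / (2 * pi)" using u by (simp_all add: c_def)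
  have ex: "exp (- pi * (c * x)\<^sup>2 / u) = sqrt (2 * pi) * std_normal_density x" for x
  proof -
    have "- pi * (c * x)\<^sup>2 / u = - x\<^sup>2 / 2" using u by (simp add: power_mult_distrib c(2))
    then show ?thesis by (simp add: std_normal_density_def)
  qed
  have "integrable lborel (\<lambda>x. exp (- pi * (0 + c * x)\<^sup>2 / u))"
    using integrable_mult_right[OF integrable_std_normal_moment[of 0], of "sqrt (2 * pi)"]
    by (simp only: add_0_left ex power_0 mult_1_right)
  then show "integrable lborel (\<lambda>z. exp (- pi * z\<^sup>2 / u))"
    using lborel_integrable_real_affine_iff[of c "\<lambda>z. exp (- pi * z\<^sup>2 / u)" 0] c by simp
  let ?t = "- 2 * pi * c * \<xi>"
  have "(LINT z|lborel. of_real (exp (- pi * z\<^sup>2 / u)) * cis (- 2 * pi * (z * \<xi>))) =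
    \<bar>c\<bar> *\<^sub>R (LINT x|lborel. of_real (exp (- pi * (0 + c * x)\<^sup>2 / u)) * cis (- 2 * pi * ((0 + c * x) * \<xi>)))"
    using c by (intro lborel_integral_real_affine) simp
  also have "(LINT x|lborel. of_real (exp (- pi * (0 + c * x)\<^sup>2 / u)) * cis (- 2 * pi * ((0 + c * x) * \<xi>))) =
    (LINT x|lborel. of_real (sqrt (2 * pi)) * (std_normal_density x *\<^sub>R iexp (?t * x)))"
    by (intro Bochner_Integration.integral_cong refl) (simp only: add_0_left ex, simp add: cis_conv_exp scaleR_conv_of_real mult_ac)
  also have "\<dots> = of_real (sqrt (2 * pi)) * (LINT x|lborel. std_normal_density x *\<^sub>R iexp (?t * x))"
    by (rule integral_mult_right_zero)
  also have "(LINT x|lborel. std_normal_density x *\<^sub>R iexp (?t * x)) = char std_normal_distribution ?t"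
    unfolding char_def by (subst integral_density) auto
  also have "\<dots> = of_real (exp (- (?t\<^sup>2) / 2))" by (simp only: char_std_normal_distribution)
  also have "- (?t\<^sup>2) / 2 = - pi * u * \<xi>\<^sup>2" by (simp add: power_mult_distrib c(2)) (simp add: power2_eq_square)
  finally have "(LINT z|lborel. of_real (exp (- pi * z\<^sup>2 / u)) * cis (- 2 * pi * (z * \<xi>))) =
    \<bar>c\<bar> *\<^sub>R (of_real (sqrt (2 * pi)) * of_real (exp (- pi * u * \<xi>\<^sup>2)) :: complex)" .
  also have "\<dots> = of_real ((c * sqrt (2 * pi)) * exp (- pi * u * \<xi>\<^sup>2))"
    using c by (simp add: scaleR_conv_of_real mult.assoc)
  also have "c * sqrt (2 * pi) = sqrt u" using u by (simp add: c_def real_sqrt_divide real_sqrt_mult)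
  finally show "(LINT z|lborel. of_real (exp (- pi * z\<^sup>2 / u)) * cis (- 2 * pi * (z * \<xi>))) = of_real (sqrt u * exp (- pi * u * \<xi>\<^sup>2))" .
qed

lemma integral_lborel_prod_Basis:
  fixes f :: "'a::euclidean_space \<Rightarrow> real \<Rightarrow> complex"
  assumes f: "\<And>b. b \<in> Basis \<Longrightarrow> integrable lborel (f b)"
  shows "(LINT z|lborel. (\<Prod>b\<in>Basis. f b (z \<bullet> b))) = (\<Prod>b\<in>Basis. (LINT x|lborel. f b x))"
proof -
  interpret product_sigma_finite "\<lambda>b::'a. lborel :: real measure" ..
  have [measurable]: "b \<in> Basis \<Longrightarrow> f b \<in> borel_measurable borel" for b using borel_measurable_integrable[OF f] by simp
  have "(LINT z|lborel. (\<Prod>b\<in>(Basis::'a set). f b (z \<bullet> b))) =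
    (LINT x|(\<Pi>\<^sub>M b\<in>(Basis::'a set). lborel). (\<Prod>b\<in>Basis. f b ((\<Sum>c\<in>Basis. x c *\<^sub>R c) \<bullet> b)))"
    unfolding lborel_def[where 'a = 'a] lborel_eq_real[symmetric]
    by (rule integral_distr) measurable
  also have "\<dots> = (LINT x|(\<Pi>\<^sub>M b\<in>(Basis::'a set). lborel). (\<Prod>b\<in>Basis. f b (x b)))"
    by (intro Bochner_Integration.integral_cong refl prod.cong) simp
  also have "\<dots> = (\<Prod>b\<in>Basis. (LINT x|lborel. f b x))"
    by (rule product_integral_prod) (auto intro: f)
  finally show ?thesis .
qed

section \<open>Gaussians and the Riesz potential\<close>

lemma power2_norm_Basis: "(norm z)\<^sup>2 = (\<Sum>b\<in>Basis. (z \<bullet> b)\<^sup>2)" for z :: "'a::euclidean_space"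
  unfolding power2_norm_eq_inner by (subst euclidean_inner) (simp add: power2_eq_square)

lemma gaussian_finite:
  assumes "u > 0"
  shows "(\<integral>\<^sup>+z. ennreal (exp (- pi * (norm (z::'a::euclidean_space))\<^sup>2 / u)) \<partial>lborel) < \<infinity>"
proof -
  have "(\<integral>\<^sup>+z. ennreal (exp (- pi * (norm (z::'a))\<^sup>2 / u)) \<partial>lborel) =
    (\<integral>\<^sup>+z. (\<Prod>b\<in>(Basis::'a set). ennreal (exp (- pi * (z \<bullet> b)\<^sup>2 / u))) \<partial>lborel)"
  proof (rule nn_integral_cong)
    fix z :: 'a
    have "- pi * (norm z)\<^sup>2 / u = (\<Sum>b\<in>Basis. - pi * (z \<bullet> b)\<^sup>2 / u)"
      by (simp only: power2_norm_Basis sum_distrib_left sum_divide_distrib)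
    then show "ennreal (exp (- pi * (norm z)\<^sup>2 / u)) = (\<Prod>b\<in>(Basis::'a set). ennreal (exp (- pi * (z \<bullet> b)\<^sup>2 / u)))"
      by (simp only: exp_sum finite_Basis) (simp add: prod_ennreal)
  qed
  also have "\<dots> = (\<Prod>b\<in>(Basis::'a set). \<integral>\<^sup>+x. ennreal (exp (- pi * x\<^sup>2 / u)) \<partial>lborel)"
    by (rule nn_integral_lborel_prod) auto
  also have "\<dots> < \<infinity>"
  proof -
    have "(\<integral>\<^sup>+x. ennreal (exp (- pi * x\<^sup>2 / u)) \<partial>lborel) < \<infinity>"
      using gaussian_fourier_real(1)[OF assms] unfolding integrable_iff_bounded by simp
    then have "(\<Prod>b\<in>(Basis::'a set). \<integral>\<^sup>+x. ennreal (exp (- pi * x\<^sup>2 / u)) \<partial>lborel) < top"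
      by (simp only: prod_constant) (auto simp: power_less_top_ennreal)
    then show ?thesis by simp
  qed
  finally show ?thesis .
qed

lemma gaussian_fourier:
  fixes \<xi> :: "'a::euclidean_space"
  assumes u: "u > 0"
  shows "(LINT z|lborel. of_real (exp (- pi * (norm z)\<^sup>2 / u)) * cis (- 2 * pi * (z \<bullet> \<xi>))) =
    of_real (sqrt u ^ DIM('a) * exp (- pi * u * (norm \<xi>)\<^sup>2))"
proof -
  define f where "f b x = of_real (exp (- pi * x\<^sup>2 / u)) * cis (- 2 * pi * (x * (\<xi> \<bullet> b)))" for b and x :: real
  have [measurable]: "f b \<in> borel_measurable borel" for b unfolding f_def[abs_def] by measurable
  have "integrable lborel (f b)" for b
    by (rule Bochner_Integration.integrable_bound[OF gaussian_fourier_real(1)[OF u]]) (auto simp: f_def norm_mult)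
  then have "(LINT z|lborel. (\<Prod>b\<in>Basis. f b (z \<bullet> b))) = (\<Prod>b\<in>Basis. (LINT x|lborel. f b x))"
    by (intro integral_lborel_prod_Basis)
  also have "(\<lambda>z::'a. \<Prod>b\<in>Basis. f b (z \<bullet> b)) = (\<lambda>z. of_real (exp (- pi * (norm z)\<^sup>2 / u)) * cis (- 2 * pi * (z \<bullet> \<xi>)))"
  proof
    fix z :: 'a
    have "(\<Prod>b\<in>Basis. f b (z \<bullet> b)) = of_real (\<Prod>b\<in>Basis. exp (- pi * (z \<bullet> b)\<^sup>2 / u)) * (\<Prod>b\<in>Basis. cis (- 2 * pi * ((z \<bullet> b) * (\<xi> \<bullet> b))))"
      by (simp add: f_def prod.distrib)
    also have "(\<Prod>b\<in>Basis. exp (- pi * (z \<bullet> b)\<^sup>2 / u)) = exp (- pi * (norm z)\<^sup>2 / u)"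
      by (simp only: exp_sum[symmetric] finite_Basis power2_norm_Basis sum_distrib_left sum_divide_distrib)
    also have "(\<Prod>b\<in>Basis. cis (- 2 * pi * ((z \<bullet> b) * (\<xi> \<bullet> b)))) = cis (- 2 * pi * (z \<bullet> \<xi>))"
      by (simp only: cis_conv_exp exp_sum[symmetric] finite_Basis euclidean_inner[of z \<xi>] sum_distrib_left of_real_sum)
    finally show "(\<Prod>b\<in>Basis. f b (z \<bullet> b)) = of_real (exp (- pi * (norm z)\<^sup>2 / u)) * cis (- 2 * pi * (z \<bullet> \<xi>))" .
  qed
  also have "(\<Prod>b\<in>Basis. (LINT x|lborel. f b x)) = (\<Prod>b\<in>Basis. of_real (sqrt u * exp (- pi * u * (\<xi> \<bullet> b)\<^sup>2)))"
    unfolding f_def by (simp only: gaussian_fourier_real(2)[OF u])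
  also have "\<dots> = of_real (sqrt u ^ DIM('a) * exp (- pi * u * (norm \<xi>)\<^sup>2))"
    by (simp only: of_real_prod[symmetric] prod.distrib prod_constant exp_sum[symmetric] finite_Basis power2_norm_Basis sum_distrib_left)
  finally show ?thesis .
qed

text \<open>For a non-integrable \<open>f\<close> the Bochner integral is 0 by convention, so the
  estimate can be used before convergence is known.\<close>

lemma norm_integral_le_nn_integral:
  fixes f :: "'a \<Rightarrow> complex"
  shows "ennreal (norm (integral\<^sup>L M f)) \<le> (\<integral>\<^sup>+x. ennreal (norm (f x)) \<partial>M)"
  by (cases "integrable M f") (auto intro: integral_norm_bound_ennreal simp: not_integrable_integral_eq)

text \<open>A Gaussian multiplier is a convolution with a Gaussian: write the multiplier as an
  integral over z and apply Fubini. The normalising power of \<open>sqrt u\<close> stays on the left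
  to avoid a division in \<open>ennreal\<close>.\<close>

lemma heat_smoothing_bound:
  fixes H :: "'a::euclidean_space \<Rightarrow> complex"
  assumes H: "integrable lborel H" and u: "u > 0"
  shows "ennreal (sqrt u ^ DIM('a)) * ennreal (norm (LINT \<xi>|lborel. cis (2 * pi * (x \<bullet> \<xi>)) * (of_real (exp (- pi * u * (norm \<xi>)\<^sup>2)) * H \<xi>)))
    \<le> (\<integral>\<^sup>+z. ennreal (exp (- pi * (norm z)\<^sup>2 / u) * norm (inv_fourier H (x - z))) \<partial>lborel)"
proof -
  have [measurable]: "H \<in> borel_measurable borel" using borel_measurable_integrable[OF H] by simp
  define P where "P \<xi> z = cis (2 * pi * (x \<bullet> \<xi>)) * H \<xi> * (of_real (exp (- pi * (norm z)\<^sup>2 / u)) * cis (- 2 * pi * (z \<bullet> \<xi>)))" for \<xi> z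
  have nP: "norm (P \<xi> z) = norm (H \<xi>) * exp (- pi * (norm z)\<^sup>2 / u)" for \<xi> z by (simp add: P_def norm_mult)
  have fub: "(LINT \<xi>|lborel. LINT z|lborel. P \<xi> z) = (LINT z|lborel. LINT \<xi>|lborel. P \<xi> z)"
  proof (rule fubini_lborel)
    show "case_prod P \<in> borel_measurable (borel \<Otimes>\<^sub>M borel)" unfolding P_def by measurable
    have "(\<integral>\<^sup>+\<xi>. \<integral>\<^sup>+z. ennreal (norm (P \<xi> z)) \<partial>lborel \<partial>lborel) =
       (\<integral>\<^sup>+\<xi>. ennreal (norm (H \<xi>)) \<partial>lborel) * (\<integral>\<^sup>+z. ennreal (exp (- pi * (norm (z::'a))\<^sup>2 / u)) \<partial>lborel)"
      by (simp add: nP ennreal_mult nn_integral_cmult nn_integral_multc)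
    also have "\<dots> < \<infinity>"
      using gaussian_finite[OF u, where 'a = 'a] H unfolding integrable_iff_bounded by (simp add: ennreal_mult_less_top)
    finally show "(\<integral>\<^sup>+\<xi>. \<integral>\<^sup>+z. ennreal (norm (P \<xi> z)) \<partial>lborel \<partial>lborel) < \<infinity>" .
  qed
  have inner1: "(LINT z|lborel. P \<xi> z) = of_real (sqrt u ^ DIM('a)) * (cis (2 * pi * (x \<bullet> \<xi>)) * (of_real (exp (- pi * u * (norm \<xi>)\<^sup>2)) * H \<xi>))" for \<xi>
  proof -
    have "(LINT z|lborel. P \<xi> z) = cis (2 * pi * (x \<bullet> \<xi>)) * H \<xi> * of_real (sqrt u ^ DIM('a) * exp (- pi * u * (norm \<xi>)\<^sup>2))"
      unfolding P_def integral_mult_right_zero gaussian_fourier[OF u] ..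
    then show ?thesis by (simp only: of_real_mult mult_ac)
  qed
  have inner2: "(LINT \<xi>|lborel. P \<xi> z) = of_real (exp (- pi * (norm z)\<^sup>2 / u)) * inv_fourier H (x - z)" for z
  proof -
    have "P \<xi> z = of_real (exp (- pi * (norm z)\<^sup>2 / u)) * (cis (2 * pi * ((x - z) \<bullet> \<xi>)) * H \<xi>)" for \<xi>
    proof -
      have "cis (2 * pi * ((x - z) \<bullet> \<xi>)) = cis (2 * pi * (x \<bullet> \<xi>)) * cis (- 2 * pi * (z \<bullet> \<xi>))"
        by (simp add: cis_mult inner_diff_left algebra_simps)
      then show ?thesis by (simp only: P_def mult_ac)
    qed
    then show ?thesis unfolding inv_fourier_def by (simp only: integral_mult_right_zero)
  qed
  have eq: "of_real (sqrt u ^ DIM('a)) * (LINT \<xi>|lborel. cis (2 * pi * (x \<bullet> \<xi>)) * (of_real (exp (- pi * u * (norm \<xi>)\<^sup>2)) * H \<xi>))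
     = (LINT z|lborel. of_real (exp (- pi * (norm z)\<^sup>2 / u)) * inv_fourier H (x - z))"
    using fub unfolding inner1 inner2 integral_mult_right_zero .
  have "ennreal (sqrt u ^ DIM('a)) * ennreal (norm (LINT \<xi>|lborel. cis (2 * pi * (x \<bullet> \<xi>)) * (of_real (exp (- pi * u * (norm \<xi>)\<^sup>2)) * H \<xi>)))
    = ennreal (norm (of_real (sqrt u ^ DIM('a)) * (LINT \<xi>|lborel. cis (2 * pi * (x \<bullet> \<xi>)) * (of_real (exp (- pi * u * (norm \<xi>)\<^sup>2)) * H \<xi>))))"
    using u by (simp only: norm_mult norm_of_real) (simp add: ennreal_mult)
  also have "\<dots> \<le> (\<integral>\<^sup>+z. ennreal (norm (of_real (exp (- pi * (norm z)\<^sup>2 / u)) * inv_fourier H (x - z))) \<partial>lborel)"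
    unfolding eq by (rule norm_integral_le_nn_integral)
  finally show ?thesis by (simp add: norm_mult)
qed

section \<open>Gamma integrals and the Riesz potential bound\<close>

lemma gamma_integral_scaled:
  assumes a: "a > 0" and c: "c > 0"
  shows "(\<integral>\<^sup>+u. ennreal (indicator {0<..} u * u powr (a - 1) * exp (- c * u)) \<partial>lborel) = ennreal (Gamma a * c powr (- a))"
proof -
  have "ennreal (Gamma a) = (\<integral>\<^sup>+t. ennreal (indicator {0<..} t * t powr (a - 1) * exp (- t)) \<partial>lborel)"
    unfolding Gamma_conv_nn_integral_real[OF a]
    by (intro nn_integral_cong) (auto simp: indicator_def exp_minus field_simps)
  also have "\<dots> = ennreal \<bar>c\<bar> * (\<integral>\<^sup>+u. ennreal (indicator {0<..} (0 + c * u) * (0 + c * u) powr (a - 1) * exp (- (0 + c * u))) \<partial>lborel)"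
    using c by (intro nn_integral_real_affine) auto
  also have "(\<integral>\<^sup>+u. ennreal (indicator {0<..} (0 + c * u) * (0 + c * u) powr (a - 1) * exp (- (0 + c * u))) \<partial>lborel) =
    (\<integral>\<^sup>+u. ennreal (c powr (a - 1)) * ennreal (indicator {0<..} u * u powr (a - 1) * exp (- c * u)) \<partial>lborel)"
    using c by (intro nn_integral_cong) (auto simp: indicator_def powr_mult zero_less_mult_iff simp flip: ennreal_mult)
  also have "\<dots> = ennreal (c powr (a - 1)) * (\<integral>\<^sup>+u. ennreal (indicator {0<..} u * u powr (a - 1) * exp (- c * u)) \<partial>lborel)"
    by (rule nn_integral_cmult) measurable
  finally have eq: "ennreal (Gamma a) = ennreal \<bar>c\<bar> * (ennreal (c powr (a - 1)) * (\<integral>\<^sup>+u. ennreal (indicator {0<..} u * u powr (a - 1) * exp (- c * u)) \<partial>lborel))" .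
  have cc: "c * c powr (a - 1) = c powr a" using c powr_add[of c 1 "a - 1"] by simp
  have "ennreal (Gamma a * c powr (- a)) = ennreal (c powr (- a)) * ennreal (Gamma a)"
    using a by (simp add: mult.commute ennreal_mult Gamma_real_nonneg)
  also have "\<dots> = (ennreal (c powr (- a)) * ennreal (c * c powr (a - 1))) * (\<integral>\<^sup>+u. ennreal (indicator {0<..} u * u powr (a - 1) * exp (- c * u)) \<partial>lborel)"
    unfolding eq using c by (simp add: ennreal_mult mult.assoc)
  also have "ennreal (c powr (- a)) * ennreal (c * c powr (a - 1)) = 1"
    unfolding cc using c by (simp add: powr_minus flip: ennreal_mult)
  finally show ?thesis by simp
qed

text \<open>Substituting 1/u would give the exact constant \<open>Gamma s\<close>. An upper bound of
  the right homogeneity is enough and comes from splitting at u = c, without a nonlinear change of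
  variables.\<close>

lemma inverse_gamma_integral_bound:
  assumes s: "s > 0"
  obtains C where "C \<ge> 0"
    "\<And>c. c > 0 \<Longrightarrow> (\<integral>\<^sup>+u. ennreal (indicator {0<..} u * u powr (- s - 1) * exp (- c / u)) \<partial>lborel) \<le> ennreal (C * c powr (- s))"
proof -
  have 1: "(- s - 1) + real DIM(real) < 0" using s by simp
  obtain C1 where C1: "C1 \<ge> 0" "\<And>\<rho>. \<rho> > 0 \<Longrightarrow>
     outer_integral (\<lambda>x::real. norm x powr (- s - 1)) \<rho> \<le> ennreal (C1 * \<rho> powr (- s - 1 + real DIM(real)))"
    using homogeneous_weight_outside[OF homogeneous_weight_norm_powr 1] by blast
  have 2: "0 + real DIM(real) > 0" by simp
  obtain C2 where C2: "C2 \<ge> 0" "\<And>\<rho>. \<rho> > 0 \<Longrightarrow>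
     inner_integral (\<lambda>x::real. norm x powr 0) \<rho> \<le> ennreal (C2 * \<rho> powr (0 + real DIM(real)))"
    using homogeneous_weight_inside[OF homogeneous_weight_norm_powr 2] by blast
  \<comment> \<open>For \<open>u < c\<close> use \<open>e\<^sup>-\<^sup>t \<le> (S/t)\<^sup>S\<close> with \<open>t = c/u\<close>.\<close>
  define S where "S = s + 1"
  have S: "S > 0" using s by (simp add: S_def)
  show thesis
  proof (rule that[of "C1 + S powr S * C2"])
    show "0 \<le> C1 + S powr S * C2" using C1 C2 by simp
    fix c :: real assume c: "c > 0"
    define A where "A = S powr S * c powr (- S)"
    have A: "A \<ge> 0" by (simp add: A_def)
    have pt: "ennreal (indicator {0<..} u * u powr (- s - 1) * exp (- c / u)) \<le>
      ennreal (norm u powr (- s - 1)) * indicator {x. c \<le> norm x} u + ennreal A * (ennreal (norm u powr 0) * indicator {x. norm x < c} u)" for u :: real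
    proof (cases "u > 0")
      case True
      show ?thesis
      proof (cases "c \<le> u")
        case le: True
        have "u powr (- s - 1) * exp (- c / u) \<le> u powr (- s - 1) * 1"
          using True c by (intro mult_left_mono) auto
        then show ?thesis using True le by (simp add: ennreal_leI)
      next
        case False
        have "c / (u * S) \<le> exp (c / (u * S))" using exp_ge_add_one_self[of "c / (u * S)"] by linarith
        then have "(c / (u * S)) powr S \<le> exp (c / (u * S)) powr S"
          using c True S by (intro powr_mono2) auto
        also have "\<dots> = exp (c / u)" using S True by (simp add: powr_def)
        finally have "inverse (exp (c / u)) \<le> inverse ((c / (u * S)) powr S)"
          using c True S by (intro le_imp_inverse_le) auto
        then have "exp (- c / u) \<le> inverse ((c / (u * S)) powr S)" by (simp add: exp_minus)
        also have "\<dots> = A * u powr S"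
          using c True S by (simp add: A_def powr_divide powr_mult powr_minus field_simps)
        finally have "u powr (- s - 1) * exp (- c / u) \<le> u powr (- s - 1) * (A * u powr S)"
          by (intro mult_left_mono) auto
        also have "\<dots> = A * (u powr (- s - 1) * u powr S)" by (simp only: mult_ac)
        also have "u powr (- s - 1) * u powr S = 1" using True by (simp add: S_def flip: powr_add)
        finally have "u powr (- s - 1) * exp (- c / u) \<le> A" by simp
        then show ?thesis using True False by (simp add: ennreal_leI)
      qed
    qed simp
    have "(\<integral>\<^sup>+u. ennreal (indicator {0<..} u * u powr (- s - 1) * exp (- c / u)) \<partial>lborel) \<le>
      (\<integral>\<^sup>+u. ennreal (norm (u::real) powr (- s - 1)) * indicator {x. c \<le> norm x} u + ennreal A * (ennreal (norm u powr 0) * indicator {x. norm x < c} u) \<partial>lborel)"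
      by (intro nn_integral_mono pt)
    also have "\<dots> = outer_integral (\<lambda>u::real. norm u powr (- s - 1)) c
      + ennreal A * inner_integral (\<lambda>u::real. norm u powr 0) c"
      by (subst nn_integral_add) (auto simp: nn_integral_cmult)
    also have "\<dots> \<le> ennreal (C1 * c powr (- s - 1 + real DIM(real))) + ennreal A * ennreal (C2 * c powr (0 + real DIM(real)))"
      using c by (intro add_mono mult_left_mono C1(2) C2(2)) auto
    also have "\<dots> = ennreal (C1 * c powr (- s) + A * (C2 * c))"
      using c A C1(1) C2(1) by (simp flip: ennreal_mult ennreal_plus)
    also have "C1 * c powr (- s) + A * (C2 * c) = (C1 + S powr S * C2) * c powr (- s)"
    proof -
      have "c powr (- S) * c powr 1 = c powr (- s)" by (simp only: powr_add[symmetric]) (simp add: S_def)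
      then have "A * c = S powr S * c powr (- s)" using c by (simp add: A_def mult.assoc)
      then have "A * (C2 * c) = S powr S * C2 * c powr (- s)" by (simp add: mult_ac)
      then show ?thesis by (simp add: distrib_right)
    qed
    finally show "(\<integral>\<^sup>+u. ennreal (indicator {0<..} u * u powr (- s - 1) * exp (- c / u)) \<partial>lborel) \<le> ennreal ((C1 + S powr S * C2) * c powr (- s))" .
  qed
qed

text \<open>Gaussian subordination: integrate \<open>exp (- \<pi> u |\<xi>|\<^sup>2)\<close> against \<open>u\<close> to the power \<open>\<alpha>/2 - 1\<close> to get a multiple
  of \<open>|\<xi>|\<close> to the power \<open>- \<alpha>\<close>.\<close>

theorem D_op_riesz_bound:
  fixes \<alpha> :: real
  assumes \<alpha>: "0 < \<alpha>" "\<alpha> < DIM('a::euclidean_space)"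
  obtains C where "C > 0" "\<And>(g :: 'a \<Rightarrow> complex) (b :: real) x. \<lbrakk>g \<in> schwartz; b > 0\<rbrakk> \<Longrightarrow>
    ennreal (norm (D_op b g x)) \<le>
      ennreal C * (\<integral>\<^sup>+y. ennreal (norm (x - y) powr (\<alpha> - DIM('a)) * norm (D_op (\<alpha> + b) g y)) \<partial>lborel)"
proof -
  let ?N = "real DIM('a)"
  define a where "a = \<alpha> / 2"
  \<comment> \<open>The power u^(\<alpha>/2 - 1), divided by the heat kernel normalisation u^(N/2)
    with N = \<open>?N\<close>, is u^(-s - 1).\<close>
  define s where "s = (?N - \<alpha>) / 2"
  have a: "a > 0" and s: "s > 0" using \<alpha> by (simp_all add: a_def s_def)
  define J where "J = Gamma a * pi powr (- a)"
  have J: "J > 0" using a by (simp add: J_def Gamma_real_pos)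
  obtain D where D: "D \<ge> 0"
    "\<And>c. c > 0 \<Longrightarrow> (\<integral>\<^sup>+u. ennreal (indicator {0<..} u * u powr (- s - 1) * exp (- c / u)) \<partial>lborel) \<le> ennreal (D * c powr (- s))"
    using inverse_gamma_integral_bound[OF s] by blast
  \<comment> \<open>Division by \<open>J\<close> undoes the subordination constant; the summand 1
    secures \<open>C > 0\<close>, as \<open>D\<close> may be 0.\<close>
  define C where "C = (D * pi powr (- s) + 1) / J"
  show thesis
  proof (rule that[of C])
    show "C > 0" using D J by (simp add: C_def add_nonneg_pos)
    fix g :: "'a \<Rightarrow> complex" and b :: real and x :: 'a
    assume g: "g \<in> schwartz" and b: "b > 0"
    note [measurable] = schwartz_measurable[OF g]
    define H where "H \<xi> = of_real (norm \<xi> powr (\<alpha> + b)) * fourier g \<xi>" for \<xi>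
    have H: "integrable lborel H" unfolding H_def using \<alpha> b by (intro integrable_norm_powr_fourier g) simp
    have [measurable]: "H \<in> borel_measurable borel" unfolding H_def by measurable
    have F: "inv_fourier H = D_op (\<alpha> + b) g" by (simp add: D_op_def H_def[abs_def])
    let ?F = "D_op (\<alpha> + b) g"
    have [measurable]: "?F \<in> borel_measurable borel" unfolding F[symmetric] by measurable
    define k where "k u = indicator {0<..} u * u powr (a - 1)" for u :: real
    have k0: "0 \<le> k u" for u by (simp add: k_def)
    have [measurable]: "k \<in> borel_measurable borel" unfolding k_def by measurable
    have sub: "(\<integral>\<^sup>+u. ennreal (k u * exp (- pi * u * (norm \<xi>)\<^sup>2)) \<partial>lborel) = ennreal (J * norm \<xi> powr (- \<alpha>))" if "\<xi> \<noteq> 0" for \<xi> :: 'a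
    proof -
      have "- pi * u * (norm \<xi>)\<^sup>2 = - (pi * (norm \<xi>)\<^sup>2) * u" for u by simp
      then have "(\<integral>\<^sup>+u. ennreal (k u * exp (- pi * u * (norm \<xi>)\<^sup>2)) \<partial>lborel) = ennreal (Gamma a * (pi * (norm \<xi>)\<^sup>2) powr (- a))"
        unfolding k_def using that by (simp only:) (intro gamma_integral_scaled a, simp)
      also have "(pi * (norm \<xi>)\<^sup>2) powr (- a) = pi powr (- a) * norm \<xi> powr (- \<alpha>)"
        using that by (simp add: powr_mult a_def powr_powr flip: powr_numeral)
      finally show ?thesis by (simp add: J_def mult.assoc)
    qed
    \<comment> \<open>At \<xi> = 0 both sides vanish, because \<open>0 powr e = 0\<close> for every
      \<open>e\<close>.\<close>
    have nH: "J * norm \<xi> powr (- \<alpha>) * norm (H \<xi>) = J * norm (of_real (norm \<xi> powr b) * fourier g \<xi>)" for \<xi>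
      by (cases "\<xi> = 0") (simp_all add: H_def norm_mult powr_add powr_minus field_simps)
    define P where "P \<xi> u = of_real (k u) * (cis (2 * pi * (x \<bullet> \<xi>)) * (of_real (exp (- pi * u * (norm \<xi>)\<^sup>2)) * H \<xi>))" for \<xi> u
    have P1: "(LINT u|lborel. P \<xi> u) = of_real J * (cis (2 * pi * (x \<bullet> \<xi>)) * (of_real (norm \<xi> powr b) * fourier g \<xi>))" for \<xi>
    proof (cases "\<xi> = 0")
      case True
      then show ?thesis by (simp add: P_def H_def)
    next
      case False
      have "has_bochner_integral lborel (\<lambda>u. k u * exp (- pi * u * (norm \<xi>)\<^sup>2)) (J * norm \<xi> powr (- \<alpha>))"
        by (rule has_bochner_integral_nn_integral[OF _ _ _ sub[OF False]]) (use J k0 in auto)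
      then have i: "(LINT u|lborel. k u * exp (- pi * u * (norm \<xi>)\<^sup>2)) = J * norm \<xi> powr (- \<alpha>)"
        by (simp add: has_bochner_integral_iff)
      have "(LINT u|lborel. P \<xi> u) = (LINT u|lborel. (cis (2 * pi * (x \<bullet> \<xi>)) * H \<xi>) * of_real (k u * exp (- pi * u * (norm \<xi>)\<^sup>2)))"
        by (intro Bochner_Integration.integral_cong refl) (simp add: P_def mult_ac)
      also have "\<dots> = cis (2 * pi * (x \<bullet> \<xi>)) * H \<xi> * of_real (J * norm \<xi> powr (- \<alpha>))"
        unfolding integral_mult_right_zero integral_complex_of_real i ..
      also have "\<dots> = of_real J * (cis (2 * pi * (x \<bullet> \<xi>)) * (of_real (norm \<xi> powr (\<alpha> + b) * norm \<xi> powr (- \<alpha>)) * fourier g \<xi>))"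
        by (simp add: H_def mult_ac)
      also have "norm \<xi> powr (\<alpha> + b) * norm \<xi> powr (- \<alpha>) = norm \<xi> powr b" by (simp flip: powr_add)
      finally show ?thesis .
    qed
    \<comment> \<open>Integrating |P| over \<open>u\<close> first gives J |\<xi>|^b times the size
      of the transform of \<open>g\<close>, which is integrable because b > 0.\<close>
    have "(LINT \<xi>|lborel. LINT u|lborel. P \<xi> u) = (LINT u|lborel. LINT \<xi>|lborel. P \<xi> u)"
    proof (rule fubini_lborel)
      show "case_prod P \<in> borel_measurable (borel \<Otimes>\<^sub>M borel)" unfolding P_def by measurable
      have "(\<integral>\<^sup>+u. ennreal (norm (P \<xi> u)) \<partial>lborel) = ennreal (J * norm (of_real (norm \<xi> powr b) * fourier g \<xi>))" for \<xi>
      proof (cases "\<xi> = 0")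
        case True
        then show ?thesis by (simp add: P_def H_def)
      next
        case False
        have "(\<integral>\<^sup>+u. ennreal (norm (P \<xi> u)) \<partial>lborel) = (\<integral>\<^sup>+u. ennreal (k u * exp (- pi * u * (norm \<xi>)\<^sup>2)) * ennreal (norm (H \<xi>)) \<partial>lborel)"
          using k0 by (intro nn_integral_cong) (simp add: P_def norm_mult mult_ac flip: ennreal_mult)
        also have "\<dots> = (\<integral>\<^sup>+u. ennreal (k u * exp (- pi * u * (norm \<xi>)\<^sup>2)) \<partial>lborel) * ennreal (norm (H \<xi>))"
          by (rule nn_integral_multc) measurable
        also have "\<dots> = ennreal (J * norm \<xi> powr (- \<alpha>) * norm (H \<xi>))"
          unfolding sub[OF False] using J by (simp flip: ennreal_mult)
        finally show ?thesis unfolding nH .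
      qed
      then have "(\<integral>\<^sup>+\<xi>. \<integral>\<^sup>+u. ennreal (norm (P \<xi> u)) \<partial>lborel \<partial>lborel) = ennreal J * (\<integral>\<^sup>+\<xi>. ennreal (norm (of_real (norm \<xi> powr b) * fourier g \<xi>)) \<partial>lborel)"
        using J by (simp add: ennreal_mult nn_integral_cmult)
      also have "\<dots> < \<infinity>"
        using integrable_norm_powr_fourier[OF g b] unfolding integrable_iff_bounded by (simp add: ennreal_mult_less_top)
      finally show "(\<integral>\<^sup>+\<xi>. \<integral>\<^sup>+u. ennreal (norm (P \<xi> u)) \<partial>lborel \<partial>lborel) < \<infinity>" .
    qed
    then have eq: "of_real J * D_op b g x = (LINT u|lborel. LINT \<xi>|lborel. P \<xi> u)"
      unfolding P1 integral_mult_right_zero D_op_def inv_fourier_def .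
    let ?L = "\<lambda>u. LINT \<xi>|lborel. cis (2 * pi * (x \<bullet> \<xi>)) * (of_real (exp (- pi * u * (norm \<xi>)\<^sup>2)) * H \<xi>)"
    define G where "G u z = indicator {0<..} u * u powr (- s - 1) * exp (- (pi * (norm z)\<^sup>2) / u)" for u and z :: 'a
    have G0: "0 \<le> G u z" for u z by (simp add: G_def)
    have [measurable]: "case_prod G \<in> borel_measurable (borel \<Otimes>\<^sub>M borel)" unfolding G_def by measurable
    have heat: "ennreal (norm (LINT \<xi>|lborel. P \<xi> u)) \<le> (\<integral>\<^sup>+z. ennreal (G u z * norm (?F (x - z))) \<partial>lborel)" for u
    proof (cases "u > 0")
      case False
      then show ?thesis by (simp add: P_def k_def)
    next
      case True
      let ?r = "k u / sqrt u ^ DIM('a)"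
      have "norm (LINT \<xi>|lborel. P \<xi> u) = k u * norm (?L u)"
        unfolding P_def integral_mult_right_zero using k0 by (simp add: norm_mult)
      also have "\<dots> = ?r * (sqrt u ^ DIM('a) * norm (?L u))" using True by simp
      finally have "ennreal (norm (LINT \<xi>|lborel. P \<xi> u)) = ennreal ?r * (ennreal (sqrt u ^ DIM('a)) * ennreal (norm (?L u)))"
        using True k0 by (simp only: ennreal_mult[symmetric] norm_ge_zero mult_nonneg_nonneg divide_nonneg_nonneg zero_le_power real_sqrt_ge_zero less_imp_le)
      also have "\<dots> \<le> ennreal ?r * (\<integral>\<^sup>+z. ennreal (exp (- pi * (norm z)\<^sup>2 / u) * norm (inv_fourier H (x - z))) \<partial>lborel)"
        by (intro mult_left_mono heat_smoothing_bound H True) simp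
      also have "\<dots> = (\<integral>\<^sup>+z. ennreal ?r * ennreal (exp (- pi * (norm z)\<^sup>2 / u) * norm (inv_fourier H (x - z))) \<partial>lborel)"
        by (rule nn_integral_cmult[symmetric]) measurable
      also have "\<dots> = (\<integral>\<^sup>+z. ennreal (G u z * norm (?F (x - z))) \<partial>lborel)"
      proof (rule nn_integral_cong)
        fix z :: 'a
        have "sqrt u ^ DIM('a) = u powr (?N / 2)"
          using True by (simp add: powr_half_sqrt[symmetric] powr_power)
        then have "?r = u powr (a - 1 - ?N / 2)" using True by (simp add: k_def powr_diff)
        also have "a - 1 - ?N / 2 = - s - 1" by (simp add: a_def s_def field_simps)
        finally have r: "?r = u powr (- s - 1)" .
        show "ennreal ?r * ennreal (exp (- pi * (norm z)\<^sup>2 / u) * norm (inv_fourier H (x - z))) = ennreal (G u z * norm (?F (x - z)))"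
          unfolding r F using True by (simp add: G_def mult.assoc flip: ennreal_mult)
      qed
      finally show ?thesis .
    qed
    have "ennreal J * ennreal (norm (D_op b g x)) = ennreal (norm (LINT u|lborel. LINT \<xi>|lborel. P \<xi> u))"
      unfolding eq[symmetric] using J by (simp add: norm_mult ennreal_mult)
    also have "\<dots> \<le> (\<integral>\<^sup>+u. ennreal (norm (LINT \<xi>|lborel. P \<xi> u)) \<partial>lborel)"
      by (rule norm_integral_le_nn_integral)
    also have "\<dots> \<le> (\<integral>\<^sup>+u. \<integral>\<^sup>+z. ennreal (G u z * norm (?F (x - z))) \<partial>lborel \<partial>lborel)"
      by (intro nn_integral_mono heat)
    also have "\<dots> = (\<integral>\<^sup>+z. \<integral>\<^sup>+u. ennreal (G u z * norm (?F (x - z))) \<partial>lborel \<partial>lborel)"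
      by (rule nn_integral_swap) measurable
    \<comment> \<open>The integral of \<open>G\<close> over \<open>u\<close> is an inverse Gamma
      integral with c = pi |z|^2; positivity of c excludes z = 0, hence the estimate almost
      everywhere.\<close>
    also have "\<dots> \<le> (\<integral>\<^sup>+z. ennreal (J * C) * ennreal (norm z powr (\<alpha> - ?N) * norm (?F (x - z))) \<partial>lborel)"
    proof (rule nn_integral_mono_AE)
      have "AE z in lborel. z \<noteq> (0::'a)" by (rule AE_lborel_singleton)
      then show "AE z in lborel. (\<integral>\<^sup>+u. ennreal (G u z * norm (?F (x - z))) \<partial>lborel) \<le>
        ennreal (J * C) * ennreal (norm z powr (\<alpha> - ?N) * norm (?F (x - z)))"
      proof eventually_elim
        case (elim z)
        have "(\<integral>\<^sup>+u. ennreal (G u z * norm (?F (x - z))) \<partial>lborel) =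
          (\<integral>\<^sup>+u. ennreal (G u z) \<partial>lborel) * ennreal (norm (?F (x - z)))"
          using G0 by (simp add: ennreal_mult nn_integral_multc)
        also have "\<dots> \<le> ennreal (D * (pi * (norm z)\<^sup>2) powr (- s)) * ennreal (norm (?F (x - z)))"
          unfolding G_def using elim by (intro mult_right_mono D(2)) auto
        also have "(pi * (norm z)\<^sup>2) powr (- s) = pi powr (- s) * norm z powr (\<alpha> - ?N)"
        proof -
          have "(norm z)\<^sup>2 = norm z powr 2" using elim by simp
          then have "((norm z)\<^sup>2) powr (- s) = norm z powr (2 * - s)" by (simp only: powr_powr)
          also have "2 * - s = \<alpha> - ?N" by (simp add: s_def field_simps)
          finally show ?thesis by (simp add: powr_mult)
        qed
        also have "ennreal (D * (pi powr (- s) * norm z powr (\<alpha> - ?N))) * ennreal (norm (?F (x - z))) \<le>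
          ennreal (J * C) * ennreal (norm z powr (\<alpha> - ?N) * norm (?F (x - z)))"
        proof -
          have "J * C = D * pi powr (- s) + 1" using J by (simp add: C_def)
          then have "D * pi powr (- s) * (norm z powr (\<alpha> - ?N) * norm (?F (x - z))) \<le> J * C * (norm z powr (\<alpha> - ?N) * norm (?F (x - z)))"
            by (intro mult_right_mono) auto
          then have "ennreal (D * pi powr (- s) * (norm z powr (\<alpha> - ?N) * norm (?F (x - z)))) \<le> ennreal (J * C * (norm z powr (\<alpha> - ?N) * norm (?F (x - z))))"
            by (rule ennreal_leI)
          then show ?thesis using D(1) J \<open>C > 0\<close> by (simp add: mult.assoc flip: ennreal_mult)
        qed
        finally show ?case .
      qed
    qed
    also have "\<dots> = ennreal (J * C) * (\<integral>\<^sup>+z. ennreal (norm z powr (\<alpha> - ?N) * norm (?F (x - z))) \<partial>lborel)"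
      by (rule nn_integral_cmult) measurable
    also have "(\<integral>\<^sup>+z. ennreal (norm z powr (\<alpha> - ?N) * norm (?F (x - z))) \<partial>lborel) =
      (\<integral>\<^sup>+y. ennreal (norm (x - y) powr (\<alpha> - ?N) * norm (?F y)) \<partial>lborel)"
      by (subst nn_integral_reflect[symmetric, of _ x]) auto
    also have "ennreal (J * C) * \<dots> = ennreal J * (ennreal C * \<dots>)"
      using J \<open>C > 0\<close> by (simp add: ennreal_mult mult.assoc)
    finally show "ennreal (norm (D_op b g x)) \<le>
      ennreal C * (\<integral>\<^sup>+y. ennreal (norm (x - y) powr (\<alpha> - ?N) * norm (?F y)) \<partial>lborel)"
      using J by (subst (asm) ennreal_mult_le_mult_iff) auto
  qed
qed

section \<open>The weighted inequality\<close>

lemma weighted_norm_le: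
  assumes q: "q > 0" and a: "a \<ge> 0"
    and le: "(\<integral>\<^sup>+x. ennreal (norm (g x) powr q * w x) \<partial>lborel) \<le> ennreal (a powr q)"
  shows "weighted_norm q w g \<le> ennreal a"
proof -
  obtain J where J: "J \<ge> 0" "(\<integral>\<^sup>+x. ennreal (norm (g x) powr q * w x) \<partial>lborel) = ennreal J"
    using le by (cases "\<integral>\<^sup>+x. ennreal (norm (g x) powr q * w x) \<partial>lborel") (auto simp: top_unique)
  then have "J \<le> a powr q" using le by simp
  then have "J powr (1 / q) \<le> (a powr q) powr (1 / q)" using q J by (intro powr_mono2) auto
  also have "\<dots> = a" using q a by (simp add: powr_powr)
  finally show ?thesis unfolding weighted_norm_def J(2) ennreal_powr_def using J(1) by (simp add: ennreal_leI)
qed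

lemma weighted_norm_finiteE:
  assumes p: "p > 0" and fin: "weighted_norm p w g \<noteq> top"
  obtains a where "a \<ge> 0" "weighted_norm p w g = ennreal a"
    "(\<integral>\<^sup>+x. ennreal (norm (g x) powr p * w x) \<partial>lborel) = ennreal (a powr p)"
proof -
  obtain J where J: "J \<ge> 0" "(\<integral>\<^sup>+x. ennreal (norm (g x) powr p * w x) \<partial>lborel) = ennreal J"
    using fin by (cases "\<integral>\<^sup>+x. ennreal (norm (g x) powr p * w x) \<partial>lborel")
      (auto simp: weighted_norm_def ennreal_powr_def)
  show thesis
  proof (rule that[of "J powr (1 / p)"])
    show "weighted_norm p w g = ennreal (J powr (1 / p))"
      using J(1) unfolding weighted_norm_def J(2) ennreal_powr_def by simp
    show "(\<integral>\<^sup>+x. ennreal (norm (g x) powr p * w x) \<partial>lborel) = ennreal ((J powr (1 / p)) powr p)"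
      using p J by (simp add: powr_powr)
  qed simp
qed

text \<open>For \<open>class_A\<close> the last inequality comes from adding the first two, as
  \<theta>2 >= 0; for \<open>class_B\<close> it is part of the definition.\<close>

lemma class_A_B_bounds:
  assumes "(\<theta>1, \<theta>2, \<theta>3) \<in> class_A n \<union> class_B n"
  shows "\<theta>1 > - (real n - 1)" "\<theta>3 > - 1" "\<theta>1 + \<theta>2 + \<theta>3 > - real n"
  using assms by (auto simp: class_A_def class_B_def)

text \<open>A change of notation: \<beta>_j = -\<theta>_j/q, \<gamma>_j = \<sigma>_j/p, \<mu> = n -
  (s - t), and r conjugate to q, so that r' = q. The class conditions become the upper bounds on
  \<beta> and \<gamma>.\<close>

lemma riesz_bound_weighted:
  fixes n :: nat and p p' q t s \<theta>1 \<theta>2 \<theta>3 \<sigma>1 \<sigma>2 \<sigma>3 \<Theta> :: real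
  assumes n: "n = CARD('m::finite) + 1"
    and pq: "1 < p" "p \<le> q"
    and p': "1 / p + 1 / p' = 1"
    and ts: "t < s" "s < t + real n"
    and \<sigma>: "(- (p' / p) * \<sigma>1, - (p' / p) * \<sigma>2, - (p' / p) * \<sigma>3) \<in> class_A n \<union> class_B n"
    and \<theta>: "(\<theta>1, \<theta>2, \<theta>3) \<in> class_A n \<union> class_B n"
    and \<Theta>: "\<Theta> = s - t + real n * (1 / q - 1 / p)" "\<Theta> \<ge> 0"
      "(\<theta>1 + \<theta>2 + \<theta>3) / q - (\<sigma>1 + \<sigma>2 + \<sigma>3) / p = - \<Theta>"
      "\<theta>1 / q - \<sigma>1 / p \<ge> - ((real n - 1) / real n) * \<Theta>"
      "\<theta>3 / q - \<sigma>3 / p \<ge> - (1 / real n) * \<Theta>"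
  shows "bilinear_bound (q / (q - 1)) p (\<lambda>x y :: (real^'m) \<times> real.
     u_weight (\<theta>1 / q) (\<theta>2 / q) (\<theta>3 / q) x * norm (x - y) powr ((s - t) - real n) *
     u_weight (- (\<sigma>1 / p)) (- (\<sigma>2 / p)) (- (\<sigma>3 / p)) y)"
proof -
  define r where "r = q / (q - 1)"
  have q: "q > 1" using pq by simp
  have r: "r > 1" "1 / r + 1 / q = 1" using q by (auto simp: r_def field_simps)
  have "1 / q \<le> 1 / p" using pq by (intro divide_left_mono) auto
  then have pr: "1 / p + 1 / r \<ge> 1" using r(2) by linarith
  have "1 / p < 1" using pq by simp
  then have "1 / p' > 0" using p' by linarith
  then have p'0: "p' > 0" by (simp add: zero_less_divide_iff)
  note T = class_A_B_bounds[OF \<theta>] and S = class_A_B_bounds[OF \<sigma>]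
  have nm: "real CARD('m) = real n - 1" "real CARD('m) + 1 = real n" using n by simp_all
  have S': "\<sigma>1 / p < (real n - 1) / p'" "\<sigma>3 / p < 1 / p'" "\<sigma>1 / p + \<sigma>2 / p + \<sigma>3 / p < real n / p'"
  proof -
    have "p' * (\<sigma>1 / p) < real n - 1" "p' * (\<sigma>3 / p) < 1" using S by simp_all
    then show "\<sigma>1 / p < (real n - 1) / p'" "\<sigma>3 / p < 1 / p'" using p'0 by (simp_all only: pos_less_divide_eq mult.commute)
    have "- (p' / p) * \<sigma>1 + - (p' / p) * \<sigma>2 + - (p' / p) * \<sigma>3 = - (p' * (\<sigma>1 / p + \<sigma>2 / p + \<sigma>3 / p))"
      by (simp add: algebra_simps)
    then have "p' * (\<sigma>1 / p + \<sigma>2 / p + \<sigma>3 / p) < real n" using S(3) by linarith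
    then show "\<sigma>1 / p + \<sigma>2 / p + \<sigma>3 / p < real n / p'" using p'0 by (simp only: pos_less_divide_eq mult.commute)
  qed
  have "bilinear_bound r p (\<lambda>x y :: (real^'m) \<times> real.
     u_weight (- (- (\<theta>1 / q))) (- (- (\<theta>2 / q))) (- (- (\<theta>3 / q))) x * norm (x - y) powr (- (real n - (s - t))) *
     u_weight (- (\<sigma>1 / p)) (- (\<sigma>2 / p)) (- (\<sigma>3 / p)) y)"
  proof (rule u_weight_stein_weiss[OF r(1) pq(1) pr r(2) p'])
    show "0 < real n - (s - t)" "real n - (s - t) < real CARD('m) + 1" using ts nm by linarith+
    have "- \<theta>1 / q < (real n - 1) / q" "- \<theta>3 / q < 1 / q" "- (\<theta>1 + \<theta>2 + \<theta>3) / q < real n / q"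
      by (rule divide_strict_right_mono; use T q in linarith)+
    then show "- (\<theta>1 / q) < real CARD('m) / q" "- (\<theta>3 / q) < 1 / q"
      "- (\<theta>1 / q) + - (\<theta>2 / q) + - (\<theta>3 / q) < (real CARD('m) + 1) / q"
      unfolding nm by (simp_all add: add_divide_distrib diff_divide_distrib)
    show "\<sigma>1 / p < real CARD('m) / p'" "\<sigma>3 / p < 1 / p'" "\<sigma>1 / p + \<sigma>2 / p + \<sigma>3 / p < (real CARD('m) + 1) / p'"
      using S' unfolding nm by auto
    show "0 \<le> \<Theta>" by (rule \<Theta>(2))
    show "\<Theta> = - (\<theta>1 / q) + - (\<theta>2 / q) + - (\<theta>3 / q) + (\<sigma>1 / p + \<sigma>2 / p + \<sigma>3 / p)"
      using \<Theta>(3) by (simp add: add_divide_distrib)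
    have e: "2 - 1 / p - 1 / r = 1 + (1 / q - 1 / p)" using r(2) by linarith
    show "\<Theta> + (real n - (s - t)) = (real CARD('m) + 1) * (2 - 1 / p - 1 / r)"
      unfolding nm \<Theta>(1) e by (simp add: algebra_simps)
    show "- (\<theta>1 / q) + \<sigma>1 / p \<le> real CARD('m) / (real CARD('m) + 1) * \<Theta>"
      "- (\<theta>3 / q) + \<sigma>3 / p \<le> 1 / (real CARD('m) + 1) * \<Theta>"
      unfolding nm using \<Theta>(4,5) by auto
  qed
  then show ?thesis by (simp add: r_def)
qed

theorem theorem1p2:
  fixes n :: nat
    and p p' q t s \<theta>1 \<theta>2 \<theta>3 \<sigma>1 \<sigma>2 \<sigma>3 \<Theta> \<tau> :: real
  assumes n: "n = CARD('m::finite) + 1"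
    and pq: "1 < p" "p \<le> q"
    and p': "1 / p + 1 / p' = 1"
    and ts: "t < s" "s < t + real n"
    and \<sigma>: "(- (p' / p) * \<sigma>1, - (p' / p) * \<sigma>2, - (p' / p) * \<sigma>3) \<in> class_A n \<union> class_B n"
    and \<theta>: "(\<theta>1, \<theta>2, \<theta>3) \<in> class_A n \<union> class_B n"
    and \<Theta>: "\<Theta> = s - t + real n * (1 / q - 1 / p)"
    and \<tau>: "\<tau> = max (- real n) (- t)"
    and cases:
      "(\<Theta> = 0 \<and> \<theta>1 / q = \<sigma>1 / p \<and> \<theta>2 / q = \<sigma>2 / p \<and> \<theta>3 / q = \<sigma>3 / p) \<or>
       (\<Theta> > 0 \<and>
        (\<theta>1 + \<theta>2 + \<theta>3) / q - (\<sigma>1 + \<sigma>2 + \<sigma>3) / p = - \<Theta> \<and>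
        \<theta>1 / q - \<sigma>1 / p > - ((real n - 1) / real n) * \<Theta> \<and>
        \<theta>3 / q - \<sigma>3 / p > - (1 / real n) * \<Theta>)"
  shows "\<exists>C::real. C > 0 \<and>
    (\<forall>f \<in> (test_class \<tau> :: ((real^'m) \<times> real \<Rightarrow> complex) set). \<forall>b g. D_rep \<tau> f b g \<longrightarrow>
       weighted_norm q (u_weight \<theta>1 \<theta>2 \<theta>3) (D_op (t + b) g)
         \<le> ennreal C * weighted_norm p (u_weight \<sigma>1 \<sigma>2 \<sigma>3) (D_op (s + b) g))"
proof -
  have q: "q > 1" "q > 0" "p > 0" using pq by auto
  define \<alpha> where "\<alpha> = s - t"
  have dim: "DIM((real^'m) \<times> real) = n" using n by simp
  let ?\<omega> = "u_weight (\<theta>1 / q) (\<theta>2 / q) (\<theta>3 / q) :: (real^'m) \<times> real \<Rightarrow> real"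
  let ?\<nu> = "u_weight (- (\<sigma>1 / p)) (- (\<sigma>2 / p)) (- (\<sigma>3 / p)) :: (real^'m) \<times> real \<Rightarrow> real"
  define K where "K x y = ?\<omega> x * norm (x - y) powr (\<alpha> - real n) * ?\<nu> y" for x y
  \<comment> \<open>In case (i) \<Theta> and all differences of exponents are 0, so both cases meet
    in the non-strict form.\<close>
  have \<Theta>': "\<Theta> \<ge> 0" "(\<theta>1 + \<theta>2 + \<theta>3) / q - (\<sigma>1 + \<sigma>2 + \<sigma>3) / p = - \<Theta>"
      "\<theta>1 / q - \<sigma>1 / p \<ge> - ((real n - 1) / real n) * \<Theta>"
      "\<theta>3 / q - \<sigma>3 / p \<ge> - (1 / real n) * \<Theta>"
    using cases by (auto simp: add_divide_distrib)
  have bb: "bilinear_bound (q / (q - 1)) p K"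
    unfolding K_def \<alpha>_def by (rule riesz_bound_weighted[OF n pq p' ts \<sigma> \<theta> \<Theta> \<Theta>'])
  have "(\<lambda>z. ?\<omega> (fst z) * norm (fst z - snd z) powr (\<alpha> - real n) * ?\<nu> (snd z)) \<in> borel_measurable (borel \<Otimes>\<^sub>M borel)"
    by measurable
  then have K: "kernel K" by (simp add: kernel_def K_def u_weight_nonneg split_def)
  have r: "q / (q - 1) > 1" "1 / q + 1 / (q / (q - 1)) = 1" using q by (auto simp: field_simps)
  obtain C0 where C0: "C0 \<ge> 0"
    "\<And>h \<phi> b. \<lbrakk>h \<in> borel_measurable borel; \<And>y. 0 \<le> h y; \<phi> \<in> borel_measurable borel; \<And>x. 0 \<le> \<phi> x; 0 \<le> b;
       power_integral p h \<le> ennreal (b powr p);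
       AE x in lborel. ennreal (\<phi> x) \<le> (\<integral>\<^sup>+y. ennreal (K x y * h y) \<partial>lborel)\<rbrakk> \<Longrightarrow>
       power_integral q \<phi> \<le> ennreal ((C0 * b) powr q)"
    by (rule bilinear_bound_dual[OF bb K r(1) q(3) r(2)]) blast
  have \<alpha>: "0 < \<alpha>" "\<alpha> < real DIM((real^'m) \<times> real)" using ts unfolding dim by (auto simp: \<alpha>_def)
  obtain C1 where C1: "C1 > 0" "\<And>(g :: (real^'m) \<times> real \<Rightarrow> complex) (b :: real) x. \<lbrakk>g \<in> schwartz; b > 0\<rbrakk> \<Longrightarrow>
    ennreal (norm (D_op b g x)) \<le>
      ennreal C1 * (\<integral>\<^sup>+y. ennreal (norm (x - y) powr (\<alpha> - real n) * norm (D_op (\<alpha> + b) g y)) \<partial>lborel)"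
    using D_op_riesz_bound[OF \<alpha>] unfolding dim by blast
  show ?thesis
  proof (intro exI[of _ "C0 * C1 + 1"] conjI ballI allI impI)
    \<comment> \<open>The summand 1 keeps the constant positive when \<open>C0\<close> is 0. An
      infinite right-hand side needs this, since 0 times \<open>top\<close> is 0 in
      \<open>ennreal\<close>.\<close>
    show "C0 * C1 + 1 > 0" using C0(1) C1(1) by (simp add: add_nonneg_pos)
    fix f :: "(real^'m) \<times> real \<Rightarrow> complex" and b g
    assume rep: "D_rep \<tau> f b g"
    \<comment> \<open>b > \<tau> >= -t gives the positive order required by the subordination
      argument.\<close>
    then have g: "g \<in> schwartz" and tb: "t + b > 0" by (auto simp: D_rep_def \<tau>)
    note [measurable] = schwartz_measurable[OF g]
    define Ft where "Ft = D_op (t + b) g"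
    define Fs where "Fs = D_op (s + b) g"
    have [measurable]: "Ft \<in> borel_measurable borel" "Fs \<in> borel_measurable borel"
      unfolding Ft_def Fs_def D_op_def by measurable
    have riesz: "ennreal (norm (Ft x)) \<le> ennreal C1 * (\<integral>\<^sup>+y. ennreal (norm (x - y) powr (\<alpha> - real n) * norm (Fs y)) \<partial>lborel)" for x
    proof -
      have "\<alpha> + (t + b) = s + b" by (simp add: \<alpha>_def)
      from C1(2)[OF g tb, of x, unfolded this] show ?thesis unfolding Ft_def Fs_def .
    qed
    let ?u\<theta> = "u_weight \<theta>1 \<theta>2 \<theta>3 :: (real^'m) \<times> real \<Rightarrow> real"
    let ?u\<sigma> = "u_weight \<sigma>1 \<sigma>2 \<sigma>3 :: (real^'m) \<times> real \<Rightarrow> real"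
    have "weighted_norm q ?u\<theta> Ft \<le> ennreal (C0 * C1 + 1) * weighted_norm p ?u\<sigma> Fs"
    proof (cases "weighted_norm p ?u\<sigma> Fs = top")
      case True
      then show ?thesis using C0(1) C1(1) by (simp add: ennreal_mult_top add_nonneg_pos)
    next
      case False
      obtain A where A: "A \<ge> 0" "weighted_norm p ?u\<sigma> Fs = ennreal A"
        "(\<integral>\<^sup>+x. ennreal (norm (Fs x) powr p * ?u\<sigma> x) \<partial>lborel) = ennreal (A powr p)"
        by (rule weighted_norm_finiteE[OF q(3) False])
      \<comment> \<open>\<open>h\<close> absorbs the weight, so that its p-norm is the weighted norm
        on the right; \<open>\<phi>\<close> does the same on the left, and its division by
        \<open>C1\<close> removes the constant from the Riesz bound.\<close>
      define h where "h y = norm (Fs y) * u_weight (\<sigma>1 / p) (\<sigma>2 / p) (\<sigma>3 / p) y" for y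
      define \<phi> where "\<phi> x = ?\<omega> x * norm (Ft x) / C1" for x
      have hp: "h y powr p = norm (Fs y) powr p * ?u\<sigma> y" for y
        using q(3) by (simp add: h_def powr_mult u_weight_nonneg u_weight_powr)
      have \<phi>q: "norm (Ft x) powr q * ?u\<theta> x = (C1 * \<phi> x) powr q" for x
        using q C1(1) by (simp add: \<phi>_def powr_mult u_weight_nonneg u_weight_powr mult.commute)
      have "power_integral q \<phi> \<le> ennreal ((C0 * A) powr q)"
      proof (rule C0(2)[of h])
        show "h \<in> borel_measurable borel" "\<phi> \<in> borel_measurable borel" unfolding h_def \<phi>_def by measurable
        show "0 \<le> h y" for y by (simp add: h_def u_weight_nonneg)
        show "0 \<le> \<phi> x" for x using C1(1) by (simp add: \<phi>_def u_weight_nonneg)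
        show "power_integral p h \<le> ennreal (A powr p)" unfolding hp A(3) ..
        have "ennreal (\<phi> x) \<le> (\<integral>\<^sup>+y. ennreal (K x y * h y) \<partial>lborel)" for x
        proof -
          have "ennreal (\<phi> x) = ennreal (?\<omega> x / C1) * ennreal (norm (Ft x))"
            using C1(1) by (simp add: \<phi>_def u_weight_nonneg flip: ennreal_mult)
          also have "\<dots> \<le> ennreal (?\<omega> x / C1) * (ennreal C1 * (\<integral>\<^sup>+y. ennreal (norm (x - y) powr (\<alpha> - real n) * norm (Fs y)) \<partial>lborel))"
            by (intro mult_left_mono riesz) simp
          also have "\<dots> = ennreal (?\<omega> x) * (\<integral>\<^sup>+y. ennreal (norm (x - y) powr (\<alpha> - real n) * norm (Fs y)) \<partial>lborel)"
            using C1(1) by (simp add: u_weight_nonneg mult.assoc[symmetric] flip: ennreal_mult)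
          also have "\<dots> = (\<integral>\<^sup>+y. ennreal (?\<omega> x) * ennreal (norm (x - y) powr (\<alpha> - real n) * norm (Fs y)) \<partial>lborel)"
            by (rule nn_integral_cmult[symmetric]) measurable
          also have "\<dots> = (\<integral>\<^sup>+y. ennreal (K x y * h y) \<partial>lborel)"
          proof (rule nn_integral_cong_AE)
            \<comment> \<open>\<open>?\<nu>\<close> is the reciprocal of the weight in
              \<open>h\<close> except where y' = 0 or y_n = 0; there both are 0 by the convention
              for \<open>powr\<close>, so the identity holds only almost everywhere.\<close>
            show "AE y in lborel. ennreal (?\<omega> x) * ennreal (norm (x - y) powr (\<alpha> - real n) * norm (Fs y)) = ennreal (K x y * h y)"
              using AE_fst_neq[of 0] AE_snd_neq[of 0]
            proof eventually_elim
              case (elim y)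
              then have "y \<noteq> 0" by auto
              then have "?\<nu> y * u_weight (\<sigma>1 / p) (\<sigma>2 / p) (\<sigma>3 / p) y = 1"
                using elim by (simp add: u_weight_def powr_minus field_simps)
              then have "K x y * h y = ?\<omega> x * (norm (x - y) powr (\<alpha> - real n) * norm (Fs y))"
                by (simp add: K_def h_def mult_ac)
              then show ?case by (simp add: u_weight_nonneg ennreal_mult)
            qed
          qed
          finally show ?thesis .
        qed
        then show "AE x in lborel. ennreal (\<phi> x) \<le> (\<integral>\<^sup>+y. ennreal (K x y * h y) \<partial>lborel)" by simp
      qed (rule A(1))
      note \<phi>le = this
      have [measurable]: "\<phi> \<in> borel_measurable borel" unfolding \<phi>_def by measurable
      have \<phi>0: "0 \<le> \<phi> x" for x using C1(1) by (simp add: \<phi>_def u_weight_nonneg)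
      have "(\<integral>\<^sup>+x. ennreal (norm (Ft x) powr q * ?u\<theta> x) \<partial>lborel) = (\<integral>\<^sup>+x. ennreal (C1 powr q) * ennreal (\<phi> x powr q) \<partial>lborel)"
        unfolding \<phi>q using C1(1) \<phi>0 by (intro nn_integral_cong) (simp add: powr_mult flip: ennreal_mult)
      also have "\<dots> = ennreal (C1 powr q) * power_integral q \<phi>"
        by (rule nn_integral_cmult) measurable
      also have "\<dots> \<le> ennreal (C1 powr q) * ennreal ((C0 * A) powr q)" by (intro mult_left_mono \<phi>le) simp
      also have "\<dots> = ennreal ((C0 * C1 * A) powr q)"
        using C0(1) C1(1) A(1) by (simp add: powr_mult mult_ac flip: ennreal_mult)
      finally have "weighted_norm q ?u\<theta> Ft \<le> ennreal (C0 * C1 * A)"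
        using C0(1) C1(1) A(1) q by (intro weighted_norm_le) auto
      also have "\<dots> \<le> ennreal ((C0 * C1 + 1) * A)" using A(1) by (intro ennreal_leI) (simp add: distrib_right)
      also have "\<dots> = ennreal (C0 * C1 + 1) * ennreal A" using C0(1) C1(1) A(1) by (simp add: ennreal_mult)
      finally show ?thesis unfolding A(2) .
    qed
    then show "weighted_norm q (u_weight \<theta>1 \<theta>2 \<theta>3) (D_op (t + b) g)
         \<le> ennreal (C0 * C1 + 1) * weighted_norm p (u_weight \<sigma>1 \<sigma>2 \<sigma>3) (D_op (s + b) g)"
      unfolding Ft_def Fs_def .
  qed
qed

end
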